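(* Let $n\ge3$, let $k$ be an integer with $0\le k\le n+1$, let $c\in\mathbb{R}$ with $c\ne0$, and let $X^n=X^n_{c,k}$. Let $P\subset X^n$ be a convex, triangulated polytope in $X^n$. Then $P$ is first-order rigid in $X^n$; that is, the bar-and-joint framework in $X^n$ formed by the vertices and edges of $P$ is first-order rigid in $X^n$.
   Context: For $x,y\in\mathbb{R}^{n+1}$ put $$\langle x,y\rangle_k=x_1y_1+\cdots+x_{n-k+1}y_{n-k+1}-x_{n-k+2}y_{n-k+2}-\cdots-x_{n+1}y_{n+1},$$ and let $X^n_{c,k}=\{x\in\mathbb{R}^{n+1}:\langle x,x\rangle_k=c,\ x_{n+1}>0\}$. (Hyperbolic space is $k=1,c=-1$; exterior hyperbolic space is $k=1,c=1$; the open upper hemisphere of the unit sphere is $k=0,c=1$.) Let $\mathbb{E}^n=\{x\in\mathbb{R}^{n+1}:x_{n+1}=1\}$ and let $\psi_{\mathbb{E}}:X^n\to\mathbb{E}^n$, $\psi_{\mathbb{E}}(x)=x/x_{n+1}$, be central projection. A line of $X^n$ is the intersection of $X^n$ with a 2-dimensional linear subspace of $\mathbb{R}^{n+1}$. A set $S\subset X^n$ is convex if $L\cap S$ is connected for every line $L$ of $X^n$; equivalently, $\psi_{\mathbb{E}}(S)\subset\mathbb{E}^n$ is convex. A convex, triangulated polytope in $X^n$ is a set $P\subset X^n$ such that $\psi_{\mathbb{E}}(P)$ is an $n$-dimensional convex polytope in the affine space $\mathbb{E}^n$ all of whose 2-dimensional faces are triangles; the vertices and edges of $P$ are those corresponding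 under $\psi_{\mathbb{E}}$ to the vertices and edges of $\psi_{\mathbb{E}}(P)$. A bar-and-joint framework $G(p)$ in $X^n$ is a finite graph $G=(V,E)$ together with a map $p:V\to X^n$; write $p_i=p(i)$, $u_i=u(i)$. A first-order motion of $G(p)$ in $X^n$ is a map $u:V\to\mathbb{R}^{n+1}$ with $\langle p_i,u_j\rangle_k+\langle p_j,u_i\rangle_k=0$ for all $\{i,j\}\in E$ and $\langle p_i,u_i\rangle_k=0$ for all $i\in V$. A trivial first-order motion of $X^n$ is a map $w:X^n\to\mathbb{R}^{n+1}$ with $\langle x,w(y)\rangle_k+\langle y,w(x)\rangle_k=0$ and $\langle z,w(z)\rangle_k=0$ for all $x,y,z\in X^n$. $G(p)$ is first-order rigid in $X^n$ if every first-order motion $u$ of $G(p)$ is the restriction of a trivial first-order motion $w$ of $X^n$, i.e. $u_i=w(p_i)$ for all $i\in V$. *)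

theory Defs
  imports "HOL-Analysis.Analysis"
begin

text \<open>
  The space \<open>\<real>\<^sup>n\<^sup>+\<^sup>1\<close> is \<open>real ^ 'm\<close> for a finite, linearly ordered index type \<open>'m\<close> with
  \<open>CARD('m) = n + 1\<close>; the order on \<open>'m\<close> is the order of the coordinates
  \<open>x\<^sub>1, \<dots>, x\<^sub>n\<^sub>+\<^sub>1\<close>. The numeral types provide such an index type for every \<open>n\<close>.
\<close>

text \<open>The position in \<open>{1..n+1}\<close> of an index:\<close>

definition coord_pos :: "'m::{finite,linorder} \<Rightarrow> nat" where
  "coord_pos i = card {j. j \<le> i}"

definition last_coord :: "real ^ ('m::{finite,linorder}) \<Rightarrow> real" where
  "last_coord x = x $ Max UNIV"

text \<open>
  The subtraction is \<open>(n + 1) - k\<close>, so it does not truncate for \<open>k \<le> n + 1\<close>.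
\<close>

definition form ::
  "nat \<Rightarrow> real ^ ('m::{finite,linorder}) \<Rightarrow> real ^ ('m::{finite,linorder}) \<Rightarrow> real" where
  "form k x y =
     (\<Sum>i | coord_pos i \<le> CARD('m) - k. x $ i * y $ i)
   - (\<Sum>i | CARD('m) - k < coord_pos i. x $ i * y $ i)"

definition space_X :: "real \<Rightarrow> nat \<Rightarrow> (real ^ ('m::{finite,linorder})) set" where
  "space_X c k = {x. form k x x = c \<and> last_coord x > 0}"

definition central_proj :: "real ^ ('m::{finite,linorder}) \<Rightarrow> real ^ ('m::{finite,linorder})" where
  "central_proj x = x /\<^sub>R last_coord x"

text \<open>
  The image of \<open>P\<close> under the central projection lies in the affine hyperplane
  \<open>x\<^sub>n\<^sub>+\<^sub>1 = 1\<close>, and \<open>CARD('m) - 1 = n\<close>.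
\<close>

definition convex_triangulated_polytope ::
  "real \<Rightarrow> nat \<Rightarrow> (real ^ ('m::{finite,linorder})) set \<Rightarrow> bool" where
  "convex_triangulated_polytope c k P \<longleftrightarrow>
     P \<subseteq> space_X c k \<and>
     polytope (central_proj ` P) \<and>
     aff_dim (central_proj ` P) = int CARD('m) - 1 \<and>
     (\<forall>F. F face_of (central_proj ` P) \<and> aff_dim F = 2 \<longrightarrow> 2 simplex F)"

text \<open>
  For \<open>c \<noteq> 0\<close> the central projection is injective on \<open>space_X c k\<close>, so vertices and edges
  of \<open>P\<close> correspond one-to-one to those of its image. An edge is represented by the set of
  its two endpoints.
\<close>

definition polytope_vertices ::
  "(real ^ ('m::{finite,linorder})) set \<Rightarrow> (real ^ ('m::{finite,linorder})) set" where
  "polytope_vertices P = {v \<in> P. central_proj v extreme_point_of (central_proj ` P)}"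

definition polytope_edges ::
  "(real ^ ('m::{finite,linorder})) set \<Rightarrow> (real ^ ('m::{finite,linorder})) set set" where
  "polytope_edges P =
     {{v, w} | v w. v \<in> polytope_vertices P \<and> w \<in> polytope_vertices P \<and>
        closed_segment (central_proj v) (central_proj w) edge_of (central_proj ` P)}"

definition framework ::
  "real \<Rightarrow> nat \<Rightarrow> 'v set \<Rightarrow> 'v set set \<Rightarrow> ('v \<Rightarrow> real ^ ('m::{finite,linorder})) \<Rightarrow> bool" where
  "framework c k V E p \<longleftrightarrow>
     finite V \<and> (\<forall>e\<in>E. e \<subseteq> V \<and> card e = 2) \<and> p ` V \<subseteq> space_X c k"

definition first_order_motion ::
  "nat \<Rightarrow> 'v set \<Rightarrow> 'v set set \<Rightarrow> ('v \<Rightarrow> real ^ ('m::{finite,linorder})) \<Rightarrow>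
   ('v \<Rightarrow> real ^ ('m::{finite,linorder})) \<Rightarrow> bool" where
  "first_order_motion k V E p u \<longleftrightarrow>
     (\<forall>i j. {i, j} \<in> E \<longrightarrow> form k (p i) (u j) + form k (p j) (u i) = 0) \<and>
     (\<forall>i\<in>V. form k (p i) (u i) = 0)"

text \<open>Only the values of \<open>w\<close> on \<open>space_X c k\<close> are relevant.\<close>

definition trivial_motion ::
  "real \<Rightarrow> nat \<Rightarrow> (real ^ ('m::{finite,linorder}) \<Rightarrow> real ^ ('m::{finite,linorder})) \<Rightarrow> bool" where
  "trivial_motion c k w \<longleftrightarrow>
     (\<forall>x\<in>space_X c k. \<forall>y\<in>space_X c k. form k x (w y) + form k y (w x) = 0) \<and>
     (\<forall>z\<in>space_X c k. form k z (w z) = 0)"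

definition first_order_rigid ::
  "real \<Rightarrow> nat \<Rightarrow> 'v set \<Rightarrow> 'v set set \<Rightarrow> ('v \<Rightarrow> real ^ ('m::{finite,linorder})) \<Rightarrow> bool" where
  "first_order_rigid c k V E p \<longleftrightarrow>
     framework c k V E p \<and>
     (\<forall>u. first_order_motion k V E p u \<longrightarrow>
        (\<exists>w. trivial_motion c k w \<and> (\<forall>i\<in>V. u i = w (p i))))"

end

(* First-order rigidity is invariant under central projection, so the problem concerns a polytope Q in an
   affine hyperplane missing the origin, with a linear functional g i attached to each vertex i;
   rigidity means that g is given by an alternating form.

   For 3-polytopes whose faces are rigid plates, every corner of a face has an angular velocity,
   and the velocities at the two ends and on the two sides of an edge differ by multiples of that
   edge. Measure the closed polygons that these velocities trace around each vertex and around
   each face by signed area. The contributions cancel edge by edge, so the total is 0, while each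
   single area is nonpositive by a discrete Minkowski inequality, with equality only if the
   polygon is a point. Hence all angular velocities agree. This is a discrete form of Blaschke's
   proof of the rigidity of convex surfaces and needs no Euler formula.

   In dimension at least 4 the facets are rigid by induction, so the vertex figure at each vertex
   is a framework with rigid 2-faces; by induction it is rigid, and hence so is each vertex star.
   A 2-face lies in two facets, which forces the stars of adjacent vertices to agree. *)

theory Submission
  imports Defs
begin

section \<open>Convex cycles in the plane\<close>

text \<open>A motion \<open>u\<close> enters only through the functional \<open>form k (u i)\<close>
  at each vertex, suitably scaled. The edge conditions make these functionals skew on adjacent
  pairs, so the signature disappears and a metric may be chosen freely later. The obstacle to
  induction is that triangular 2-faces are not inherited: a 2-face of a vertex figure is cut from a
  3-face, and an octahedral 3-face already gives a quadrilateral. What does pass on, once the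
  3-faces are rigid, is that the functionals on each 2-face come from an alternating form. This
  condition, \<open>plate\<close>, is therefore the hypothesis throughout; triangles supply it for
  the given polytope. A plate controls displacements within the plane of its face only, so a face
  with more than three vertices may still bend. This is why angular velocities belong to corners and
  why polygons around faces are needed beside those around vertices. Each such polygon has edges
  parallel to those of a convex one: the face itself, or the face dual to the vertex in the polar
  polytope. The Minkowski inequality is applicable because their mixed area vanishes.\<close>

lemma finite_linear_functionals_common_nonzero:
  fixes F :: "('a::real_vector \<Rightarrow> real) set"
  assumes "finite F" and "\<And>f. f \<in> F \<Longrightarrow> linear f" and "\<And>f. f \<in> F \<Longrightarrow> \<exists>x. f x \<noteq> 0"
  shows "\<exists>a. \<forall>f\<in>F. f a \<noteq> 0"
  using assms
proof (induction F rule: finite_induct)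
  case empty
  then show ?case by simp
next
  case (insert f F)
  then obtain a where a: "\<forall>g\<in>F. g a \<noteq> 0" by auto
  from insert.prems obtain b where b: "f b \<noteq> 0" by auto
  \<comment> \<open>Along the line \<open>a + t *\<^sub>R b\<close> a functional that is not
    constant vanishes for a single \<open>t\<close>; finitely many values are excluded.\<close>
  let ?bad = "insert (- f a / f b) ((\<lambda>g. - g a / g b) ` F)"
  have "finite ?bad" using insert.hyps by simp
  then obtain t :: real where t: "t \<notin> ?bad"
    using ex_new_if_finite infinite_UNIV_char_0 by blast
  have "g (a + t *\<^sub>R b) \<noteq> 0" if "g \<in> insert f F" for g
  proof -
    have lin: "linear g" using insert.prems that by auto
    have eq: "g (a + t *\<^sub>R b) = g a + t * g b"
      by (simp add: linear_add[OF lin] linear_scale[OF lin])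
    show ?thesis
    proof (cases "g b = 0")
      case True
      then have "g \<in> F" using that b by auto
      then show ?thesis using eq True a by simp
    next
      case False
      have "t \<noteq> - g a / g b" using t that by auto
      then show ?thesis using eq False by (simp add: field_simps add_eq_0_iff)
    qed
  qed
  then show ?case by blast
qed

text \<open>\<open>\<alpha>\<close> is the area form of a plane, possibly pulled back from a
  quotient; \<open>plucker\<close> says that its rank is at most two. The edge relations are stated
  after pairing with \<open>\<alpha>\<close>, so they need to hold only modulo its radical, as
  happens for the polygons at vertices. \<open>\<eta>\<close> is a strictly convex polygon run
  through counterclockwise; the edge \<open>e q\<close> ends at the corner \<open>\<eta> q\<close>,
  and \<open>e (nx q)\<close> leaves it.\<close>

locale convex_cycle =
  fixes \<alpha> :: "'a::real_vector \<Rightarrow> 'a \<Rightarrow> real" and J :: "'j set" and nx :: "'j \<Rightarrow> 'j"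
    and e \<eta> :: "'j \<Rightarrow> 'a" and \<kappa> :: "'j \<Rightarrow> real"
  assumes bil: "bilinear \<alpha>" and alt: "\<And>x. \<alpha> x x = 0"
    and plucker: "\<And>x y z u. \<alpha> x y * \<alpha> z u - \<alpha> x z * \<alpha> y u + \<alpha> x u * \<alpha> y z = 0"
    and fin: "finite J" and ne: "J \<noteq> {}"
    and nx: "bij_betw nx J J"
    and turn: "\<And>q. q \<in> J \<Longrightarrow> \<alpha> (e q) (e (nx q)) > 0"
    and kap: "\<And>q. q \<in> J \<Longrightarrow> \<kappa> q > 0"
    and step: "\<And>q x. q \<in> J \<Longrightarrow> \<alpha> (\<eta> (nx q) - \<eta> q) x = \<kappa> (nx q) * \<alpha> (e (nx q)) x"
    and cvx: "\<And>q r. q \<in> J \<Longrightarrow> r \<in> J \<Longrightarrow> r \<noteq> q \<Longrightarrow> r \<noteq> nx q \<Longrightarrow> \<alpha> (e (nx q)) (\<eta> r - \<eta> q) > 0"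
begin

lemma a_simps:
  "\<alpha> (x + y) z = \<alpha> x z + \<alpha> y z" "\<alpha> z (x + y) = \<alpha> z x + \<alpha> z y"
  "\<alpha> (x - y) z = \<alpha> x z - \<alpha> y z" "\<alpha> z (x - y) = \<alpha> z x - \<alpha> z y"
  "\<alpha> (c *\<^sub>R x) z = c * \<alpha> x z" "\<alpha> z (c *\<^sub>R x) = c * \<alpha> z x"
  using bilinear_ladd[OF bil] bilinear_radd[OF bil] bilinear_lsub[OF bil] bilinear_rsub[OF bil]
    bilinear_lmul[OF bil] bilinear_rmul[OF bil] by simp_all

lemma skew: "\<alpha> x y = - \<alpha> y x"
proof -
  have "\<alpha> (x + y) (x + y) = 0" by (rule alt)
  then have "\<alpha> x x + \<alpha> y x + (\<alpha> x y + \<alpha> y y) = 0" unfolding a_simps .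
  then show ?thesis using alt[of x] alt[of y] by linarith
qed

lemma nx_in: "q \<in> J \<Longrightarrow> nx q \<in> J"
  using nx bij_betwE by blast

lemma nx_surj: "q \<in> J \<Longrightarrow> \<exists>r\<in>J. nx r = q"
  using nx by (metis bij_betw_imp_surj_on imageE)

lemma sum_nx: "(\<Sum>q\<in>J. f (nx q)) = (\<Sum>q\<in>J. f q)"
  using sum.reindex_bij_betw[OF nx, of f] .

lemma nx_neq: "q \<in> J \<Longrightarrow> nx q \<noteq> q"
  using turn alt by force

lemma nx_nx_neq: "q \<in> J \<Longrightarrow> nx (nx q) \<noteq> q"
  using turn[of q] turn[of "nx q"] skew[of "e q" "e (nx q)"] nx_in[of q] by auto

text \<open>Every corner lies on the left of both edge lines at \<open>q\<close>. Only a neighbour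
  of \<open>q\<close> can lie on one of them, and the two neighbours differ, so no other corner lies
  on both.\<close>

lemma edge_right: 
  assumes q: "q \<in> J" and r: "r \<in> J"
  shows "\<alpha> (\<eta> r - \<eta> q) (e (nx q)) \<le> 0" "\<alpha> (\<eta> r - \<eta> q) (e q) \<le> 0"
    and "r \<noteq> q \<Longrightarrow> \<alpha> (\<eta> r - \<eta> q) (e (nx q)) < 0 \<or> \<alpha> (\<eta> r - \<eta> q) (e q) < 0"
proof -
  obtain p where p: "p \<in> J" "nx p = q" using nx_surj q by blast
  have A: "\<alpha> (\<eta> r - \<eta> q) (e (nx q)) < 0" if "r \<noteq> q" "r \<noteq> nx q"
    using cvx[OF q r that] skew[of "\<eta> r - \<eta> q"] by simp
  have A0: "\<alpha> (\<eta> r - \<eta> q) (e (nx q)) = 0" if "r = nx q"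
    using step[OF q] that alt by simp
  have B1: "\<alpha> (\<eta> q - \<eta> p) (e q) = 0" using step[OF p(1)] p alt by simp
  have B: "\<alpha> (\<eta> r - \<eta> q) (e q) < 0" if "r \<noteq> q" "r \<noteq> p"
    using cvx[OF p(1) r that(2)] that p skew[of "\<eta> r - \<eta> p" "e q"] B1 by (simp add: a_simps)
  have B0: "\<alpha> (\<eta> r - \<eta> q) (e q) = 0" if "r = p"
    using B1 that by (simp add: a_simps)
  have Z: "\<alpha> (\<eta> r - \<eta> q) x = 0" if "r = q" for x
    using that bilinear_lzero[OF bil] by simp
  have pn: "p \<noteq> nx q" using nx_nx_neq[OF p(1)] p by auto
  show "\<alpha> (\<eta> r - \<eta> q) (e (nx q)) \<le> 0" using A A0 Z[of "e (nx q)"] by linarith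
  show "\<alpha> (\<eta> r - \<eta> q) (e q) \<le> 0" using B B0 Z[of "e q"] by linarith
  show "r \<noteq> q \<Longrightarrow> \<alpha> (\<eta> r - \<eta> q) (e (nx q)) < 0 \<or> \<alpha> (\<eta> r - \<eta> q) (e q) < 0"
    using A B pn by blast
qed

text \<open>The identity makes the area of a closed cycle negative as soon as \<open>\<omega>\<close> is orthogonal to \<open>a\<close>
  at each corner where \<open>\<alpha> (e q) a\<close> changes sign.\<close>

lemma area_identity:
  assumes s: "\<And>q. q \<in> J \<Longrightarrow> \<alpha> (e q) a \<noteq> 0"
    and om: "\<And>q x. q \<in> J \<Longrightarrow> \<alpha> (\<omega> (nx q) - \<omega> q) x = l (nx q) * \<alpha> (e (nx q)) x"
  shows "(\<Sum>q\<in>J. l q * \<alpha> (\<omega> q) (e q)) =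
    - (\<Sum>q\<in>J. (\<alpha> (\<omega> q) a)\<^sup>2 * \<alpha> (e q) (e (nx q)) / (\<alpha> (e q) a * \<alpha> (e (nx q)) a))"
proof -
  define s where "s q = \<alpha> (e q) a" for q
  define m where "m q = \<alpha> (\<omega> q) a" for q
  define H where "H q = \<alpha> (\<omega> q) (e q)" for q
  \<comment> \<open>\<open>H q\<close> is the support number of the line carrying the edge
    \<open>e q\<close>, so both ends of an edge give the same value. This prepares a summation by
    parts.\<close>
  have Hnx: "\<alpha> (\<omega> q) (e (nx q)) = H (nx q)" if "q \<in> J" for q
    using om[OF that, of "e (nx q)"] alt by (simp add: H_def a_simps)
  have mnx: "m (nx q) - m q = l (nx q) * s (nx q)" if "q \<in> J" for q
    using om[OF that, of a] by (simp add: m_def s_def a_simps)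
  have snz: "s q \<noteq> 0" if "q \<in> J" for q using s that by (simp add: s_def)
  have mD: "m q * \<alpha> (e q) (e (nx q)) = H (nx q) * s q - H q * s (nx q)" if "q \<in> J" for q
    using plucker[of "\<omega> q" a "e q" "e (nx q)"] skew[of a "e q"] skew[of a "e (nx q)"] Hnx[OF that]
    by (simp add: m_def s_def H_def algebra_simps)
  have "(\<Sum>q\<in>J. l q * H q) = (\<Sum>q\<in>J. l (nx q) * H (nx q))"
    using sum_nx[of "\<lambda>q. l q * H q"] by simp
  also have "\<dots> = (\<Sum>q\<in>J. m (nx q) * H (nx q) / s (nx q) - m q * H (nx q) / s (nx q))"
  proof (rule sum.cong[OF refl])
    fix q assume q: "q \<in> J"
    have "l (nx q) = (m (nx q) - m q) / s (nx q)" using mnx[OF q] snz[OF nx_in[OF q]] by (simp add: field_simps)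
    then show "l (nx q) * H (nx q) = m (nx q) * H (nx q) / s (nx q) - m q * H (nx q) / s (nx q)"
      by (simp add: diff_divide_distrib left_diff_distrib)
  qed
  also have "\<dots> = (\<Sum>q\<in>J. m q * H q / s q - m q * H (nx q) / s (nx q))"
    using sum_nx[of "\<lambda>q. m q * H q / s q"] by (simp add: sum_subtractf)
  also have "\<dots> = (\<Sum>q\<in>J. - ((m q)\<^sup>2 * \<alpha> (e q) (e (nx q)) / (s q * s (nx q))))"
  proof (rule sum.cong[OF refl])
    fix q assume q: "q \<in> J"
    have "m q * H q / s q - m q * H (nx q) / s (nx q) = - (m q * (H (nx q) * s q - H q * s (nx q)) / (s q * s (nx q)))"
      using snz[OF q] snz[OF nx_in[OF q]] by (simp add: field_simps)
    also have "\<dots> = - ((m q)\<^sup>2 * \<alpha> (e q) (e (nx q)) / (s q * s (nx q)))"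
      using mD[OF q] by (simp add: power2_eq_square mult.assoc)
    finally show "m q * H q / s q - m q * H (nx q) / s (nx q) = - ((m q)\<^sup>2 * \<alpha> (e q) (e (nx q)) / (s q * s (nx q)))" .
  qed
  finally show ?thesis by (simp add: sum_negf s_def m_def H_def)
qed

text \<open>The sum is twice the area enclosed by \<open>\<eta>\<close>. Since the polygon closes
  up, the base point may be moved to a corner; then no edge spans a triangle of negative area with
  it, and some edge spans a positive one.\<close>

lemma kappa_area_pos: "(\<Sum>q\<in>J. \<kappa> q * \<alpha> (\<eta> q) (e q)) > 0"
proof -
  obtain q0 where q0: "q0 \<in> J" using ne by auto
  have "(\<Sum>q\<in>J. \<kappa> q * \<alpha> (\<eta> q0) (e q)) = (\<Sum>q\<in>J. \<kappa> (nx q) * \<alpha> (\<eta> q0) (e (nx q)))"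
    using sum_nx[of "\<lambda>q. \<kappa> q * \<alpha> (\<eta> q0) (e q)"] by simp
  also have "\<dots> = (\<Sum>q\<in>J. \<alpha> (\<eta> q0) (\<eta> (nx q)) - \<alpha> (\<eta> q0) (\<eta> q))"
  proof (rule sum.cong[OF refl])
    fix q assume "q \<in> J"
    from step[OF this, of "\<eta> q0"] show "\<kappa> (nx q) * \<alpha> (\<eta> q0) (e (nx q)) = \<alpha> (\<eta> q0) (\<eta> (nx q)) - \<alpha> (\<eta> q0) (\<eta> q)"
      using skew[of "\<eta> q0"] by (simp add: a_simps)
  qed
  also have "\<dots> = 0" using sum_nx[of "\<lambda>q. \<alpha> (\<eta> q0) (\<eta> q)"] by (simp add: sum_subtractf)
  finally have z: "(\<Sum>q\<in>J. \<kappa> q * \<alpha> (\<eta> q0) (e q)) = 0" .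
  have eq: "(\<Sum>q\<in>J. \<kappa> q * \<alpha> (\<eta> q) (e q)) = (\<Sum>q\<in>J. \<kappa> q * - \<alpha> (\<eta> q0 - \<eta> q) (e q))"
    using z by (simp add: a_simps algebra_simps sum_subtractf sum.distrib)
  \<comment> \<open>The edge from \<open>nx q0\<close> to \<open>nx (nx q0)\<close> avoids the base
    corner, since left turns exclude fixed points and 2-cycles of \<open>nx\<close>.\<close>
  let ?q = "nx (nx q0)"
  have q: "?q \<in> J" using q0 nx_in by auto
  have "\<alpha> (\<eta> q0 - \<eta> (nx q0)) (e ?q) < 0"
    using cvx[OF nx_in[OF q0] q0] nx_neq[OF q0] nx_nx_neq[OF q0] skew[of "\<eta> q0 - \<eta> (nx q0)"] by force
  moreover have "\<alpha> (\<eta> ?q - \<eta> (nx q0)) (e ?q) = 0" using step[OF nx_in[OF q0]] alt by simp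
  ultimately have "\<kappa> ?q * - \<alpha> (\<eta> q0 - \<eta> ?q) (e ?q) > 0"
    using kap[OF q] by (simp add: a_simps)
  moreover have "\<kappa> r * - \<alpha> (\<eta> q0 - \<eta> r) (e r) \<ge> 0" if "r \<in> J" for r
    using edge_right(2)[OF that q0] kap[OF that] by (simp add: mult_nonneg_nonpos)
  ultimately show ?thesis unfolding eq by (rule sum_pos2[OF fin q])
qed

text \<open>By \<open>plucker\<close> the height difference
  \<open>\<alpha> (\<eta> r - \<eta> q) a\<close> is a combination of the two distances in
  \<open>edge_right\<close>, and the sign change makes both weights have the same sign. So a corner
  with a sign change is a strict extremum of the height, which leaves room for at most two of
  them.\<close>

lemma crossing_extremal:
  assumes q: "q \<in> J" and r: "r \<in> J" "r \<noteq> q" and s: "\<alpha> (e q) a * \<alpha> (e (nx q)) a < 0"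
  shows "\<alpha> (e q) a * (\<alpha> (\<eta> r) a - \<alpha> (\<eta> q) a) < 0"
proof -
  define x where "x = \<eta> r - \<eta> q"
  have id: "\<alpha> x a * \<alpha> (e q) (e (nx q)) = \<alpha> x (e (nx q)) * \<alpha> (e q) a - \<alpha> x (e q) * \<alpha> (e (nx q)) a"
    using plucker[of x a "e q" "e (nx q)"] skew[of a "e q"] skew[of a "e (nx q)"] by (simp add: algebra_simps)
  have X: "\<alpha> x (e (nx q)) \<le> 0" "\<alpha> x (e q) \<le> 0" "\<alpha> x (e (nx q)) < 0 \<or> \<alpha> x (e q) < 0"
    using edge_right[OF q r(1)] r(2) by (simp_all add: x_def)
  have "\<alpha> (e q) a * (\<alpha> x (e (nx q)) * \<alpha> (e q) a - \<alpha> x (e q) * \<alpha> (e (nx q)) a)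
      = \<alpha> x (e (nx q)) * (\<alpha> (e q) a)\<^sup>2 + \<alpha> x (e q) * - (\<alpha> (e q) a * \<alpha> (e (nx q)) a)"
    by (simp add: power2_eq_square algebra_simps)
  also have "\<dots> < 0"
  proof -
    define A where "A = (\<alpha> (e q) a)\<^sup>2"
    define B where "B = - (\<alpha> (e q) a * \<alpha> (e (nx q)) a)"
    have AB: "A > 0" "B > 0" using s by (auto simp: A_def B_def)
    then have "\<alpha> x (e (nx q)) * A \<le> 0" "\<alpha> x (e q) * B \<le> 0"
      "\<alpha> x (e (nx q)) * A < 0 \<or> \<alpha> x (e q) * B < 0"
      using X by (auto simp: mult_le_0_iff mult_less_0_iff)
    then have "\<alpha> x (e (nx q)) * A + \<alpha> x (e q) * B < 0" by linarith
    then show ?thesis unfolding A_def B_def .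
  qed
  finally have "\<alpha> (e q) a * \<alpha> x a * \<alpha> (e q) (e (nx q)) < 0" using id by (simp add: mult.assoc)
  then show ?thesis using turn[OF q] by (simp add: x_def a_simps mult_less_0_iff zero_less_mult_iff)
qed

text \<open>A discrete form of Minkowski's second inequality in the plane. Subtracting a multiple of \<open>\<eta>\<close>
  and a constant from \<open>\<omega>\<close> makes \<open>\<omega>\<close> orthogonal to \<open>a\<close> at the only two corners where the sign of
  \<open>\<alpha> (e q) a\<close> can change; since the mixed area vanishes, this does not decrease the area.\<close>

theorem minkowski_inequality:
  assumes om: "\<And>q x. q \<in> J \<Longrightarrow> \<alpha> (\<omega> (nx q) - \<omega> q) x = l (nx q) * \<alpha> (e (nx q)) x"
    and mixed: "(\<Sum>q\<in>J. l q * \<alpha> (\<eta> q) (e q)) = 0"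
  shows "(\<Sum>q\<in>J. \<alpha> (\<omega> q) (\<omega> (nx q))) \<le> 0"
    and "(\<Sum>q\<in>J. \<alpha> (\<omega> q) (\<omega> (nx q))) = 0 \<Longrightarrow> q \<in> J \<Longrightarrow> l q = 0"
proof -
  \<comment> \<open>\<open>area_identity\<close> divides by \<open>\<alpha> (e q) a\<close>, so the
    direction \<open>a\<close> must be parallel to no edge.\<close>
  have "\<exists>a. \<forall>f\<in>(\<lambda>q. \<alpha> (e q)) ` J. f a \<noteq> 0"
  proof (rule finite_linear_functionals_common_nonzero)
    show "finite ((\<lambda>q. \<alpha> (e q)) ` J)" using fin by simp
    fix f assume "f \<in> (\<lambda>q. \<alpha> (e q)) ` J"
    then obtain q where q: "q \<in> J" "f = \<alpha> (e q)" by auto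
    show "linear f" using bil q by (simp add: bilinear_def)
    show "\<exists>x. f x \<noteq> 0" using turn[OF q(1)] q(2) by (metis less_irrefl)
  qed
  then obtain a where a: "\<And>q. q \<in> J \<Longrightarrow> \<alpha> (e q) a \<noteq> 0" by auto
  define y where "y q = \<alpha> (\<eta> q) a" for q
  have finy: "finite (y ` J)" and ney: "y ` J \<noteq> {}" using fin ne by auto
  obtain q1 where q1: "q1 \<in> J" "y q1 = Max (y ` J)" using Max_in[OF finy ney] by auto
  obtain q2 where q2: "q2 \<in> J" "y q2 = Min (y ` J)" using Min_in[OF finy ney] by auto
  have q1m: "y q \<le> y q1" if "q \<in> J" for q using q1 finy that by simp
  have q2m: "y q2 \<le> y q" if "q \<in> J" for q using q2 finy that by simp
  have "y (nx q1) \<noteq> y q1"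
  proof -
    have "y (nx q1) - y q1 = \<kappa> (nx q1) * \<alpha> (e (nx q1)) a"
      using step[OF q1(1), of a] by (simp add: y_def a_simps)
    moreover have "\<kappa> (nx q1) > 0" "\<alpha> (e (nx q1)) a \<noteq> 0" using kap a nx_in[OF q1(1)] by auto
    ultimately show ?thesis by auto
  qed
  then have y12: "y q2 < y q1" using q1m[OF nx_in[OF q1(1)]] q2m[OF nx_in[OF q1(1)]] by linarith
  have cross: "q = q1 \<or> q = q2" if q: "q \<in> J" and s: "\<alpha> (e q) a * \<alpha> (e (nx q)) a < 0" for q
  proof (rule ccontr)
    assume "\<not> ?thesis"
    then have "\<alpha> (e q) a * (y q1 - y q) < 0" "\<alpha> (e q) a * (y q2 - y q) < 0"
      using crossing_extremal[OF q q1(1) _ s] crossing_extremal[OF q q2(1) _ s] by (auto simp: y_def)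
    then show False using q1m[OF q] q2m[OF q] by (smt (verit) mult_less_0_iff)
  qed
  \<comment> \<open>\<open>t\<close> makes the heights of \<open>\<omega> - t \<eta>\<close> equal
    at the highest and the lowest corner of \<open>\<eta>\<close>, and \<open>z\<close> removes the
    common value. Only \<open>\<alpha> z a\<close> matters, so a multiple of a single edge can serve
    as \<open>z\<close>.\<close>
  define t where "t = (\<alpha> (\<omega> q1) a - \<alpha> (\<omega> q2) a) / (y q1 - y q2)"
  define z where "z = ((\<alpha> (\<omega> q1) a - t * y q1) / \<alpha> (e q1) a) *\<^sub>R e q1"
  define \<omega>' where "\<omega>' q = \<omega> q - t *\<^sub>R \<eta> q - z" for q
  define l' where "l' q = l q - t * \<kappa> q" for q
  have za: "\<alpha> z a = \<alpha> (\<omega> q1) a - t * y q1" using a[OF q1(1)] by (simp add: z_def a_simps)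
  have m1: "\<alpha> (\<omega>' q1) a = 0" using za by (simp add: \<omega>'_def a_simps y_def)
  have "t * (y q1 - y q2) = \<alpha> (\<omega> q1) a - \<alpha> (\<omega> q2) a" using y12 by (simp add: t_def)
  then have m2: "\<alpha> (\<omega>' q2) a = 0" using za by (simp add: \<omega>'_def a_simps y_def algebra_simps)
  have om': "\<alpha> (\<omega>' (nx q) - \<omega>' q) x = l' (nx q) * \<alpha> (e (nx q)) x" if "q \<in> J" for q x
    using om[OF that, of x] step[OF that, of x] by (simp add: \<omega>'_def l'_def a_simps algebra_simps)
  define T where "T q = (\<alpha> (\<omega>' q) a)\<^sup>2 * \<alpha> (e q) (e (nx q)) / (\<alpha> (e q) a * \<alpha> (e (nx q)) a)" for q
  have Tpos: "T q \<ge> 0" "T q = 0 \<Longrightarrow> \<alpha> (\<omega>' q) a = 0" if q: "q \<in> J" for q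
  proof -
    have "\<alpha> (\<omega>' q) a = 0 \<or> \<alpha> (e q) a * \<alpha> (e (nx q)) a > 0"
      using cross[OF q] m1 m2 a[OF q] a[OF nx_in[OF q]] by (metis linorder_neqE_linordered_idom mult_eq_0_iff)
    then show "T q \<ge> 0" "T q = 0 \<Longrightarrow> \<alpha> (\<omega>' q) a = 0" using turn[OF q] by (auto simp: T_def)
  qed
  have Q': "(\<Sum>q\<in>J. l' q * \<alpha> (\<omega>' q) (e q)) = - (\<Sum>q\<in>J. T q)"
    using area_identity[OF a om'] by (simp add: T_def)
  have zero: "(\<Sum>q\<in>J. l q * \<alpha> x (e q)) = 0" "(\<Sum>q\<in>J. \<kappa> q * \<alpha> x (e q)) = 0" for x
  proof -
    have "(\<Sum>q\<in>J. l (nx q) * \<alpha> (e (nx q)) x) = (\<Sum>q\<in>J. \<alpha> (\<omega> (nx q)) x - \<alpha> (\<omega> q) x)"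
      using om[of _ x] by (intro sum.cong) (auto simp: a_simps)
    also have "\<dots> = 0" using sum_nx[of "\<lambda>q. \<alpha> (\<omega> q) x"] by (simp add: sum_subtractf)
    finally show "(\<Sum>q\<in>J. l q * \<alpha> x (e q)) = 0"
      using sum_nx[of "\<lambda>q. l q * \<alpha> (e q) x"] skew[of x] by (simp add: sum_negf)
    have "(\<Sum>q\<in>J. \<kappa> (nx q) * \<alpha> (e (nx q)) x) = (\<Sum>q\<in>J. \<alpha> (\<eta> (nx q)) x - \<alpha> (\<eta> q) x)"
      using step[of _ x] by (intro sum.cong) (auto simp: a_simps)
    also have "\<dots> = 0" using sum_nx[of "\<lambda>q. \<alpha> (\<eta> q) x"] by (simp add: sum_subtractf)
    finally show "(\<Sum>q\<in>J. \<kappa> q * \<alpha> x (e q)) = 0"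
      using sum_nx[of "\<lambda>q. \<kappa> q * \<alpha> (e q) x"] skew[of x] by (simp add: sum_negf)
  qed
  \<comment> \<open>Symmetry of the mixed area: summation by parts exchanges the roles of
    \<open>\<omega>\<close> and \<open>\<eta>\<close>, so the second cross term vanishes as
    well.\<close>
  have mixed': "(\<Sum>q\<in>J. \<kappa> q * \<alpha> (\<omega> q) (e q)) = 0"
  proof -
    have "(\<Sum>q\<in>J. \<kappa> q * \<alpha> (\<omega> q) (e q)) = (\<Sum>q\<in>J. \<kappa> (nx q) * \<alpha> (\<omega> (nx q)) (e (nx q)))"
      using sum_nx[of "\<lambda>q. \<kappa> q * \<alpha> (\<omega> q) (e q)"] by simp
    also have "\<dots> = (\<Sum>q\<in>J. \<kappa> (nx q) * \<alpha> (\<omega> q) (e (nx q)))"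
    proof (rule sum.cong[OF refl])
      fix q assume "q \<in> J"
      from om[OF this, of "e (nx q)"] show "\<kappa> (nx q) * \<alpha> (\<omega> (nx q)) (e (nx q)) = \<kappa> (nx q) * \<alpha> (\<omega> q) (e (nx q))"
        by (simp add: a_simps alt)
    qed
    also have "\<dots> = (\<Sum>q\<in>J. \<alpha> (\<omega> q) (\<eta> (nx q)) - \<alpha> (\<omega> q) (\<eta> q))"
    proof (rule sum.cong[OF refl])
      fix q assume "q \<in> J"
      from step[OF this, of "\<omega> q"] show "\<kappa> (nx q) * \<alpha> (\<omega> q) (e (nx q)) = \<alpha> (\<omega> q) (\<eta> (nx q)) - \<alpha> (\<omega> q) (\<eta> q)"
        using skew[of "\<omega> q"] by (simp add: a_simps)
    qed
    also have "\<dots> = (\<Sum>q\<in>J. \<alpha> (\<omega> q) (\<eta> (nx q)) - \<alpha> (\<omega> (nx q)) (\<eta> (nx q)))"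
      using sum_nx[of "\<lambda>q. \<alpha> (\<omega> q) (\<eta> q)"] by (simp add: sum_subtractf)
    also have "\<dots> = (\<Sum>q\<in>J. l (nx q) * \<alpha> (\<eta> (nx q)) (e (nx q)))"
    proof (rule sum.cong[OF refl])
      fix q assume "q \<in> J"
      from om[OF this, of "\<eta> (nx q)"] show "\<alpha> (\<omega> q) (\<eta> (nx q)) - \<alpha> (\<omega> (nx q)) (\<eta> (nx q)) = l (nx q) * \<alpha> (\<eta> (nx q)) (e (nx q))"
        using skew[of "\<eta> (nx q)" "e (nx q)"] by (simp add: a_simps)
    qed
    also have "\<dots> = 0" using mixed sum_nx[of "\<lambda>q. l q * \<alpha> (\<eta> q) (e q)"] by simp
    finally show ?thesis .
  qed
  have "(\<Sum>q\<in>J. l' q * \<alpha> (\<omega>' q) (e q)) = (\<Sum>q\<in>J. l q * \<alpha> (\<omega> q) (e q)) - t * (\<Sum>q\<in>J. l q * \<alpha> (\<eta> q) (e q))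
      - (\<Sum>q\<in>J. l q * \<alpha> z (e q)) - t * (\<Sum>q\<in>J. \<kappa> q * \<alpha> (\<omega> q) (e q)) 
      + t\<^sup>2 * (\<Sum>q\<in>J. \<kappa> q * \<alpha> (\<eta> q) (e q)) + t * (\<Sum>q\<in>J. \<kappa> q * \<alpha> z (e q))"
    unfolding sum_distrib_left sum_subtractf[symmetric] sum.distrib[symmetric]
    by (rule sum.cong[OF refl]) (simp add: l'_def \<omega>'_def a_simps algebra_simps power2_eq_square)
  then have Q: "(\<Sum>q\<in>J. l q * \<alpha> (\<omega> q) (e q)) = - (\<Sum>q\<in>J. T q) - t\<^sup>2 * (\<Sum>q\<in>J. \<kappa> q * \<alpha> (\<eta> q) (e q))"
    using Q' zero mixed mixed' by simp
  have area: "(\<Sum>q\<in>J. \<alpha> (\<omega> q) (\<omega> (nx q))) = (\<Sum>q\<in>J. l q * \<alpha> (\<omega> q) (e q))"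
  proof -
    have "(\<Sum>q\<in>J. \<alpha> (\<omega> q) (\<omega> (nx q))) = (\<Sum>q\<in>J. l (nx q) * \<alpha> (\<omega> (nx q)) (e (nx q)))"
    proof (rule sum.cong[OF refl])
      fix q assume "q \<in> J"
      from om[OF this, of "\<omega> (nx q)"] show "\<alpha> (\<omega> q) (\<omega> (nx q)) = l (nx q) * \<alpha> (\<omega> (nx q)) (e (nx q))"
        using skew[of "\<omega> (nx q)" "e (nx q)"] alt by (simp add: a_simps)
    qed
    then show ?thesis using sum_nx[of "\<lambda>q. l q * \<alpha> (\<omega> q) (e q)"] by simp
  qed
  have ST: "(\<Sum>q\<in>J. T q) \<ge> 0" using Tpos(1) by (simp add: sum_nonneg)
  show "(\<Sum>q\<in>J. \<alpha> (\<omega> q) (\<omega> (nx q))) \<le> 0"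
    using ST kappa_area_pos unfolding area Q by (smt (verit) mult_nonneg_nonneg zero_le_power2)
  \<comment> \<open>Equality forces \<open>t = 0\<close> and height zero at every corner. Heights of
    consecutive corners differ by \<open>l' q * \<alpha> (e q) a\<close>, which then gives
    \<open>l q = 0\<close>.\<close>
  assume z0: "(\<Sum>q\<in>J. \<alpha> (\<omega> q) (\<omega> (nx q))) = 0" and q: "q \<in> J"
  have "t\<^sup>2 * (\<Sum>q\<in>J. \<kappa> q * \<alpha> (\<eta> q) (e q)) \<ge> 0" using kappa_area_pos by simp
  then have "t\<^sup>2 * (\<Sum>q\<in>J. \<kappa> q * \<alpha> (\<eta> q) (e q)) = 0" and T0: "(\<Sum>q\<in>J. T q) = 0"
    using z0 ST unfolding area Q by linarith+
  then have t0: "t = 0" using kappa_area_pos by auto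
  have "\<forall>q\<in>J. T q = 0" using T0 Tpos(1) sum_nonneg_eq_0_iff[OF fin, of T] by auto
  then have m0: "\<alpha> (\<omega>' q) a = 0" if "q \<in> J" for q using Tpos(2) that by blast
  obtain p where p: "p \<in> J" "nx p = q" using nx_surj q by blast
  have "l' q * \<alpha> (e q) a = 0" using om'[OF p(1), of a] m0[OF p(1)] m0[OF q] p by (simp add: a_simps)
  then show "l q = 0" using a[OF q] t0 by (simp add: l'_def)
qed

end

section \<open>Vertex figures\<close>

definition verts :: "'a::euclidean_space set \<Rightarrow> 'a set" where
  "verts Q = {x. x extreme_point_of Q}"

definition adj :: "'a::euclidean_space set \<Rightarrow> 'a \<Rightarrow> 'a \<Rightarrow> bool" where
  "adj Q p q \<longleftrightarrow> closed_segment p q edge_of Q"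

definition two_faces :: "'a::euclidean_space set \<Rightarrow> 'a set set" where
  "two_faces Q = {C. C face_of Q \<and> aff_dim C = 2}"

lemma verts_subset: "verts Q \<subseteq> Q"
  by (auto simp: verts_def extreme_point_of_def)

lemma polytope_eq_hull_verts: "polytope Q \<Longrightarrow> Q = convex hull (verts Q)"
  unfolding verts_def
  by (rule Krein_Milman_Minkowski) (auto simp: polytope_imp_compact polytope_imp_convex)

lemma finite_verts: "polytope Q \<Longrightarrow> finite (verts Q)"
  unfolding verts_def by (simp add: finite_polyhedron_extreme_points polytope_imp_polyhedron)

lemma verts_face: "F face_of Q \<Longrightarrow> verts F = verts Q \<inter> F"
  by (auto simp: verts_def extreme_point_of_face)

lemma affine_hull_verts: "polytope Q \<Longrightarrow> affine hull (verts Q) = affine hull Q"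
  using polytope_eq_hull_verts affine_hull_convex_hull by metis

lemma polytope_le_if_verts_le:
  fixes f :: "'a::euclidean_space \<Rightarrow> real"
  assumes "polytope Q" "linear f" "\<And>q. q \<in> verts Q \<Longrightarrow> b \<le> f q" "x \<in> Q"
  shows "b \<le> f x"
proof -
  have "convex (f -` {b..})" by (rule convex_linear_vimage[OF assms(2)]) simp
  then have "convex hull (verts Q) \<subseteq> f -` {b..}"
    using assms(3) by (intro hull_minimal) auto
  then show ?thesis using polytope_eq_hull_verts[OF assms(1)] assms(4) by auto
qed

lemma polytope_less_if_verts_less:
  fixes f :: "'a::euclidean_space \<Rightarrow> real"
  assumes "polytope Q" "linear f" "\<And>q. q \<in> verts Q \<Longrightarrow> b < f q" "x \<in> Q"
  shows "b < f x"
proof -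
  have "convex (f -` {b<..})" by (rule convex_linear_vimage[OF assms(2)]) simp
  then have "convex hull (verts Q) \<subseteq> f -` {b<..}"
    using assms(3) by (intro hull_minimal) auto
  then show ?thesis using polytope_eq_hull_verts[OF assms(1)] assms(4) by auto
qed

lemma adj_commute: "adj Q p q \<longleftrightarrow> adj Q q p"
  by (simp add: adj_def closed_segment_commute)

lemma adj_neq: "adj Q p q \<Longrightarrow> p \<noteq> q"
  by (auto simp: adj_def edge_of_def)

lemma adj_verts:
  assumes "adj Q p q" shows "p \<in> verts Q" "q \<in> verts Q"
proof -
  have "closed_segment p q face_of Q" using assms by (simp add: adj_def edge_of_def)
  from verts_face[OF this] show "p \<in> verts Q" "q \<in> verts Q"
    by (auto simp: verts_def extreme_point_of_segment)
qed

lemma adj_face: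
  assumes "F face_of Q" shows "adj F p q \<longleftrightarrow> adj Q p q \<and> p \<in> F \<and> q \<in> F"
proof -
  have "convex F" using assms face_of_imp_convex by blast
  then show ?thesis
    unfolding adj_def edge_of_def face_of_face[OF assms]
    by (meson closed_segment_subset ends_in_segment subsetD)
qed

lemma two_faces_face:
  assumes "F face_of Q" shows "two_faces F = {C \<in> two_faces Q. C \<subseteq> F}"
  unfolding two_faces_def face_of_face[OF assms] by auto

lemma edge_is_segment:
  assumes "polytope F" "aff_dim F = 1" "p \<in> verts F"
  obtains q where "F = closed_segment p q" "q \<noteq> p" "q \<in> verts F"
proof -
  have "F \<noteq> {}" using assms(2) by auto
  moreover have "compact F" "convex F" "collinear F"
    using assms polytope_imp_compact polytope_imp_convex by (auto simp: collinear_aff_dim)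
  ultimately obtain a b where ab: "F = closed_segment a b"
    using compact_convex_collinear_segment by blast
  then have vs: "verts F = {a, b}" by (auto simp: verts_def extreme_point_of_segment)
  have "a \<noteq> b" using ab assms(2) by auto
  consider "p = a" | "p = b" using vs assms(3) by auto
  then show ?thesis
  proof cases
    case 1 then show ?thesis using that[of b] ab vs \<open>a \<noteq> b\<close> by auto
  next
    case 2 then show ?thesis using that[of a] ab vs \<open>a \<noteq> b\<close> by (auto simp: closed_segment_commute)
  qed
qed

locale vertex_figure =
  fixes Q :: "'a::euclidean_space set" and p h :: 'a and \<gamma> :: real
  assumes poly: "polytope Q" and pv: "p \<in> verts Q" and hp: "h \<bullet> p < \<gamma>"
    and hv: "\<And>q. q \<in> verts Q \<Longrightarrow> q \<noteq> p \<Longrightarrow> h \<bullet> q > \<gamma>"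

text \<open>An extreme point stays outside the hull of the other vertices because
  \<open>Q - {p}\<close> is convex; a hyperplane strictly separating the two is the cut.\<close>

lemma vertex_figure_exists:
  assumes "polytope Q" "p \<in> verts Q"
  shows "\<exists>h \<gamma>. vertex_figure Q p h \<gamma>"
proof -
  let ?W = "convex hull (verts Q - {p})"
  have "p \<notin> ?W"
  proof
    assume "p \<in> ?W"
    moreover have "?W \<subseteq> Q - {p}"
    proof (rule hull_minimal)
      show "verts Q - {p} \<subseteq> Q - {p}" using verts_subset by blast
      show "convex (Q - {p})"
        using assms extreme_point_of_stillconvex[of Q p] polytope_imp_convex by (auto simp: verts_def)
    qed
    ultimately show False by blast
  qed
  moreover have "closed ?W" using finite_verts[OF assms(1)]
    by (simp add: compact_imp_closed finite_imp_compact_convex_hull)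
  ultimately obtain h \<gamma> where "h \<bullet> p < \<gamma>" "\<forall>x\<in>?W. h \<bullet> x > \<gamma>"
    using separating_hyperplane_closed_point[of ?W p] by auto
  then have "vertex_figure Q p h \<gamma>"
    using assms by unfold_locales (auto simp: hull_inc)
  then show ?thesis by blast
qed

context vertex_figure begin

abbreviation K where "K \<equiv> Q \<inter> {x. h \<bullet> x = \<gamma>}"

lemma face_figure:
  assumes "F face_of Q" "p \<in> F"
  shows "vertex_figure F p h \<gamma>"
  using assms pv hp hv verts_face[OF assms(1)] face_of_polytope_polytope[OF poly assms(1)]
  by unfold_locales auto

lemma polytope_K: "polytope K"
  using poly polyhedron_hyperplane polytope_Int_polyhedron by blast

lemma low_face_contains:
  assumes "F face_of Q" "x \<in> F" "h \<bullet> x \<le> \<gamma>" shows "p \<in> F"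
proof (rule ccontr)
  assume "p \<notin> F"
  then have "\<gamma> < h \<bullet> q" if "q \<in> verts F" for q
    using hv that verts_face[OF assms(1)] by auto
  then have "\<gamma> < h \<bullet> x"
    using polytope_less_if_verts_less[OF face_of_polytope_polytope[OF poly assms(1)], of "(\<bullet>) h" \<gamma> x]
      assms(2) bounded_linear.linear[OF bounded_linear_inner_right] by blast
  then show False using assms(3) by simp
qed

text \<open>Exhibits \<open>K\<close> as a base of the cone of \<open>Q\<close> at \<open>p\<close>:
  \<open>x\<close> lies on a segment from \<open>p\<close> to a point \<open>z\<close> of the hull
  of the other vertices, and this segment crosses the cut.\<close>

lemma ray:
  assumes "x \<in> Q" "x \<noteq> p"
  obtains y t where "y \<in> K" "t > 0" "x = p + t *\<^sub>R (y - p)"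
proof -
  let ?W = "verts Q - {p}"
  have Q: "Q = convex hull (insert p ?W)" using polytope_eq_hull_verts[OF poly] pv by (simp add: insert_absorb)
  have "?W \<noteq> {}"
  proof
    assume "?W = {}"
    then have "Q = {p}" using Q by (metis convex_hull_singleton)
    then show False using assms by blast
  qed
  then obtain u v z where uv: "u \<ge> 0" "v \<ge> 0" "u + v = 1" "z \<in> convex hull ?W" "x = u *\<^sub>R p + v *\<^sub>R z"
    using assms(1) convex_hull_insert[of ?W p] unfolding Q[symmetric] by blast
  have u: "u = 1 - v" using uv by simp
  have v0: "v > 0" using uv assms(2) u by (cases "v = 0") auto
  have "convex hull ?W \<subseteq> {x. h \<bullet> x > \<gamma>}"
    using hv by (intro hull_minimal convex_halfspace_gt) auto
  then have hz: "h \<bullet> z > \<gamma>" using uv by auto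
  have zQ: "z \<in> Q" using uv(4) Q hull_mono[of ?W "insert p ?W" convex] by auto
  define r where "r = (\<gamma> - h \<bullet> p) / (h \<bullet> z - h \<bullet> p)"
  have r: "0 < r" "r < 1" using hz hp by (auto simp: r_def divide_simps)
  define y where "y = p + r *\<^sub>R (z - p)"
  have "y = (1 - r) *\<^sub>R p + r *\<^sub>R z" by (simp add: y_def algebra_simps)
  moreover have "p \<in> Q" using pv verts_subset by blast
  ultimately have "y \<in> Q" using zQ r polytope_imp_convex[OF poly] by (simp add: convexD_alt)
  moreover have "h \<bullet> y = \<gamma>" using hz hp by (simp add: y_def inner_add_right inner_diff_right r_def)
  moreover have "x = p + (v / r) *\<^sub>R (y - p)" using r uv(5) by (simp add: y_def u algebra_simps)
  ultimately show ?thesis using that[of y "v / r"] v0 r by auto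
qed

lemma p_notin_affine_K: "p \<notin> affine hull K"
proof -
  have "affine hull K \<subseteq> {x. h \<bullet> x = \<gamma>}" by (intro hull_minimal affine_hyperplane) auto
  then show ?thesis using hp by auto
qed


lemma affine_hull_K: "affine hull Q = affine hull (insert p K)"
proof (rule subset_antisym)
  have "x \<in> affine hull (insert p K)" if "x \<in> Q" for x
  proof (cases "x = p")
    case False
    then obtain y t where yt: "y \<in> K" "x = p + t *\<^sub>R (y - p)" using ray[OF \<open>x \<in> Q\<close>] by metis
    have "(1 - t) *\<^sub>R p + t *\<^sub>R y \<in> affine hull (insert p K)"
      using yt(1) by (intro mem_affine[OF affine_affine_hull] hull_inc) auto
    moreover have "(1 - t) *\<^sub>R p + t *\<^sub>R y = x" using yt(2) by (simp add: algebra_simps)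
    ultimately show ?thesis by simp
  qed (simp add: hull_inc)
  then show "affine hull Q \<subseteq> affine hull (insert p K)" by (simp add: hull_minimal subsetI)
  have "insert p K \<subseteq> Q" using pv verts_subset by blast
  then show "affine hull (insert p K) \<subseteq> affine hull Q" by (rule hull_mono)
qed

lemma aff_dim_K: "aff_dim Q = aff_dim K + 1"
proof -
  have "aff_dim Q = aff_dim (insert p K)" using affine_hull_K by (metis aff_dim_affine_hull)
  then show ?thesis using p_notin_affine_K by (simp add: aff_dim_insert)
qed

lemma face_K:
  assumes F: "F face_of Q" "p \<in> F"
  shows "(F \<inter> {x. h \<bullet> x = \<gamma>}) face_of K"
    and "aff_dim F = aff_dim (F \<inter> {x. h \<bullet> x = \<gamma>}) + 1"
    and "affine hull F = affine hull (insert p (F \<inter> {x. h \<bullet> x = \<gamma>}))"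
proof -
  interpret F: vertex_figure F p h \<gamma> using face_figure[OF F] .
  show "(F \<inter> {x. h \<bullet> x = \<gamma>}) face_of K"
    using F(1) by (simp add: face_of_slice convex_hyperplane)
  show "aff_dim F = aff_dim (F \<inter> {x. h \<bullet> x = \<gamma>}) + 1" by (rule F.aff_dim_K)
  show "affine hull F = affine hull (insert p (F \<inter> {x. h \<bullet> x = \<gamma>}))" by (rule F.affine_hull_K)
qed

lemma face_K_unique:
  assumes "F face_of Q" "p \<in> F" "G face_of Q" "p \<in> G"
    and "F \<inter> {x. h \<bullet> x = \<gamma>} = G \<inter> {x. h \<bullet> x = \<gamma>}"
  shows "F = G"
  using face_K(3)[OF assms(1,2)] face_K(3)[OF assms(3,4)] assms(5)
    face_of_imp_eq_affine_Int[OF polytope_imp_convex[OF poly] assms(1)]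
    face_of_imp_eq_affine_Int[OF polytope_imp_convex[OF poly] assms(3)] by metis

text \<open>\<open>F\<close> is the smallest face of \<open>Q\<close> through a relative interior
  point \<open>x\<close> of \<open>G\<close>. Minimality puts \<open>x\<close> into the relative
  interior of \<open>F\<close> too. So \<open>G\<close> and the slice of \<open>F\<close> are both
  faces of \<open>K\<close> with \<open>x\<close> inside, and each contains the other.\<close>

lemma face_of_K_lift:
  assumes G: "G face_of K" "G \<noteq> {}"
  obtains F where "F face_of Q" "p \<in> F" "G = F \<inter> {x. h \<bullet> x = \<gamma>}"
proof -
  have cG: "convex G" using G face_of_imp_convex by blast
  then obtain x where x: "x \<in> rel_interior G" using G rel_interior_eq_empty by blast
  then have xG: "x \<in> G" using rel_interior_subset by blast
  then have xK: "x \<in> K" using G face_of_imp_subset by blast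
  define \<F> where "\<F> = {F. F face_of Q \<and> x \<in> F}"
  define F where "F = \<Inter>\<F>"
  have cQ: "convex Q" using poly polytope_imp_convex by blast
  have "Q \<in> \<F>" using face_of_refl[OF cQ] xK by (auto simp: \<F>_def)
  then have F: "F face_of Q" unfolding F_def by (intro face_of_Inter) (auto simp: \<F>_def)
  have xF: "x \<in> F" by (auto simp: F_def \<F>_def)
  have min: "F \<subseteq> F'" if "F' face_of Q" "x \<in> F'" for F' using that by (auto simp: F_def \<F>_def)
  have xrel: "x \<in> rel_interior F"
  proof (rule ccontr)
    assume "x \<notin> rel_interior F"
    then obtain D where D: "D facet_of F" "x \<in> D"
      using xF rel_boundary_of_polyhedron[of F] face_of_polytope_polytope[OF poly F] polytope_imp_polyhedron by blast
    then have "D face_of Q" using F facet_of_imp_face_of face_of_trans by blast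
    then have "F \<subseteq> D" using min D by blast
    then have "F = D" using D facet_of_imp_subset by blast
    then show False using D by simp
  qed
  have pF: "p \<in> F" using low_face_contains[OF F xF] xK by simp
  have "G \<subseteq> F \<inter> {x. h \<bullet> x = \<gamma>}"
    using subset_of_face_of[OF face_K(1)[OF F pF], of G] G x xF xK face_of_imp_subset by blast
  moreover have "F \<inter> {x. h \<bullet> x = \<gamma>} \<subseteq> G"
  proof
    fix w assume w: "w \<in> F \<inter> {x. h \<bullet> x = \<gamma>}"
    show "w \<in> G"
    proof (cases "w = x")
      case False
      \<comment> \<open>The segment from \<open>w\<close> can be prolonged a little beyond
        \<open>x\<close> within \<open>F\<close> and within the cut. Then \<open>x\<close> lies
        strictly between two points of \<open>K\<close>, and the face property of \<open>G\<close>
        captures \<open>w\<close>.\<close>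
      obtain e where e: "e > 1" "(1 - e) *\<^sub>R w + e *\<^sub>R x \<in> F"
        using convex_rel_interior_if2[OF face_of_imp_convex[OF F] xrel] hull_inc[of w F affine] w by auto
      define w' where "w' = (1 - e) *\<^sub>R w + e *\<^sub>R x"
      have w': "w' \<in> K" using e w xK F face_of_imp_subset
        by (auto simp: w'_def inner_add_right left_diff_distrib)
      have wK: "w \<in> K" using w F face_of_imp_subset by blast
      have xeq: "x = (1 - 1 / e) *\<^sub>R w + (1 / e) *\<^sub>R w'"
      proof -
        have c: "(1 / e) * (1 - e) = 1 / e - 1" "(1 / e) * e = 1" using e(1) by (simp_all add: field_simps)
        have "(1 / e) *\<^sub>R w' = (1 / e - 1) *\<^sub>R w + x"
          unfolding w'_def scaleR_right_distrib scaleR_scaleR c by simp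
        then show ?thesis by (simp add: algebra_simps)
      qed
      have "w \<noteq> w'"
      proof
        assume "w = w'"
        then have "x = w" using xeq by (simp add: scaleR_add_left[symmetric])
        then show False using False by simp
      qed
      then have "x \<in> open_segment w w'"
        using xeq e(1) by (auto simp: in_segment intro!: exI[of _ "1 / e"])
      then show ?thesis using face_ofD[OF G(1) _ wK w' xG] by blast
    qed (simp add: xG)
  qed
  ultimately show ?thesis using that[OF F pF] by blast
qed

lemma edge_point:
  assumes "adj Q p q"
  obtains y t where "y \<in> verts K" "0 < t" "t < 1" "y = p + t *\<^sub>R (q - p)"
    and "closed_segment p q \<inter> {x. h \<bullet> x = \<gamma>} = {y}"
proof -
  let ?F = "closed_segment p q"
  have F: "?F face_of Q" "aff_dim ?F = 1" using assms by (auto simp: adj_def edge_of_def)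
  have "aff_dim (?F \<inter> {x. h \<bullet> x = \<gamma>}) = 0" using face_K(2)[OF F(1)] F(2) by auto
  then obtain y where y: "?F \<inter> {x. h \<bullet> x = \<gamma>} = {y}" using aff_dim_eq_0 by blast
  have yin: "y \<in> ?F" using y by blast
  have "y \<in> verts K" using face_K(1)[OF F(1)] y by (simp add: verts_def face_of_singleton)
  moreover obtain t where t: "0 \<le> t" "t \<le> 1" "y = (1 - t) *\<^sub>R p + t *\<^sub>R q"
    using yin by (auto simp: in_segment)
  moreover have "h \<bullet> y = \<gamma>" using y by blast
  moreover have "h \<bullet> q > \<gamma>" using hv adj_verts[OF assms] adj_neq[OF assms] by metis
  ultimately have "t \<noteq> 0" "t \<noteq> 1" using hp by auto
  with t have "0 < t" "t < 1" "y = p + t *\<^sub>R (q - p)" by (auto simp: algebra_simps)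
  then show ?thesis using that \<open>y \<in> verts K\<close> y by blast
qed

lemma vert_K:
  assumes "y \<in> verts K"
  obtains q t where "adj Q p q" "0 < t" "t < 1" "y = p + t *\<^sub>R (q - p)"
    and "closed_segment p q \<inter> {x. h \<bullet> x = \<gamma>} = {y}"
proof -
  have "{y} face_of K" using assms by (simp add: verts_def face_of_singleton)
  then obtain F where F: "F face_of Q" "p \<in> F" "{y} = F \<inter> {x. h \<bullet> x = \<gamma>}"
    using face_of_K_lift[of "{y}"] by auto
  have d: "aff_dim F = 1" using face_K(2)[OF F(1,2)] F(3)[symmetric] by simp
  have pF: "p \<in> verts F" using pv F verts_face by blast
  obtain q where q: "F = closed_segment p q"
    using edge_is_segment[OF face_of_polytope_polytope[OF poly F(1)] d pF] by metis
  have a: "adj Q p q" using F d q by (simp add: adj_def edge_of_def)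
  obtain y' t where y': "0 < t" "t < 1" "y' = p + t *\<^sub>R (q - p)"
    "closed_segment p q \<inter> {x. h \<bullet> x = \<gamma>} = {y'}" using edge_point[OF a] .
  have "{y} = {y'}" using F(3) q y'(4) by simp
  then have "y = y'" by simp
  then show ?thesis using that[OF a y'(1,2)] y'(3,4) by simp
qed

lemma edge_point_unique:
  assumes "adj Q p q" "adj Q p q'" "closed_segment p q \<inter> {x. h \<bullet> x = \<gamma>} = closed_segment p q' \<inter> {x. h \<bullet> x = \<gamma>}"
  shows "q = q'"
proof -
  have "closed_segment p q = closed_segment p q'"
    using face_K_unique[OF _ _ _ _ assms(3)] assms(1,2) by (auto simp: adj_def edge_of_def)
  then show ?thesis by (auto simp: doubleton_eq_iff)
qed

text \<open>The optimality criterion of the simplex method: \<open>Q\<close> lies in the cone over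
  \<open>K\<close>, and the vertices of \<open>K\<close> lie on the edges at
  \<open>p\<close>.\<close>

lemma le_if_nbrs_le:
  fixes f :: "'a \<Rightarrow> real"
  assumes f: "linear f" and le: "\<And>q. adj Q p q \<Longrightarrow> f p \<le> f q" and x: "x \<in> Q"
  shows "f p \<le> f x"
proof (cases "x = p")
  case False
  then obtain y t where yt: "y \<in> K" "t > 0" "x = p + t *\<^sub>R (y - p)" using ray[OF x] by metis
  have "f p \<le> f y"
  proof (rule polytope_le_if_verts_le[OF polytope_K f _ yt(1)])
    fix z assume "z \<in> verts K"
    then obtain q s where q: "adj Q p q" "0 < s" "z = p + s *\<^sub>R (q - p)" using vert_K by metis
    show "f p \<le> f z" using le[OF q(1)] q(2,3) by (simp add: linear_add[OF f] linear_scale[OF f] linear_diff[OF f])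
  qed
  then show ?thesis using yt by (simp add: linear_add[OF f] linear_scale[OF f] linear_diff[OF f])
qed simp

lemma affine_hull_nbrs: "affine hull Q = affine hull (insert p {q. adj Q p q})"
proof (rule subset_antisym)
  let ?A = "affine hull (insert p {q. adj Q p q})"
  have "y \<in> ?A" if y: "y \<in> verts K" for y
  proof -
    obtain q s where q: "adj Q p q" "y = p + s *\<^sub>R (q - p)" using vert_K[OF y] by metis
    have "(1 - s) *\<^sub>R p + s *\<^sub>R q \<in> ?A"
      using q(1) by (intro mem_affine[OF affine_affine_hull] hull_inc) auto
    moreover have "(1 - s) *\<^sub>R p + s *\<^sub>R q = y" using q(2) by (simp add: algebra_simps)
    ultimately show ?thesis by simp
  qed
  then have "affine hull K \<subseteq> ?A"
    using affine_hull_verts[OF polytope_K] by (metis affine_affine_hull hull_minimal subsetI)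
  then have "insert p K \<subseteq> ?A" by (auto simp: hull_inc)
  then show "affine hull Q \<subseteq> ?A" unfolding affine_hull_K by (simp add: hull_minimal)
  have "insert p {q. adj Q p q} \<subseteq> Q" using pv verts_subset adj_verts(2) by blast
  then show "?A \<subseteq> affine hull Q" by (rule hull_mono)
qed

end

text \<open>The functional \<open>h\<close> that cuts off \<open>b\<close> has \<open>b\<close> as
  its unique lowest vertex. From any other vertex \<open>le_if_nbrs_le\<close> yields a strictly
  lower neighbour, so the descent ends at \<open>b\<close>.\<close>

lemma graph_connected:
  assumes Q: "polytope Q" and a: "a \<in> verts Q" and b: "b \<in> verts Q"
  shows "(a, b) \<in> {(x, y). adj Q x y}\<^sup>*"
proof -
  obtain h \<gamma> where "vertex_figure Q b h \<gamma>" using vertex_figure_exists[OF Q b] by blast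
  then interpret b: vertex_figure Q b h \<gamma> .
  have linh: "linear ((\<bullet>) h)" by (simp add: bounded_linear.linear bounded_linear_inner_right)
  show ?thesis using a
  proof (induction "card {v \<in> verts Q. h \<bullet> v < h \<bullet> a}" arbitrary: a rule: less_induct)
    case less
    show ?case
    proof (cases "a = b")
      case False
      then have hb: "h \<bullet> b < h \<bullet> a" using b.hp b.hv[OF less.prems] by linarith
      obtain h' \<gamma>' where "vertex_figure Q a h' \<gamma>'" using vertex_figure_exists[OF Q less.prems] by blast
      then interpret a: vertex_figure Q a h' \<gamma>' .
      obtain q where q: "adj Q a q" "h \<bullet> q < h \<bullet> a"
        using a.le_if_nbrs_le[OF linh, of b] hb b verts_subset by (meson not_le subsetD)
      have qv: "q \<in> verts Q" using adj_verts q by blast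
      have "{v \<in> verts Q. h \<bullet> v < h \<bullet> q} \<subset> {v \<in> verts Q. h \<bullet> v < h \<bullet> a}" using q qv by force
      then have "card {v \<in> verts Q. h \<bullet> v < h \<bullet> q} < card {v \<in> verts Q. h \<bullet> v < h \<bullet> a}"
        using finite_verts[OF Q] by (simp add: psubset_card_mono)
      from less.hyps[OF this qv] show ?thesis using q by (simp add: converse_rtrancl_into_rtrancl)
    qed simp
  qed
qed

context vertex_figure begin

lemma edge_lift:
  assumes z: "adj K y z"
  shows "\<exists>C\<in>two_faces Q. p \<in> C \<and> C \<inter> {x. h \<bullet> x = \<gamma>} = closed_segment y z"
proof -
  have E: "closed_segment y z face_of K" "aff_dim (closed_segment y z) = 1" using z by (auto simp: adj_def edge_of_def)
  then obtain C where C: "C face_of Q" "p \<in> C" "closed_segment y z = C \<inter> {x. h \<bullet> x = \<gamma>}"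
    using face_of_K_lift[of "closed_segment y z"] by auto
  have "aff_dim C = 2" using face_K(2)[OF C(1,2)] C(3) E(2) by simp
  then show ?thesis using C by (auto simp: two_faces_def)
qed

lemma has_nbr:
  assumes "aff_dim Q \<ge> 1" shows "\<exists>q. adj Q p q"
proof (rule ccontr)
  assume "\<not> ?thesis"
  then have no: "{q. adj Q p q} = {}" by blast
  have "aff_dim Q = aff_dim (insert p {})" using affine_hull_nbrs unfolding no by (metis aff_dim_affine_hull)
  then show False using assms by simp
qed

text \<open>A vertex figure of the vertex figure: the edges of \<open>K\<close> at the cut point
  \<open>y\<close> of the edge lift to 2-faces of \<open>Q\<close>. These contain \<open>q\<close>
  besides \<open>p\<close>, since \<open>y\<close> is interior to the edge. As \<open>y\<close> and
  its neighbours span \<open>K\<close>, these faces span \<open>Q\<close>.\<close>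

lemma edge_two_faces_span:
  assumes d: "aff_dim Q \<ge> 2" and pq: "adj Q p q"
  shows "\<exists>C\<in>two_faces Q. p \<in> C \<and> q \<in> C"
    and "affine hull Q = affine hull (\<Union>{C \<in> two_faces Q. p \<in> C \<and> q \<in> C})"
proof -
  let ?U = "\<Union>{C \<in> two_faces Q. p \<in> C \<and> q \<in> C}"
  have dK: "aff_dim K \<ge> 1" using aff_dim_K d by simp
  obtain y t where y: "y \<in> verts K" "0 < t" "t < 1" "y = p + t *\<^sub>R (q - p)"
    using edge_point[OF pq] by metis
  have yo: "y \<in> open_segment p q" using y adj_neq[OF pq] by (auto simp: in_segment algebra_simps intro!: exI[of _ t])
  have pQ: "p \<in> Q" "q \<in> Q" using pv adj_verts[OF pq] verts_subset by auto
  obtain hy gy where "vertex_figure K y hy gy" using vertex_figure_exists[OF polytope_K y(1)] by blast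
  then interpret Y: vertex_figure K y hy gy .
  have C: "\<exists>C\<in>two_faces Q. p \<in> C \<and> q \<in> C \<and> y \<in> C \<and> z \<in> C" if z: "adj K y z" for z
  proof -
    obtain C where C: "C \<in> two_faces Q" "p \<in> C" "C \<inter> {x. h \<bullet> x = \<gamma>} = closed_segment y z"
      using edge_lift[OF z] by blast
    then have "y \<in> C" "z \<in> C" by (metis IntD1 ends_in_segment)+
    moreover have "q \<in> C" using face_ofD[of C Q y p q] C(1) yo \<open>y \<in> C\<close> pQ by (auto simp: two_faces_def)
    ultimately show ?thesis using C by blast
  qed
  obtain z0 where z0: "adj K y z0" using Y.has_nbr[OF dK] by blast
  then show "\<exists>C\<in>two_faces Q. p \<in> C \<and> q \<in> C" using C by blast
  have "insert y {z. adj K y z} \<subseteq> ?U" "p \<in> ?U" using C z0 by blast+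
  then have "affine hull K \<subseteq> affine hull ?U" unfolding Y.affine_hull_nbrs by (intro hull_mono) auto
  then have "K \<subseteq> affine hull ?U" using hull_subset[of K affine] by (rule order_trans[rotated])
  then have "insert p K \<subseteq> affine hull ?U" using hull_inc[OF \<open>p \<in> ?U\<close>] by simp
  then have "affine hull Q \<subseteq> affine hull ?U" unfolding affine_hull_K by (simp add: hull_minimal)
  moreover have "?U \<subseteq> Q" using face_of_imp_subset by (auto simp: two_faces_def)
  then have "affine hull ?U \<subseteq> affine hull Q" by (rule hull_mono)
  ultimately show "affine hull Q = affine hull ?U" by blast
qed

end

text \<open>For a polygon \<open>K\<close> is a segment: its endpoints give the two edges at
  \<open>p\<close>, and its points give the cone coordinates.\<close>

lemma (in vertex_figure) polygon_nbrs:
  assumes d: "aff_dim Q = 2"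
  obtains q1 q2 where "q1 \<noteq> q2" "{q. adj Q p q} = {q1, q2}" "\<not> collinear {p, q1, q2}"
    and "\<And>x. x \<in> Q \<Longrightarrow> \<exists>a\<ge>0. \<exists>b\<ge>0. x = p + a *\<^sub>R (q1 - p) + b *\<^sub>R (q2 - p)"
proof -
  have dK: "aff_dim K = 1" using aff_dim_K d by simp
  then have "K \<noteq> {}" by auto
  then obtain y1 where y1: "y1 \<in> verts K"
    using polytope_eq_hull_verts[OF polytope_K] by fastforce
  obtain y2 where y2: "K = closed_segment y1 y2" "y2 \<noteq> y1" "y2 \<in> verts K"
    using edge_is_segment[OF polytope_K dK y1] .
  have vK: "verts K = {y1, y2}" using y2(1) by (auto simp: verts_def extreme_point_of_segment)
  obtain q1 t1 where q1: "adj Q p q1" "0 < t1" "y1 = p + t1 *\<^sub>R (q1 - p)"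
    "closed_segment p q1 \<inter> {x. h \<bullet> x = \<gamma>} = {y1}" using vert_K[OF y1] by metis
  obtain q2 t2 where q2: "adj Q p q2" "0 < t2" "y2 = p + t2 *\<^sub>R (q2 - p)"
    "closed_segment p q2 \<inter> {x. h \<bullet> x = \<gamma>} = {y2}" using vert_K[OF y2(3)] by metis
  have ne: "q1 \<noteq> q2" using q1(4) q2(4) y2(2) by auto
  have nb: "{q. adj Q p q} = {q1, q2}"
  proof (intro subset_antisym subsetI)
    fix q assume "q \<in> {q. adj Q p q}"
    then have q: "adj Q p q" by simp
    obtain y where y: "y \<in> verts K" "closed_segment p q \<inter> {x. h \<bullet> x = \<gamma>} = {y}"
      using edge_point[OF q] by metis
    then consider "y = y1" | "y = y2" using vK by auto
    then show "q \<in> {q1, q2}"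
    proof cases
      case 1 then show ?thesis using edge_point_unique[OF q q1(1)] y q1(4) by simp
    next
      case 2 then show ?thesis using edge_point_unique[OF q q2(1)] y q2(4) by simp
    qed
  qed (use q1 q2 in auto)
  have "aff_dim (insert p {q1, q2}) = 2"
    using affine_hull_nbrs unfolding nb by (metis aff_dim_affine_hull d)
  then have nc: "\<not> collinear {p, q1, q2}" by (simp add: collinear_aff_dim)
  have "\<exists>a\<ge>0. \<exists>b\<ge>0. x = p + a *\<^sub>R (q1 - p) + b *\<^sub>R (q2 - p)" if x: "x \<in> Q" for x
  proof (cases "x = p")
    case True then show ?thesis by (intro exI[of _ 0]) auto
  next
    case False
    obtain y t where yt: "y \<in> K" "t > 0" "x = p + t *\<^sub>R (y - p)" using ray[OF x False] by metis
    then obtain u where u: "0 \<le> u" "u \<le> 1" "y = (1 - u) *\<^sub>R y1 + u *\<^sub>R y2"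
      unfolding y2(1) by (auto simp: in_segment)
    have "x = p + (t * (1 - u) * t1) *\<^sub>R (q1 - p) + (t * u * t2) *\<^sub>R (q2 - p)"
      unfolding yt(3) u(3) q1(3) q2(3) by (simp add: algebra_simps)
    moreover have "t * (1 - u) * t1 \<ge> 0" "t * u * t2 \<ge> 0" using yt u q1 q2 by auto
    ultimately show ?thesis by blast
  qed
  with that[OF ne nb nc] show ?thesis by blast
qed

text \<open>Now \<open>K\<close> is a polygon, and the two neighbours of the cut point
  \<open>y\<close> correspond to the two faces at the edge. The last clause is the local minimum
  criterion at \<open>y\<close> in \<open>K\<close>; it will show that the two faces lie on
  different sides of a plane through the edge.\<close>

lemma (in vertex_figure) edge_two_faces:
  assumes d: "aff_dim Q = 3" and pq: "adj Q p q"
  obtains C1 C2 where "C1 \<noteq> C2" "{C \<in> two_faces Q. p \<in> C \<and> q \<in> C} = {C1, C2}"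
    and "\<And>f x. linear f \<Longrightarrow> f p = (f q :: real) \<Longrightarrow> (\<And>x. x \<in> C1 \<union> C2 \<Longrightarrow> f p \<le> f x) \<Longrightarrow> x \<in> Q \<Longrightarrow> f p \<le> f x"
proof -
  have dK: "aff_dim K = 2" using aff_dim_K d by simp
  obtain y t where y: "y \<in> verts K" "0 < t" "t < 1" "y = p + t *\<^sub>R (q - p)"
    using edge_point[OF pq] by metis
  have yH: "h \<bullet> y = \<gamma>" "y \<in> Q" using y(1) verts_subset[of K] by auto
  have pneq: "p \<noteq> q" using adj_neq[OF pq] .
  have yo: "y \<in> open_segment p q" using y pneq by (auto simp: in_segment algebra_simps intro!: exI[of _ t])
  have pQ: "p \<in> Q" "q \<in> Q" using pv adj_verts[OF pq] verts_subset by auto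
  have y_in: "y \<in> C \<longleftrightarrow> p \<in> C \<and> q \<in> C" if C: "C face_of Q" for C
  proof
    assume "y \<in> C" then show "p \<in> C \<and> q \<in> C" using face_ofD[OF C yo] pQ by blast
  next
    assume "p \<in> C \<and> q \<in> C"
    then have "closed_segment p q \<subseteq> C" using face_of_imp_convex[OF C] by (simp add: closed_segment_subset)
    then show "y \<in> C" using yo by (auto simp: open_segment_def)
  qed
  obtain hy gy where "vertex_figure K y hy gy" using vertex_figure_exists[OF polytope_K y(1)] by blast
  then interpret Y: vertex_figure K y hy gy .
  obtain y1 y2 where y12: "y1 \<noteq> y2" "{z. adj K y z} = {y1, y2}" using Y.polygon_nbrs[OF dK] by metis
  have lift: "\<exists>C\<in>two_faces Q. p \<in> C \<and> q \<in> C \<and> C \<inter> {x. h \<bullet> x = \<gamma>} = closed_segment y z" if z: "adj K y z" for z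
  proof -
    obtain C where C: "C \<in> two_faces Q" "p \<in> C" "C \<inter> {x. h \<bullet> x = \<gamma>} = closed_segment y z"
      using edge_lift[OF z] by blast
    have "y \<in> C" using C(3) by (metis IntD1 ends_in_segment(1))
    then show ?thesis using C y_in[of C] by (auto simp: two_faces_def)
  qed
  obtain C1 where C1: "C1 \<in> two_faces Q" "p \<in> C1" "q \<in> C1" "C1 \<inter> {x. h \<bullet> x = \<gamma>} = closed_segment y y1"
    using lift[of y1] y12 by blast
  obtain C2 where C2: "C2 \<in> two_faces Q" "p \<in> C2" "q \<in> C2" "C2 \<inter> {x. h \<bullet> x = \<gamma>} = closed_segment y y2"
    using lift[of y2] y12 by blast
  have ne: "C1 \<noteq> C2"
  proof
    assume "C1 = C2"
    then have "closed_segment y y1 = closed_segment y y2" using C1(4) C2(4) by simp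
    then show False using y12(1) by (auto simp: doubleton_eq_iff)
  qed
  have all: "C = C1 \<or> C = C2" if C: "C \<in> two_faces Q" "p \<in> C" "q \<in> C" for C
  proof -
    have Cf: "C face_of Q" "aff_dim C = 2" using C by (auto simp: two_faces_def)
    let ?E = "C \<inter> {x. h \<bullet> x = \<gamma>}"
    have E: "?E face_of K" "aff_dim ?E = 1" using face_K[OF Cf(1) C(2)] Cf(2) by auto
    have yE: "y \<in> verts ?E" using verts_face[OF E(1)] y(1) y_in[OF Cf(1)] C yH by auto
    obtain z where z: "?E = closed_segment y z"
      using edge_is_segment[OF face_of_polytope_polytope[OF polytope_K E(1)] E(2) yE] by metis
    then have "adj K y z" using E by (simp add: adj_def edge_of_def)
    then consider "z = y1" | "z = y2" using y12(2) by blast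
    then show ?thesis
    proof cases
      case 1
      then show ?thesis using face_K_unique[OF Cf(1) C(2) _ C1(2)] C1(1,4) z by (auto simp: two_faces_def)
    next
      case 2
      then show ?thesis using face_K_unique[OF Cf(1) C(2) _ C2(2)] C2(1,4) z by (auto simp: two_faces_def)
    qed
  qed
  have set: "{C \<in> two_faces Q. p \<in> C \<and> q \<in> C} = {C1, C2}" using all C1 C2 by auto
  have half: "f p \<le> f x" if f: "linear f" and pq: "f p = (f q :: real)"
    and le: "\<And>x. x \<in> C1 \<union> C2 \<Longrightarrow> f p \<le> f x" and x: "x \<in> Q" for f x
  proof (cases "x = p")
    case False
    have fy: "f y = f p" unfolding y(4) using pq by (simp add: linear_add[OF f] linear_scale[OF f] linear_diff[OF f])
    have K: "f y \<le> f z" if "z \<in> K" for z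
    proof (rule Y.le_if_nbrs_le[OF f _ that])
      fix w assume "adj K y w"
      then have "w \<in> {y1, y2}" using y12 by blast
      then have "w \<in> C1 \<union> C2" using C1(4) C2(4) by (metis IntD1 UnI1 UnI2 ends_in_segment(2) insertE singletonD)
      then show "f y \<le> f w" using le fy by simp
    qed
    obtain z s where zs: "z \<in> K" "s > 0" "x = p + s *\<^sub>R (z - p)" using ray[OF x False] by metis
    then show ?thesis using K[OF zs(1)] fy by (simp add: linear_add[OF f] linear_scale[OF f] linear_diff[OF f])
  qed simp
  show ?thesis using that[OF ne set half] by blast
qed

text \<open>This is \<open>graph_connected\<close> for \<open>K\<close>, whose vertices are the
  edges at \<open>p\<close> and whose edges are the 2-faces at \<open>p\<close>.\<close>

lemma (in vertex_figure) nbrs_connected: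
  assumes "adj Q p a" "adj Q p b"
  shows "(a, b) \<in> {(x, y). adj Q p x \<and> adj Q p y \<and> (\<exists>C\<in>two_faces Q. p \<in> C \<and> x \<in> C \<and> y \<in> C)}\<^sup>*"
    (is "_ \<in> ?R\<^sup>*")
proof -
  define pt where "pt q = (THE y. closed_segment p q \<inter> {x. h \<bullet> x = \<gamma>} = {y})" for q
  have pt: "closed_segment p q \<inter> {x. h \<bullet> x = \<gamma>} = {pt q}" "pt q \<in> verts K"
     "pt q \<in> open_segment p q" if q: "adj Q p q" for q
  proof -
    obtain y t where y: "y \<in> verts K" "0 < t" "t < 1" "y = p + t *\<^sub>R (q - p)" 
      "closed_segment p q \<inter> {x. h \<bullet> x = \<gamma>} = {y}" using edge_point[OF q] .
    have "pt q = y" unfolding pt_def using y(5) by (intro the_equality) auto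
    moreover have "y \<in> open_segment p q"
      using y adj_neq[OF q] by (auto simp: in_segment algebra_simps intro!: exI[of _ t])
    ultimately show "closed_segment p q \<inter> {x. h \<bullet> x = \<gamma>} = {pt q}" "pt q \<in> verts K"
     "pt q \<in> open_segment p q" using y by auto
  qed
  have sharing: "(q, q') \<in> ?R" if q: "adj Q p q" "adj Q p q'" and e: "adj K (pt q) (pt q')" for q q'
  proof -
    obtain C where C2: "C \<in> two_faces Q" "p \<in> C" "C \<inter> {x. h \<bullet> x = \<gamma>} = closed_segment (pt q) (pt q')"
      using edge_lift[OF e] by blast
    then have C: "C face_of Q" by (simp add: two_faces_def)
    have "pt q \<in> C" "pt q' \<in> C" using C2(3) by (metis IntD1 ends_in_segment)+
    then have "q \<in> C" "q' \<in> C"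
      using face_ofD[OF C pt(3)[OF q(1)]] face_ofD[OF C pt(3)[OF q(2)]] pv adj_verts[OF q(1)] adj_verts[OF q(2)] verts_subset
      by blast+
    then show ?thesis using q C2 by auto
  qed
  have inj: "q = q'" if "adj Q p q" "adj Q p q'" "pt q = pt q'" for q q'
    using edge_point_unique[OF that(1,2)] pt(1)[OF that(1)] pt(1)[OF that(2)] that(3) by simp
  have "adj Q p c \<Longrightarrow> pt c = z \<Longrightarrow> (a, c) \<in> ?R\<^sup>*" if "(pt a, z) \<in> {(x, y). adj K x y}\<^sup>*" for z c
    using that
  proof (induction arbitrary: c rule: rtrancl_induct)
    case base
    have "a = c" using inj[OF assms(1) base(1)] base(2) by simp
    then show ?case by simp
  next
    case (step z z')
    then have zz: "adj K z z'" by simp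
    obtain q where q: "adj Q p q" "closed_segment p q \<inter> {x. h \<bullet> x = \<gamma>} = {z}"
      using vert_K[OF adj_verts(1)[OF zz]] by metis
    then have "pt q = z" using pt(1)[OF q(1)] by simp
    then show ?case
      using step.IH[OF q(1)] sharing[OF q(1) step.prems(1)]
        zz step.prems(2) by (simp add: rtrancl_into_rtrancl)
  qed
  then show ?thesis using graph_connected[OF polytope_K pt(2)[OF assms(1)] pt(2)[OF assms(2)]] assms(2) by blast
qed

lemma edge_in_two_face:
  assumes "polytope Q" "aff_dim Q \<ge> 2" "adj Q p q"
  shows "\<exists>C\<in>two_faces Q. p \<in> C \<and> q \<in> C"
  using vertex_figure_exists[OF assms(1) adj_verts(1)[OF assms(3)]]
    vertex_figure.edge_two_faces_span(1)[OF _ assms(2,3)] by blast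

lemma vertex_in_two_face:
  assumes "polytope Q" "aff_dim Q \<ge> 2" "p \<in> verts Q"
  shows "\<exists>C\<in>two_faces Q. p \<in> C"
proof -
  obtain h \<gamma> where "vertex_figure Q p h \<gamma>" using vertex_figure_exists assms by blast
  then obtain q where "adj Q p q" using vertex_figure.has_nbr assms(2) by force
  then show ?thesis using edge_in_two_face assms by blast
qed


section \<open>Corner rotations of polyhedral surfaces\<close>

unbundle cross3_syntax

lemma sum_nonpos_0D:
  fixes f :: "'a \<Rightarrow> real"
  assumes "finite S" "\<And>x. x \<in> S \<Longrightarrow> f x \<le> 0" "sum f S = 0" "x \<in> S"
  shows "f x = 0"
  using assms sum_nonneg_eq_0_iff[of S "\<lambda>x. - f x"] by (simp add: sum_negf)

lemma bilinear_triple: "bilinear (\<lambda>x y. w \<bullet> (x \<times> y))" for w :: "real^3"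
  unfolding bilinear_def
  by (auto intro!: linearI simp: cross_add_left cross_add_right cross_mult_left cross_mult_right inner_add_right)

lemma triple_plucker:
  fixes w x y z u :: "real^3"
  shows "(w \<bullet> (x \<times> y)) * (w \<bullet> (z \<times> u)) - (w \<bullet> (x \<times> z)) * (w \<bullet> (y \<times> u)) + (w \<bullet> (x \<times> u)) * (w \<bullet> (y \<times> z)) = 0"
  by (simp add: cross3_simps)

lemma triple_reverse: "x \<bullet> (y \<times> z) = - (z \<bullet> (y \<times> x))" for x :: "real^3"
  by (simp add: cross3_simps)

text \<open>Compares a volume weighted by the position \<open>p\<close> with areas weighted by a
  normal \<open>n\<close>; needed since edge cancellation uses the former and the geometry of a face
  the latter.\<close>

lemma triple_expansion:
  fixes n p w e :: "real^3"
  shows "(n \<bullet> n) * (p \<bullet> (w \<times> e)) = (p \<bullet> n) * (n \<bullet> (w \<times> e)) - (w \<bullet> n) * (n \<bullet> (p \<times> e)) + (e \<bullet> n) * (n \<bullet> (p \<times> w))"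
  by (simp add: cross3_simps)

lemma cross_parallel:
  fixes x e :: "real^3"
  assumes "x \<times> e = 0" "e \<noteq> 0"
  shows "x = ((x \<bullet> e) / (e \<bullet> e)) *\<^sub>R e"
proof -
  have "e \<times> (x \<times> e) = (e \<bullet> e) *\<^sub>R x - (e \<bullet> x) *\<^sub>R e" by (rule Lagrange)
  then have "(e \<bullet> e) *\<^sub>R x = (x \<bullet> e) *\<^sub>R e" using assms(1) by (simp add: inner_commute)
  then have "(1 / (e \<bullet> e)) *\<^sub>R ((e \<bullet> e) *\<^sub>R x) = (1 / (e \<bullet> e)) *\<^sub>R ((x \<bullet> e) *\<^sub>R e)" by simp
  then show ?thesis using assms(2) by simp
qed

lemma perp_parallel_cross:
  fixes d p q :: "real^3"
  assumes "d \<bullet> p = 0" "d \<bullet> q = 0" "p \<times> q \<noteq> 0"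
  shows "d = ((d \<bullet> (p \<times> q)) / ((p \<times> q) \<bullet> (p \<times> q))) *\<^sub>R (p \<times> q)"
proof (rule cross_parallel[OF _ assms(3)])
  show "d \<times> (p \<times> q) = 0" using assms by (simp add: Lagrange)
qed

text \<open>The four corner velocities at an edge are \<open>w\<close> plus multiples of
  \<open>e\<close>. Hence each term is a multiple of \<open>p \<bullet> (w \<times> e)\<close>, the
  summand \<open>e\<close> of the weight \<open>p + e\<close> contributing nothing, and the
  coefficients \<open>- g\<close>, \<open>f\<close>, \<open>k - f\<close>, \<open>g - k\<close> add
  up to zero.\<close>

lemma edge_cancellation:
  fixes p e w :: "real^3"
  shows "p \<bullet> ((w + g *\<^sub>R e) \<times> w) + p \<bullet> (w \<times> (w + f *\<^sub>R e))
    + (p + e) \<bullet> ((w + f *\<^sub>R e) \<times> (w + k *\<^sub>R e)) + (p + e) \<bullet> ((w + k *\<^sub>R e) \<times> (w + g *\<^sub>R e)) = 0"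
  by (simp add: cross3_simps)

text \<open>An edge of the polar polytope is parallel to \<open>p \<times> s\<close>. After the
  quarter turn by \<open>p\<close> it is, modulo \<open>p\<close>, a multiple of the edge from
  \<open>p\<close> to \<open>s\<close>.\<close>

lemma vertex_step:
  fixes p s x :: "real^3"
  shows "p \<bullet> (((k *\<^sub>R (p \<times> s)) \<times> p) \<times> x) = k * (p \<bullet> p) * (p \<bullet> ((s - p) \<times> x))"
  by (simp add: cross3_simps)

lemma vertex_cvx_identity:
  fixes p s y :: "real^3"
  assumes "y \<bullet> p = 0"
  shows "p \<bullet> ((s - p) \<times> (y \<times> p)) = - (p \<bullet> p) * (y \<bullet> s)"
proof -
  have "p \<bullet> ((s - p) \<times> (y \<times> p)) = (p \<bullet> s) * (y \<bullet> p) - (p \<bullet> p) * (y \<bullet> s)"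
    by (simp add: cross3_simps)
  then show ?thesis using assms by simp
qed

text \<open>A mixed area term at a vertex amounts to the component of the edge along
  \<open>p\<close>, precisely the one that projection along \<open>p\<close> forgets.\<close>

lemma vertex_mixed_identity:
  fixes p n e :: "real^3"
  assumes "n \<bullet> p = 1" "n \<bullet> e = 0"
  shows "p \<bullet> ((n \<times> p) \<times> e) = - (p \<bullet> e)"
proof -
  have "p \<bullet> ((n \<times> p) \<times> e) = (p \<bullet> p) * (n \<bullet> e) - (n \<bullet> p) * (p \<bullet> e)"
    by (simp add: cross3_simps)
  then show ?thesis using assms by simp
qed

text \<open>Links the area of a triangle in the face plane with the volume of the cone over it from
  the origin, so that orientation can be tested without normals.\<close>

lemma polar_area:
  fixes n p q r :: "real^3"
  assumes "n \<bullet> p = 1" "n \<bullet> q = 1" "n \<bullet> r = 1"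
  shows "n \<bullet> ((q - p) \<times> (r - p)) = (n \<bullet> n) * (p \<bullet> (q \<times> r))"
proof -
  have "(n \<bullet> n) * (p \<bullet> (q \<times> r)) = n \<bullet> (q \<times> r) - n \<bullet> (p \<times> r) + n \<bullet> (p \<times> q)"
    using triple_expansion[of n p q r] assms by (simp add: inner_commute)
  also have "\<dots> = n \<bullet> ((q - p) \<times> (r - p))" by (simp add: cross3_simps)
  finally show ?thesis by simp
qed

section \<open>Darts and the cycles around faces and vertices\<close>

type_synonym dart = "(real^3) \<times> (real^3)"

definition dvec :: "dart \<Rightarrow> real^3" where "dvec d = snd d - fst d"

lemma dvec_swap: "dvec (prod.swap d) = - dvec d" by (simp add: dvec_def)

text \<open>A dart is an oriented edge, \<open>\<phi>\<close> passes to the next dart of the face on its left, and \<open>\<nu>\<close> is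
  the normal of that face, scaled so that the face lies in \<open>{x. \<nu> d \<bullet> x = 1}\<close>.\<close>

locale polyhedral_map =
  fixes A :: "dart set" and \<phi> :: "dart \<Rightarrow> dart" and \<nu> :: "dart \<Rightarrow> real^3"
  assumes fin: "finite A"
    and swap: "d \<in> A \<Longrightarrow> prod.swap d \<in> A"
    and phi_bij: "bij_betw \<phi> A A"
    and fst_phi: "d \<in> A \<Longrightarrow> fst (\<phi> d) = snd d"
    and nu_phi: "d \<in> A \<Longrightarrow> \<nu> (\<phi> d) = \<nu> d"
    and nu_fst: "d \<in> A \<Longrightarrow> \<nu> d \<bullet> fst d = 1"
    and orient: "d \<in> A \<Longrightarrow> fst d \<bullet> (snd d \<times> snd (\<phi> d)) > 0"
    and face_cvx: "\<lbrakk>d \<in> A; d' \<in> A; \<nu> d' = \<nu> d; d' \<noteq> d; d' \<noteq> \<phi> d\<rbrakk>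
      \<Longrightarrow> snd d \<bullet> (snd (\<phi> d) \<times> snd d') > 0"
    and vertex_cvx: "\<lbrakk>d \<in> A; d' \<in> A; fst d' = snd d; d' \<noteq> \<phi> d; d' \<noteq> prod.swap d\<rbrakk>
      \<Longrightarrow> \<nu> d' \<bullet> fst d < 1"
begin

lemma phi_in: "d \<in> A \<Longrightarrow> \<phi> d \<in> A"
  using phi_bij bij_betwE by blast

lemma phi_inj: "\<lbrakk>d \<in> A; d' \<in> A; \<phi> d = \<phi> d'\<rbrakk> \<Longrightarrow> d = d'"
  using phi_bij by (auto simp: bij_betw_def inj_on_def)

lemma nu_snd: "d \<in> A \<Longrightarrow> \<nu> d \<bullet> snd d = 1"
  using nu_fst[OF phi_in] nu_phi fst_phi by metis

lemma nu_dvec: "d \<in> A \<Longrightarrow> \<nu> d \<bullet> dvec d = 0"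
  by (simp add: dvec_def inner_diff_right nu_fst nu_snd)

lemma nu_nonzero: "d \<in> A \<Longrightarrow> \<nu> d \<noteq> 0"
  using nu_fst by fastforce

lemma fst_nonzero: "d \<in> A \<Longrightarrow> fst d \<noteq> 0"
  using nu_fst by fastforce

lemma dvec_nonzero: "d \<in> A \<Longrightarrow> dvec d \<noteq> 0"
  using orient[of d] by (auto simp: dvec_def dot_cross_self)

definition \<psi> :: "dart \<Rightarrow> dart" where "\<psi> = inv_into A \<phi>"

text \<open>Rotation about the tail: the next dart runs along the other edge that the left face of
  \<open>d\<close> has at this vertex.\<close>

definition \<sigma> :: "dart \<Rightarrow> dart" where "\<sigma> d = prod.swap (\<psi> d)"

lemma psi_in: "d \<in> A \<Longrightarrow> \<psi> d \<in> A"
  unfolding \<psi>_def using phi_bij by (metis bij_betw_imp_surj_on inv_into_into)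

lemma phi_psi: "d \<in> A \<Longrightarrow> \<phi> (\<psi> d) = d"
  unfolding \<psi>_def using phi_bij by (metis bij_betw_inv_into_right)

lemma psi_phi: "d \<in> A \<Longrightarrow> \<psi> (\<phi> d) = d"
  unfolding \<psi>_def using phi_bij by (metis bij_betw_inv_into_left)

lemma sigma_in: "d \<in> A \<Longrightarrow> \<sigma> d \<in> A"
  by (simp add: \<sigma>_def psi_in swap)

lemma swap_sigma: "prod.swap (\<sigma> d) = \<psi> d"
  by (simp add: \<sigma>_def)

lemma fst_sigma: "d \<in> A \<Longrightarrow> fst (\<sigma> d) = fst d"
  using fst_phi[OF psi_in] phi_psi by (simp add: \<sigma>_def)

lemma snd_psi: "d \<in> A \<Longrightarrow> snd (\<psi> d) = fst d"
  using fst_phi[OF psi_in] phi_psi by simp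

lemma sigma_inj: "\<lbrakk>d \<in> A; d' \<in> A; \<sigma> d = \<sigma> d'\<rbrakk> \<Longrightarrow> d = d'"
  by (metis swap_sigma phi_psi)

lemma sum_swap: "(\<Sum>d\<in>A. f (prod.swap d)) = (\<Sum>d\<in>A. f d)"
  by (rule sum.reindex_bij_witness[of _ prod.swap prod.swap]) (auto simp: swap)

lemma face_phi_bij: "bij_betw \<phi> {d \<in> A. \<nu> d = c} {d \<in> A. \<nu> d = c}"
proof -
  have "inj_on \<phi> {d \<in> A. \<nu> d = c}" using phi_inj by (auto simp: inj_on_def)
  moreover have "\<phi> ` {d \<in> A. \<nu> d = c} \<subseteq> {d \<in> A. \<nu> d = c}" using phi_in nu_phi by auto
  ultimately show ?thesis using fin by (simp add: bij_betw_def endo_inj_surj)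
qed

lemma vertex_sigma_bij: "bij_betw \<sigma> {d \<in> A. fst d = p} {d \<in> A. fst d = p}"
proof -
  have "inj_on \<sigma> {d \<in> A. fst d = p}" using sigma_inj by (auto simp: inj_on_def)
  moreover have "\<sigma> ` {d \<in> A. fst d = p} \<subseteq> {d \<in> A. fst d = p}" using sigma_in fst_sigma by auto
  ultimately show ?thesis using fin by (simp add: bij_betw_def endo_inj_surj)
qed

text \<open>The comparison polygon is the face itself. A dart represents the corner at its head
  here, because the edge \<open>e q\<close> has to end at \<open>\<eta> q\<close>.\<close>

lemma face_cycle:
  assumes "d0 \<in> A" "c = \<nu> d0"
  shows "convex_cycle (\<lambda>x y. c \<bullet> (x \<times> y)) {d \<in> A. \<nu> d = c} \<phi> dvec snd (\<lambda>_. 1)"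
proof
  let ?J = "{d \<in> A. \<nu> d = c}"
  have cc: "c \<bullet> c > 0" using nu_nonzero[OF assms(1)] assms(2) by simp
  show "finite ?J" using fin by simp
  show "?J \<noteq> {}" using assms by blast
  show "bij_betw \<phi> ?J ?J" by (rule face_phi_bij)
  fix d assume d: "d \<in> ?J"
  then have dA: "d \<in> A" and c: "\<nu> d = c" by auto
  note P = phi_in[OF dA]
  have n: "c \<bullet> fst d = 1" "c \<bullet> snd d = 1" "c \<bullet> snd (\<phi> d) = 1"
    using nu_fst[OF dA] nu_snd[OF dA] nu_snd[OF P] nu_phi[OF dA] c by auto
  have "c \<bullet> (dvec d \<times> dvec (\<phi> d)) = c \<bullet> ((snd d - fst d) \<times> (snd (\<phi> d) - fst d))"
    unfolding dvec_def fst_phi[OF dA] by (simp add: cross3_simps)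
  then show "0 < c \<bullet> (dvec d \<times> dvec (\<phi> d))"
    using polar_area[OF n] orient[OF dA] cc by simp
  show "c \<bullet> ((snd (\<phi> d) - snd d) \<times> x) = 1 * (c \<bullet> (dvec (\<phi> d) \<times> x))" for x
    by (simp add: dvec_def fst_phi[OF dA])
  fix d' assume d': "d' \<in> ?J" "d' \<noteq> d" "d' \<noteq> \<phi> d"
  then have "d' \<in> A" "\<nu> d' = c" by simp_all
  then have "c \<bullet> snd d' = 1" using nu_snd[of d'] by simp
  then show "0 < c \<bullet> (dvec (\<phi> d) \<times> (snd d' - snd d))"
    using polar_area[OF n(2,3), of "snd d'"] face_cvx[OF dA, of d'] d' c cc
    by (simp add: dvec_def fst_phi[OF dA])
qed (simp_all add: bilinear_triple triple_plucker)

text \<open>The normals on the two sides of an edge differ by a multiple of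
  \<open>fst d \<times> snd d\<close>. That multiple times \<open>fst d \<bullet> fst d\<close> is
  the length factor in \<open>vertex_step\<close>.\<close>

definition kap :: "dart \<Rightarrow> real" where
  "kap d = (\<nu> d - \<nu> (prod.swap d)) \<bullet> (fst d \<times> snd d) / ((fst d \<times> snd d) \<bullet> (fst d \<times> snd d)) * (fst d \<bullet> fst d)"

lemma kap:
  assumes d: "d \<in> A"
  shows "kap d > 0"
    and "fst d \<bullet> (((\<nu> d - \<nu> (prod.swap d)) \<times> fst d) \<times> x) = kap d * (fst d \<bullet> (dvec d \<times> x))"
proof -
  let ?p = "fst d" and ?s = "snd d"
  let ?d0 = "prod.swap d"
  let ?q = "snd (\<phi> ?d0)"
  define k where "k = (\<nu> d - \<nu> ?d0) \<bullet> (?p \<times> ?s) / ((?p \<times> ?s) \<bullet> (?p \<times> ?s))"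
  have d0: "?d0 \<in> A" using swap[OF d] .
  have or0: "?s \<bullet> (?p \<times> ?q) > 0" using orient[OF d0] by simp
  have rev: "?q \<bullet> (?p \<times> ?s) = - (?s \<bullet> (?p \<times> ?q))" by (rule triple_reverse)
  have nz: "?p \<times> ?s \<noteq> 0"
  proof
    assume "?p \<times> ?s = 0"
    then show False using or0 rev by simp
  qed
  have "\<nu> d - \<nu> ?d0 = k *\<^sub>R (?p \<times> ?s)"
    unfolding k_def using nu_fst[OF d] nu_snd[OF d] nu_fst[OF d0] nu_snd[OF d0]
    by (intro perp_parallel_cross nz) (auto simp: inner_diff_left)
  note k = this
  have kk: "kap d = k * (?p \<bullet> ?p)" by (simp add: kap_def k_def)
  show "fst d \<bullet> (((\<nu> d - \<nu> (prod.swap d)) \<times> fst d) \<times> x) = kap d * (fst d \<bullet> (dvec d \<times> x))"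
    unfolding k kk dvec_def by (rule vertex_step)
  have p0: "\<phi> ?d0 \<in> A" using phi_in[OF d0] .
  have f0: "fst (\<phi> ?d0) = ?p" using fst_phi[OF d0] by simp
  \<comment> \<open>\<open>?e\<close> runs from \<open>?q\<close> to \<open>?p\<close>. Through it
    \<open>vertex_cvx\<close> places \<open>?q\<close>, a vertex of the right face of
    \<open>d\<close>, strictly below the plane of the left face; this decides the sign of
    \<open>k\<close>.\<close>
  let ?e = "prod.swap (\<phi> ?d0)"
  have e: "?e \<in> A" using swap[OF p0] .
  have "d \<noteq> \<phi> ?e"
  proof
    assume "d = \<phi> ?e"
    then have "?q \<bullet> (?p \<times> ?s) > 0" using orient[OF e] f0 by simp
    then show False using or0 rev by simp
  qed
  moreover have "d \<noteq> prod.swap ?e" using or0 by (auto simp: dot_cross_self)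
  ultimately have "\<nu> d \<bullet> ?q < 1" using vertex_cvx[OF e d] f0 by simp
  moreover have "\<nu> ?d0 \<bullet> ?q = 1" using nu_snd[OF p0] nu_phi[OF d0] by simp
  ultimately have "(\<nu> d - \<nu> ?d0) \<bullet> ?q < 0" by (simp add: inner_diff_left)
  then have "k * (?q \<bullet> (?p \<times> ?s)) < 0" unfolding k by (simp add: inner_commute)
  moreover have "?q \<bullet> (?p \<times> ?s) < 0" using or0 rev by simp
  ultimately have "k > 0" by (simp add: mult_less_0_iff)
  then show "kap d > 0" using kk fst_nonzero[OF d] by simp
qed

text \<open>Up to a quarter turn and projection along \<open>p\<close>, the points \<open>\<nu> d \<times> p\<close> are the vertices
  of the face dual to \<open>p\<close> of the polar polytope.\<close>

lemma vertex_cycle: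
  assumes "d0 \<in> A" "p = fst d0"
  shows "convex_cycle (\<lambda>x y. p \<bullet> (x \<times> y)) {d \<in> A. fst d = p} \<sigma> dvec (\<lambda>d. \<nu> d \<times> p) kap"
proof
  let ?J = "{d \<in> A. fst d = p}"
  have pp: "p \<bullet> p > 0" using fst_nonzero[OF assms(1)] assms(2) by simp
  show "finite ?J" using fin by simp
  show "?J \<noteq> {}" using assms by blast
  show "bij_betw \<sigma> ?J ?J" by (rule vertex_sigma_bij)
  fix d assume d: "d \<in> ?J"
  then have dA: "d \<in> A" and p: "fst d = p" by auto
  note S = sigma_in[OF dA] and P = psi_in[OF dA]
  have fs: "fst (\<sigma> d) = p" using fst_sigma[OF dA] p by simp
  have ss: "snd (\<sigma> d) = fst (\<psi> d)" by (simp add: \<sigma>_def)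
  have sp: "snd (\<psi> d) = p" using snd_psi[OF dA] p by simp
  have np: "\<nu> (\<psi> d) = \<nu> d" using nu_phi[OF P] phi_psi[OF dA] by simp
  have "p \<bullet> (dvec d \<times> dvec (\<sigma> d)) = fst (\<psi> d) \<bullet> (p \<times> snd d)"
    unfolding dvec_def p fs ss by (simp add: cross3_simps)
  then show "0 < p \<bullet> (dvec d \<times> dvec (\<sigma> d))"
    using orient[OF P] phi_psi[OF dA] sp by simp
  show "0 < kap d" using kap(1)[OF dA] .
  show "p \<bullet> ((\<nu> (\<sigma> d) \<times> p - \<nu> d \<times> p) \<times> x) = kap (\<sigma> d) * (p \<bullet> (dvec (\<sigma> d) \<times> x))" for x
    using kap(2)[OF S, of x] fs np by (simp add: swap_sigma Cross3.left_diff_distrib)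
  fix d' assume d': "d' \<in> ?J" "d' \<noteq> d" "d' \<noteq> \<sigma> d"
  have "\<nu> d' \<bullet> fst (\<psi> d) < 1"
    using vertex_cvx[OF P, of d'] d' sp phi_psi[OF dA] by (simp add: \<sigma>_def)
  then have lt: "(\<nu> d' - \<nu> d) \<bullet> fst (\<psi> d) < 0" using nu_fst[OF P] np by (simp add: inner_diff_left)
  have "(\<nu> d' - \<nu> d) \<bullet> p = 0" using nu_fst[OF dA] nu_fst[of d'] d' p by (simp add: inner_diff_left)
  from vertex_cvx_identity[OF this, of "fst (\<psi> d)"]
  have "p \<bullet> (dvec (\<sigma> d) \<times> (\<nu> d' \<times> p - \<nu> d \<times> p)) = - (p \<bullet> p) * ((\<nu> d' - \<nu> d) \<bullet> fst (\<psi> d))"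
    by (simp add: dvec_def fs ss Cross3.left_diff_distrib)
  then show "0 < p \<bullet> (dvec (\<sigma> d) \<times> (\<nu> d' \<times> p - \<nu> d \<times> p))"
    using pp lt by (simp add: mult_less_0_iff)
qed (simp_all add: bilinear_triple triple_plucker)

end

text \<open>The vector \<open>\<omega> d\<close> is the angular velocity of the corner of the left face of \<open>d\<close> at its tail.\<close>

locale corner_motion = polyhedral_map +
  fixes u :: "real^3 \<Rightarrow> real^3" and \<omega> :: "dart \<Rightarrow> real^3"
  assumes tail: "d \<in> A \<Longrightarrow> \<omega> d \<times> dvec d = u (snd d) - u (fst d)"
    and head: "d \<in> A \<Longrightarrow> \<omega> (\<phi> d) \<times> dvec d = u (snd d) - u (fst d)"
    and spin: "\<lbrakk>d \<in> A; d' \<in> A; \<nu> d' = \<nu> d\<rbrakk> \<Longrightarrow> \<omega> d' \<bullet> \<nu> d = \<omega> d \<bullet> \<nu> d"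
begin

text \<open>The coefficient of the jump of \<open>\<omega>\<close> along the left side of the edge,
  from tail to head; \<open>lam\<close> belongs to the jump across the edge at its tail, from right
  to left.\<close>

definition \<mu> :: "dart \<Rightarrow> real" where
  "\<mu> d = (\<omega> (\<phi> d) - \<omega> d) \<bullet> dvec d / (dvec d \<bullet> dvec d)"

definition lam :: "dart \<Rightarrow> real" where
  "lam d = (\<omega> d - \<omega> (\<phi> (prod.swap d))) \<bullet> dvec d / (dvec d \<bullet> dvec d)"

lemma mu: "d \<in> A \<Longrightarrow> \<omega> (\<phi> d) - \<omega> d = \<mu> d *\<^sub>R dvec d"
  unfolding \<mu>_def by (rule cross_parallel) (auto simp: dvec_nonzero Cross3.left_diff_distrib tail head)

lemma lam: "d \<in> A \<Longrightarrow> \<omega> d - \<omega> (\<phi> (prod.swap d)) = lam d *\<^sub>R dvec d"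
proof -
  assume d: "d \<in> A"
  have "\<omega> (\<phi> (prod.swap d)) \<times> dvec d = u (snd d) - u (fst d)"
    using arg_cong[OF head[OF swap[OF d]], of uminus] by (simp add: dvec_swap)
  then show ?thesis unfolding lam_def
    using d by (intro cross_parallel) (auto simp: dvec_nonzero Cross3.left_diff_distrib tail)
qed

lemma lam_sigma: "d \<in> A \<Longrightarrow> \<omega> (\<sigma> d) - \<omega> d = lam (\<sigma> d) *\<^sub>R dvec (\<sigma> d)"
  using lam[OF sigma_in] by (simp add: swap_sigma phi_psi)

definition vterm :: "dart \<Rightarrow> real" where
  "vterm d = fst d \<bullet> (\<omega> (\<phi> (prod.swap d)) \<times> \<omega> d)"

text \<open>The weight is the position \<open>fst d\<close> and not the face normal, since only so
  do face and vertex terms cancel at each edge. \<open>face_sum\<close> translates it back into area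
  in the face plane.\<close>

definition fterm :: "dart \<Rightarrow> real" where
  "fterm d = fst d \<bullet> (\<omega> d \<times> \<omega> (\<phi> d))"

text \<open>The angular velocities of the four corners at an edge differ by multiples of the edge.\<close>

lemma edge_sum_zero:
  assumes d: "d \<in> A"
  shows "vterm d + fterm d + (vterm (prod.swap d) + fterm (prod.swap d)) = 0"
proof -
  let ?d' = "prod.swap d"
  have 1: "\<omega> (\<phi> d) = \<omega> d + \<mu> d *\<^sub>R dvec d" using mu[OF d] by (simp add: algebra_simps)
  have 2: "\<omega> (\<phi> ?d') = \<omega> d + (- lam d) *\<^sub>R dvec d" using lam[OF d] by (simp add: algebra_simps)
  have "\<omega> ?d' = \<omega> (\<phi> d) + lam ?d' *\<^sub>R dvec ?d'" using lam[OF swap[OF d]] by (simp add: algebra_simps)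
  then have 3: "\<omega> ?d' = \<omega> d + (\<mu> d - lam ?d') *\<^sub>R dvec d"
    unfolding 1 dvec_swap by (simp add: algebra_simps)
  have 4: "snd d = fst d + dvec d" by (simp add: dvec_def)
  have "vterm d + fterm d + (vterm ?d' + fterm ?d') =
     fst d \<bullet> (\<omega> (\<phi> ?d') \<times> \<omega> d) + fst d \<bullet> (\<omega> d \<times> \<omega> (\<phi> d))
     + snd d \<bullet> (\<omega> (\<phi> d) \<times> \<omega> ?d') + snd d \<bullet> (\<omega> ?d' \<times> \<omega> (\<phi> ?d'))"
    by (simp add: vterm_def fterm_def)
  also have "\<dots> = 0" unfolding 1 2 3 4 by (rule edge_cancellation)
  finally show ?thesis .
qed

lemma total_zero: "(\<Sum>d\<in>A. vterm d) + (\<Sum>d\<in>A. fterm d) = 0"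
proof -
  have "2 * (\<Sum>d\<in>A. vterm d + fterm d) = (\<Sum>d\<in>A. vterm d + fterm d + (vterm (prod.swap d) + fterm (prod.swap d)))"
    using sum_swap[of "\<lambda>d. vterm d + fterm d"] by (simp add: sum.distrib)
  also have "\<dots> = 0" using edge_sum_zero by simp
  finally show ?thesis by (simp add: sum.distrib)
qed

text \<open>The jumps across the edges at \<open>p\<close> add up to zero in space, hence also in
  the direction \<open>p\<close> that the area form does not see. By
  \<open>vertex_mixed_identity\<close> this is the vanishing of the mixed area.\<close>

lemma vertex_sum:
  assumes "d0 \<in> A" "p = fst d0"
  shows "(\<Sum>d | d \<in> A \<and> fst d = p. vterm d) \<le> 0"
    and "(\<Sum>d | d \<in> A \<and> fst d = p. vterm d) = 0 \<Longrightarrow> lam d0 = 0"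
proof -
  let ?J = "{d \<in> A. fst d = p}"
  interpret V: convex_cycle "\<lambda>x y. p \<bullet> (x \<times> y)" ?J \<sigma> dvec "\<lambda>d. \<nu> d \<times> p" kap
    by (rule vertex_cycle[OF assms])
  have "(\<Sum>d\<in>?J. vterm d) = (\<Sum>d\<in>?J. vterm (\<sigma> d))" using V.sum_nx[of vterm] by simp
  also have "\<dots> = (\<Sum>d\<in>?J. p \<bullet> (\<omega> d \<times> \<omega> (\<sigma> d)))"
    by (rule sum.cong[OF refl]) (simp add: vterm_def fst_sigma swap_sigma phi_psi)
  finally have eq: "(\<Sum>d\<in>?J. vterm d) = (\<Sum>d\<in>?J. p \<bullet> (\<omega> d \<times> \<omega> (\<sigma> d)))" .
  have om: "p \<bullet> ((\<omega> (\<sigma> d) - \<omega> d) \<times> x) = lam (\<sigma> d) * (p \<bullet> (dvec (\<sigma> d) \<times> x))" if "d \<in> ?J" for d x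
    using lam_sigma[of d] that by (simp add: cross_mult_left)
  have "(\<Sum>d\<in>?J. lam d * (p \<bullet> ((\<nu> d \<times> p) \<times> dvec d))) = (\<Sum>d\<in>?J. - (p \<bullet> (lam d *\<^sub>R dvec d)))"
  proof (rule sum.cong[OF refl])
    fix d assume "d \<in> ?J"
    then have "\<nu> d \<bullet> p = 1" "\<nu> d \<bullet> dvec d = 0" using nu_fst[of d] nu_dvec[of d] by auto
    from vertex_mixed_identity[OF this]
    show "lam d * (p \<bullet> ((\<nu> d \<times> p) \<times> dvec d)) = - (p \<bullet> (lam d *\<^sub>R dvec d))" by simp
  qed
  also have "\<dots> = - (p \<bullet> (\<Sum>d\<in>?J. lam (\<sigma> d) *\<^sub>R dvec (\<sigma> d)))"
    by (simp add: sum_negf inner_sum_right V.sum_nx[of "\<lambda>d. p \<bullet> (lam d *\<^sub>R dvec d)", symmetric] del: inner_scaleR_right)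
  also have "(\<Sum>d\<in>?J. lam (\<sigma> d) *\<^sub>R dvec (\<sigma> d)) = (\<Sum>d\<in>?J. \<omega> (\<sigma> d) - \<omega> d)"
    by (rule sum.cong[OF refl]) (simp add: lam_sigma)
  also have "\<dots> = 0" using sum.reindex_bij_betw[OF V.nx, of \<omega>] by (simp add: sum_subtractf)
  finally have mixed: "(\<Sum>d\<in>?J. lam d * (p \<bullet> ((\<nu> d \<times> p) \<times> dvec d))) = 0" by simp
  show "(\<Sum>d | d \<in> A \<and> fst d = p. vterm d) \<le> 0"
    unfolding eq by (rule V.minkowski_inequality(1)[OF om mixed])
  assume "(\<Sum>d | d \<in> A \<and> fst d = p. vterm d) = 0"
  then show "lam d0 = 0"
    unfolding eq using V.minkowski_inequality(2)[OF om mixed] assms by blast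
qed

text \<open>The mixed area telescopes because the displacement \<open>u\<close> returns to its value
  around the face. By \<open>spin\<close>, passing from the weight \<open>fst d\<close> to the
  normal \<open>c\<close> costs only a constant multiple of this mixed area.\<close>

lemma face_sum:
  assumes d0: "d0 \<in> A" "c = \<nu> d0"
  shows "(\<Sum>d | d \<in> A \<and> \<nu> d = c. fterm d) \<le> 0"
    and "(\<Sum>d | d \<in> A \<and> \<nu> d = c. fterm d) = 0 \<Longrightarrow> \<mu> d0 = 0"
proof -
  let ?J = "{d \<in> A. \<nu> d = c}"
  interpret F: convex_cycle "\<lambda>x y. c \<bullet> (x \<times> y)" ?J \<phi> dvec snd "\<lambda>_. 1"
    by (rule face_cycle[OF assms])
  have cc: "c \<bullet> c > 0" using nu_nonzero[OF assms(1)] assms(2) by simp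
  \<comment> \<open>The corner at the head of \<open>d\<close> is that of \<open>\<phi> d\<close>,
    so \<open>\<omega>\<close> is shifted by \<open>\<phi>\<close> to match the convention of
    \<open>face_cycle\<close>.\<close>
  have om: "c \<bullet> ((\<omega> (\<phi> (\<phi> d)) - \<omega> (\<phi> d)) \<times> x) = \<mu> (\<phi> d) * (c \<bullet> (dvec (\<phi> d) \<times> x))" if "d \<in> ?J" for d x
    using mu[OF phi_in, of d] that by (simp add: cross_mult_left)
  have "(\<Sum>d\<in>?J. \<mu> d * (c \<bullet> (snd d \<times> dvec d))) = (\<Sum>d\<in>?J. c \<bullet> (snd d \<times> \<omega> (\<phi> d)) - c \<bullet> (snd d \<times> \<omega> d))"
  proof (rule sum.cong[OF refl])
    fix d assume "d \<in> ?J"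
    then have "\<mu> d *\<^sub>R dvec d = \<omega> (\<phi> d) - \<omega> d" using mu by simp
    then show "\<mu> d * (c \<bullet> (snd d \<times> dvec d)) = c \<bullet> (snd d \<times> \<omega> (\<phi> d)) - c \<bullet> (snd d \<times> \<omega> d)"
      by (metis cross_mult_right inner_scaleR_right Cross3.right_diff_distrib inner_diff_right)
  qed
  also have "\<dots> = (\<Sum>d\<in>?J. c \<bullet> (fst (\<phi> d) \<times> \<omega> (\<phi> d))) - (\<Sum>d\<in>?J. c \<bullet> (snd d \<times> \<omega> d))"
    unfolding sum_subtractf by (simp add: fst_phi)
  also have "\<dots> = (\<Sum>d\<in>?J. c \<bullet> (fst d \<times> \<omega> d)) - (\<Sum>d\<in>?J. c \<bullet> (snd d \<times> \<omega> d))"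
    using F.sum_nx[of "\<lambda>d. c \<bullet> (fst d \<times> \<omega> d)"] by simp
  also have "\<dots> = (\<Sum>d\<in>?J. c \<bullet> (\<omega> d \<times> dvec d))"
    unfolding sum_subtractf[symmetric] dvec_def by (rule sum.cong[OF refl]) (simp add: cross3_simps)
  also have "\<dots> = (\<Sum>d\<in>?J. c \<bullet> u (snd d)) - (\<Sum>d\<in>?J. c \<bullet> u (fst d))"
    unfolding sum_subtractf[symmetric] by (rule sum.cong[OF refl]) (simp add: tail inner_diff_right)
  also have "(\<Sum>d\<in>?J. c \<bullet> u (snd d)) = (\<Sum>d\<in>?J. c \<bullet> u (fst (\<phi> d)))" by (simp add: fst_phi)
  also have "\<dots> = (\<Sum>d\<in>?J. c \<bullet> u (fst d))" using F.sum_nx[of "\<lambda>d. c \<bullet> u (fst d)"] by simp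
  finally have mixed: "(\<Sum>d\<in>?J. \<mu> d * (c \<bullet> (snd d \<times> dvec d))) = 0" by simp
  have "(c \<bullet> c) * (\<Sum>d\<in>?J. fterm d) = (\<Sum>d\<in>?J. c \<bullet> (\<omega> d \<times> \<omega> (\<phi> d)) - (\<omega> d0 \<bullet> c) * (\<mu> d * (c \<bullet> (snd d \<times> dvec d))))"
    unfolding sum_distrib_left
  proof (rule sum.cong[OF refl])
    fix d assume d: "d \<in> ?J"
    then have dA: "d \<in> A" and nd: "\<nu> d = c" by auto
    have w: "\<omega> (\<phi> d) = \<omega> d + \<mu> d *\<^sub>R dvec d" using mu[OF dA] by (simp add: algebra_simps)
    have ww: "v \<bullet> (\<omega> d \<times> \<omega> (\<phi> d)) = \<mu> d * (v \<bullet> (\<omega> d \<times> dvec d))" for v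
      unfolding w by (simp add: cross_add_right cross_mult_right)
    have sp: "\<omega> d \<bullet> c = \<omega> d0 \<bullet> c" using spin[OF d0(1) dA] nd d0(2) by simp
    have "fst d \<bullet> c = 1" "dvec d \<bullet> c = 0" using nu_fst[OF dA] nu_dvec[OF dA] nd by (auto simp: inner_commute)
    then have "(c \<bullet> c) * (fst d \<bullet> (\<omega> d \<times> dvec d)) = c \<bullet> (\<omega> d \<times> dvec d) - (\<omega> d0 \<bullet> c) * (c \<bullet> (fst d \<times> dvec d))"
      using triple_expansion[of c "fst d" "\<omega> d" "dvec d"] sp by simp
    moreover have "c \<bullet> (fst d \<times> dvec d) = c \<bullet> (snd d \<times> dvec d)"
      unfolding dvec_def by (simp add: cross3_simps)
    ultimately have "\<mu> d * ((c \<bullet> c) * (fst d \<bullet> (\<omega> d \<times> dvec d))) = 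
       \<mu> d * (c \<bullet> (\<omega> d \<times> dvec d)) - \<mu> d * ((\<omega> d0 \<bullet> c) * (c \<bullet> (snd d \<times> dvec d)))"
      by (simp add: right_diff_distrib)
    then show "c \<bullet> c * fterm d = c \<bullet> (\<omega> d \<times> \<omega> (\<phi> d)) - (\<omega> d0 \<bullet> c) * (\<mu> d * (c \<bullet> (snd d \<times> dvec d)))"
      unfolding fterm_def ww by (simp add: mult.left_commute)
  qed
  also have "\<dots> = (\<Sum>d\<in>?J. c \<bullet> (\<omega> d \<times> \<omega> (\<phi> d)))"
    unfolding sum_subtractf using mixed by (simp add: sum_distrib_left[symmetric])
  also have "\<dots> = (\<Sum>d\<in>?J. c \<bullet> (\<omega> (\<phi> d) \<times> \<omega> (\<phi> (\<phi> d))))"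
    using F.sum_nx[of "\<lambda>d. c \<bullet> (\<omega> d \<times> \<omega> (\<phi> d))"] by simp
  finally have eq: "(c \<bullet> c) * (\<Sum>d\<in>?J. fterm d) = (\<Sum>d\<in>?J. c \<bullet> (\<omega> (\<phi> d) \<times> \<omega> (\<phi> (\<phi> d))))" .
  have "(c \<bullet> c) * (\<Sum>d\<in>?J. fterm d) \<le> 0"
    unfolding eq by (rule F.minkowski_inequality(1)[where \<omega> = "\<lambda>d. \<omega> (\<phi> d)", OF om mixed])
  then show "(\<Sum>d | d \<in> A \<and> \<nu> d = c. fterm d) \<le> 0" using cc by (simp add: mult_le_0_iff)
  assume "(\<Sum>d | d \<in> A \<and> \<nu> d = c. fterm d) = 0"
  then have "(\<Sum>d\<in>?J. c \<bullet> (\<omega> (\<phi> d) \<times> \<omega> (\<phi> (\<phi> d)))) = 0" using eq by simp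
  then show "\<mu> d0 = 0"
    using F.minkowski_inequality(2)[where \<omega> = "\<lambda>d. \<omega> (\<phi> d)", OF om mixed] d0 by blast
qed

theorem corner_rotations_agree:
  assumes d: "d \<in> A"
  shows "\<omega> (\<phi> d) = \<omega> d" "\<omega> (prod.swap d) = \<omega> d"
proof -
  have V: "(\<Sum>d\<in>A. vterm d) = (\<Sum>p\<in>fst ` A. \<Sum>d | d \<in> A \<and> fst d = p. vterm d)"
    by (rule sum.image_gen[OF fin])
  have F: "(\<Sum>d\<in>A. fterm d) = (\<Sum>c\<in>\<nu> ` A. \<Sum>d | d \<in> A \<and> \<nu> d = c. fterm d)"
    by (rule sum.image_gen[OF fin])
  have Vle: "\<And>p. p \<in> fst ` A \<Longrightarrow> (\<Sum>d | d \<in> A \<and> fst d = p. vterm d) \<le> 0" using vertex_sum(1) by blast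
  have Fle: "\<And>c. c \<in> \<nu> ` A \<Longrightarrow> (\<Sum>d | d \<in> A \<and> \<nu> d = c. fterm d) \<le> 0" using face_sum(1) by blast
  have "(\<Sum>d\<in>A. vterm d) \<le> 0" "(\<Sum>d\<in>A. fterm d) \<le> 0"
    unfolding V F using Vle Fle by (simp_all add: sum_nonpos)
  then have "(\<Sum>d\<in>A. vterm d) = 0" "(\<Sum>d\<in>A. fterm d) = 0" using total_zero by linarith+
  then have VF: "(\<Sum>p\<in>fst ` A. \<Sum>d | d \<in> A \<and> fst d = p. vterm d) = 0"
    "(\<Sum>c\<in>\<nu> ` A. \<Sum>d | d \<in> A \<and> \<nu> d = c. fterm d) = 0" unfolding V F .
  have V0: "(\<Sum>d | d \<in> A \<and> fst d = p. vterm d) = 0" if "p \<in> fst ` A" for p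
    by (rule sum_nonpos_0D[OF finite_imageI[OF fin] Vle VF(1) that])
  have F0: "(\<Sum>d | d \<in> A \<and> \<nu> d = c. fterm d) = 0" if "c \<in> \<nu> ` A" for c
    by (rule sum_nonpos_0D[OF finite_imageI[OF fin] Fle VF(2) that])
  have mu0: "\<mu> d = 0" if "d \<in> A" for d using face_sum(2)[OF that refl] F0 that by blast
  have lam0: "lam d = 0" if "d \<in> A" for d using vertex_sum(2)[OF that refl] V0 that by blast
  show "\<omega> (\<phi> d) = \<omega> d" using mu[OF d] mu0[OF d] by simp
  then show "\<omega> (prod.swap d) = \<omega> d" using lam[OF swap[OF d]] lam0[OF swap[OF d]] by simp
qed

end

section \<open>Polytopes in three dimensions\<close>

locale polytope3 =
  fixes P :: "(real^3) set"
  assumes poly: "polytope P" and int0: "0 \<in> interior P"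
begin

lemma dim3: "aff_dim P = 3"
  using aff_dim_nonempty_interior[of P] int0 by auto

lemma positive_somewhere:
  assumes "n \<noteq> 0" shows "\<exists>x\<in>P. n \<bullet> x > 0"
proof -
  obtain e where e: "e > 0" "ball 0 e \<subseteq> P" using int0 mem_interior by blast
  define x where "x = (e / (2 * norm n)) *\<^sub>R n"
  have "norm x < e" using e assms by (simp add: x_def)
  moreover have "n \<bullet> x > 0" using e assms by (simp add: x_def)
  ultimately show ?thesis using e by (auto simp: subset_iff)
qed

lemma face_normal:
  assumes "C \<in> two_faces P"
  shows "\<exists>n. C = P \<inter> {x. n \<bullet> x = 1} \<and> P \<subseteq> {x. n \<bullet> x \<le> 1}"
proof -
  have "C \<noteq> {}" "C face_of P" using assms by (auto simp: two_faces_def)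
  then have "C facet_of P" using assms dim3 by (simp add: facet_of_def two_faces_def)
  then obtain a b where ab: "a \<noteq> 0" "P \<subseteq> {x. a \<bullet> x \<le> b}" "C = P \<inter> {x. a \<bullet> x = b}"
    using facet_of_polyhedron[OF polytope_imp_polyhedron[OF poly]] by blast
  obtain x where "x \<in> P" "a \<bullet> x > 0" using positive_somewhere[OF ab(1)] by blast
  then have b: "b > 0" using ab(2) by force
  have "\<And>x. (inverse b *\<^sub>R a) \<bullet> x = 1 \<longleftrightarrow> a \<bullet> x = b" "\<And>x. (inverse b *\<^sub>R a) \<bullet> x \<le> 1 \<longleftrightarrow> a \<bullet> x \<le> b"
    using b by (auto simp: field_simps)
  then show ?thesis using ab by (intro exI[of _ "inverse b *\<^sub>R a"]) auto
qed

text \<open>The vertex of the polar polytope dual to the facet \<open>C\<close>. Scaling the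
  right-hand side to 1 is possible as \<open>0\<close> is interior to \<open>P\<close>.\<close>

definition pol :: "(real^3) set \<Rightarrow> real^3" where
  "pol C = (SOME n. C = P \<inter> {x. n \<bullet> x = 1} \<and> P \<subseteq> {x. n \<bullet> x \<le> 1})"

lemma pol:
  assumes "C \<in> two_faces P"
  shows "C = P \<inter> {x. pol C \<bullet> x = 1}" "P \<subseteq> {x. pol C \<bullet> x \<le> 1}"
  using someI_ex[OF face_normal[OF assms]] unfolding pol_def by blast+

lemma pol_eq1: "C \<in> two_faces P \<Longrightarrow> x \<in> C \<Longrightarrow> pol C \<bullet> x = 1"
  using pol(1) by blast

lemma triple_nonzero:
  assumes C: "C \<in> two_faces P" and x: "x \<in> C" "y \<in> C" "z \<in> C" and nc: "\<not> collinear {x, y, z}"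
  shows "x \<bullet> (y \<times> z) \<noteq> 0" "(y - x) \<times> (z - x) \<noteq> 0"
proof -
  let ?n = "pol C" and ?N = "(y - x) \<times> (z - x)"
  have n: "?n \<bullet> x = 1" "?n \<bullet> y = 1" "?n \<bullet> z = 1" using pol_eq1[OF C] x by auto
  have n0: "?n \<noteq> 0" using n by auto
  show N: "?N \<noteq> 0"
  proof
    assume "?N = 0"
    then have "collinear {0, y - x, z - x}" by (simp add: cross_eq_0)
    then have "collinear {y, x, z}" using collinear_3[of y x z] by (simp add: insert_commute)
    then show False using nc by (simp add: insert_commute)
  qed
  have "?n \<times> ?N = 0" unfolding Lagrange using n by (simp add: inner_diff_right)
  then have "?N \<times> ?n = 0" using cross_skew[of ?N ?n] by simp
  then have "?N = ((?N \<bullet> ?n) / (?n \<bullet> ?n)) *\<^sub>R ?n" by (rule cross_parallel[OF _ n0])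
  then have "?N \<bullet> ?n \<noteq> 0" using N by auto
  then show "x \<bullet> (y \<times> z) \<noteq> 0" using polar_area[OF n] by (auto simp: inner_commute)
qed

lemma nbrs_in_face:
  assumes C: "C \<in> two_faces P" and p: "p \<in> C" "adj P p q" "q \<in> C"
  obtains r where "r \<noteq> q" "{x. adj C p x} = {q, r}" "\<not> collinear {p, q, r}" "r \<in> C" "adj P p r"
    "\<And>x. x \<in> C \<Longrightarrow> \<exists>a\<ge>0. \<exists>b\<ge>0. x = p + a *\<^sub>R (q - p) + b *\<^sub>R (r - p)"
proof -
  have f: "C face_of P" "aff_dim C = 2" using C by (auto simp: two_faces_def)
  have pC: "polytope C" using face_of_polytope_polytope[OF poly f(1)] .
  have pv: "p \<in> verts C" using verts_face[OF f(1)] adj_verts[OF p(2)] p by auto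
  obtain h \<gamma> where "vertex_figure C p h \<gamma>" using vertex_figure_exists[OF pC pv] by blast
  then interpret vertex_figure C p h \<gamma> .
  obtain q1 q2 where q12: "q1 \<noteq> q2" "{x. adj C p x} = {q1, q2}" "\<not> collinear {p, q1, q2}"
    and cone: "\<And>x. x \<in> C \<Longrightarrow> \<exists>a\<ge>0. \<exists>b\<ge>0. x = p + a *\<^sub>R (q1 - p) + b *\<^sub>R (q2 - p)"
    by (rule polygon_nbrs[OF f(2)]) (rule that)
  have "adj C p q" using adj_face[OF f(1)] p by simp
  then consider "q = q1" | "q = q2" using q12(2) by blast
  then show ?thesis
  proof cases
    case 1
    have "adj C p q2" using q12(2) by blast
    then have "q2 \<in> C" "adj P p q2" using adj_face[OF f(1)] by auto
    then show ?thesis using that[of q2] 1 q12 cone by simp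
  next
    case 2
    have "adj C p q1" using q12(2) by blast
    then have "q1 \<in> C" "adj P p q1" using adj_face[OF f(1)] by auto
    moreover have "\<exists>a\<ge>0. \<exists>b\<ge>0. x = p + a *\<^sub>R (q2 - p) + b *\<^sub>R (q1 - p)" if x: "x \<in> C" for x
    proof -
      obtain a b where ab: "a \<ge> 0" "b \<ge> 0" "x = p + a *\<^sub>R (q1 - p) + b *\<^sub>R (q2 - p)" using cone[OF x] by blast
      then have "x = p + b *\<^sub>R (q2 - p) + a *\<^sub>R (q1 - p)" by simp
      then show ?thesis using ab by blast
    qed
    moreover have "{x. adj C p x} = {q, q1}" "\<not> collinear {p, q, q1}" using 2 q12 by (simp_all add: insert_commute)
    ultimately show ?thesis using that[of q1] 2 q12(1) by blast
  qed
qed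

text \<open>With \<open>0\<close> inside \<open>P\<close>, the plane through \<open>0\<close>,
  \<open>p\<close> and \<open>q\<close> separates the two faces at the edge, so the sign of a triple
  product on the face tells the sides apart.\<close>

definition is_left :: "real^3 \<Rightarrow> real^3 \<Rightarrow> (real^3) set \<Rightarrow> bool" where
  "is_left p q C \<longleftrightarrow> C \<in> two_faces P \<and> p \<in> C \<and> q \<in> C \<and> (\<forall>x\<in>C. p \<bullet> (q \<times> x) \<ge> 0)"

lemma left_or_right:
  assumes C: "C \<in> two_faces P" "p \<in> C" "q \<in> C" and pq: "adj P p q"
  shows "is_left p q C \<noteq> is_left q p C"
proof -
  obtain r where r: "r \<noteq> q" "{x. adj C p x} = {q, r}" "\<not> collinear {p, q, r}" "r \<in> C" "adj P p r"
    and cone: "\<And>x. x \<in> C \<Longrightarrow> \<exists>a\<ge>0. \<exists>b\<ge>0. x = p + a *\<^sub>R (q - p) + b *\<^sub>R (r - p)"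
    using nbrs_in_face[OF C(1,2) pq C(3)] by blast
  have nz: "p \<bullet> (q \<times> r) \<noteq> 0" by (rule triple_nonzero(1)[OF C r(4,3)])
  have sw: "q \<bullet> (p \<times> x) = - (p \<bullet> (q \<times> x))" for x by (simp add: cross3_simps)
  have val: "\<exists>b\<ge>0. p \<bullet> (q \<times> x) = b * (p \<bullet> (q \<times> r))" if x: "x \<in> C" for x
  proof -
    obtain a b where ab: "a \<ge> 0" "b \<ge> 0" "x = p + a *\<^sub>R (q - p) + b *\<^sub>R (r - p)" using cone[OF x] by blast
    have "p \<bullet> (q \<times> x) = b * (p \<bullet> (q \<times> r))" unfolding ab(3) by (simp add: cross3_simps)
    then show ?thesis using ab by blast
  qed
  show ?thesis
  proof (cases "p \<bullet> (q \<times> r) > 0")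
    case True
    have "is_left p q C" unfolding is_left_def using C val True by fastforce
    moreover have "\<not> is_left q p C" unfolding is_left_def sw using r(4) True by force
    ultimately show ?thesis by simp
  next
    case False
    then have "p \<bullet> (q \<times> r) < 0" using nz by simp
    then have "is_left q p C" "\<not> is_left p q C" unfolding is_left_def sw using C val r(4)
      by (fastforce simp: mult_nonneg_nonpos, force)
    then show ?thesis by simp
  qed
qed

text \<open>If both faces at the edge were on the same side, the last clause of
  \<open>edge_two_faces\<close> would put all of \<open>P\<close> on one side of a plane through
  \<open>0\<close>, although \<open>0\<close> is interior.\<close>

lemma left_faces:
  assumes pq: "adj P p q"
  shows "\<exists>!C. is_left p q C"
    and "\<lbrakk>C \<in> two_faces P; p \<in> C; q \<in> C\<rbrakk> \<Longrightarrow> is_left p q C \<or> is_left q p C"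
proof -
  have pv: "p \<in> verts P" using adj_verts[OF pq] by simp
  obtain h \<gamma> where "vertex_figure P p h \<gamma>" using vertex_figure_exists[OF poly pv] by blast
  then interpret vertex_figure P p h \<gamma> .
  obtain C1 C2 where C12: "C1 \<noteq> C2" "{C \<in> two_faces P. p \<in> C \<and> q \<in> C} = {C1, C2}"
    and half: "\<And>f x. \<lbrakk>linear f; f p = (f q :: real); \<And>x. x \<in> C1 \<union> C2 \<Longrightarrow> f p \<le> f x; x \<in> P\<rbrakk> \<Longrightarrow> f p \<le> f x"
    using edge_two_faces[OF dim3 pq] by blast
  have m: "C1 \<in> two_faces P" "p \<in> C1" "q \<in> C1" "C2 \<in> two_faces P" "p \<in> C2" "q \<in> C2"
    using C12(2) by blast+
  have n: "pol C1 \<bullet> p = 1" "pol C1 \<bullet> q = 1" using pol_eq1 m by auto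
  have N: "p \<times> q \<noteq> 0"
  proof
    assume "p \<times> q = 0"
    then have "pol C1 \<times> (p \<times> q) = 0" by simp
    then have "p - q = 0" unfolding Lagrange using n by simp
    then show False using adj_neq[OF pq] by simp
  qed
  have lin: "linear (\<lambda>x. n \<bullet> x)" for n :: "real^3" by (simp add: bounded_linear.linear bounded_linear_inner_right)
  have tr: "p \<bullet> (q \<times> x) = (p \<times> q) \<bullet> x" for x by (simp add: cross3_simps)
  have tr': "q \<bullet> (p \<times> x) = - ((p \<times> q) \<bullet> x)" for x by (simp add: cross3_simps)
  have z: "(p \<times> q) \<bullet> p = 0" "(p \<times> q) \<bullet> q = 0" by (simp_all add: cross3_simps)
  have notboth: "\<not> (is_left p q C1 \<and> is_left p q C2)"
  proof
    assume "is_left p q C1 \<and> is_left p q C2"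
    then have "0 \<le> (p \<times> q) \<bullet> x" if "x \<in> C1 \<union> C2" for x using that unfolding is_left_def tr by blast
    then have "0 \<le> (p \<times> q) \<bullet> x" if "x \<in> P" for x using half[OF lin, of "p \<times> q" x] z that by simp
    moreover obtain x where "x \<in> P" "- (p \<times> q) \<bullet> x > 0" using positive_somewhere[of "- (p \<times> q)"] N by auto
    ultimately show False by force
  qed
  have notneither: "\<not> (is_left q p C1 \<and> is_left q p C2)"
  proof
    assume "is_left q p C1 \<and> is_left q p C2"
    then have "0 \<le> - (p \<times> q) \<bullet> x" if "x \<in> C1 \<union> C2" for x using that unfolding is_left_def tr' by force
    then have "0 \<le> - (p \<times> q) \<bullet> x" if "x \<in> P" for x using half[OF lin, of "- (p \<times> q)" x] z that by simp
    moreover obtain x where "x \<in> P" "(p \<times> q) \<bullet> x > 0" using positive_somewhere[OF N] by auto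
    ultimately show False by force
  qed
  have in12: "C = C1 \<or> C = C2" if "is_left p q C" for C
    using that C12(2) unfolding is_left_def by blast
  have lr: "is_left p q C1 \<noteq> is_left q p C1" "is_left p q C2 \<noteq> is_left q p C2"
    using left_or_right[OF m(1-3) pq] left_or_right[OF m(4-6) pq] by auto
  show "\<exists>!C. is_left p q C" using notboth notneither in12 lr by metis
  show "\<lbrakk>C \<in> two_faces P; p \<in> C; q \<in> C\<rbrakk> \<Longrightarrow> is_left p q C \<or> is_left q p C"
    using left_or_right[OF _ _ _ pq] by blast
qed

definition left :: "real^3 \<Rightarrow> real^3 \<Rightarrow> (real^3) set" where "left p q = (THE C. is_left p q C)"

lemma left: "adj P p q \<Longrightarrow> is_left p q (left p q)"
  unfolding left_def by (rule theI') (rule left_faces(1))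

lemma left_eqI: "adj P p q \<Longrightarrow> is_left p q C \<Longrightarrow> left p q = C"
  using left left_faces(1) by blast

lemma left_face: "adj P p q \<Longrightarrow> left p q \<in> two_faces P" "adj P p q \<Longrightarrow> p \<in> left p q" "adj P p q \<Longrightarrow> q \<in> left p q"
  using left unfolding is_left_def by blast+

lemma left_antisym:
  assumes "adj P p q" shows "left p q \<noteq> left q p"
  using left_or_right[OF left_face[OF assms] assms] left[OF assms] left[of q p] assms adj_commute by metis

lemma face_cases:
  assumes "adj P p q" "C \<in> two_faces P" "p \<in> C" "q \<in> C"
  shows "C = left p q \<or> C = left q p"
  using left_faces(2)[OF assms] left_eqI[OF assms(1)] left_eqI[of q p C] assms(1) adj_commute by metis

definition succ :: "real^3 \<Rightarrow> real^3 \<Rightarrow> real^3" where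
  "succ p q = (THE r. r \<noteq> p \<and> adj (left p q) q r)"

lemma succ:
  assumes pq: "adj P p q"
  shows "{x. adj (left p q) q x} = {p, succ p q}" "succ p q \<noteq> p" "\<not> collinear {q, p, succ p q}"
    "adj P q (succ p q)" "left q (succ p q) = left p q" "p \<bullet> (q \<times> succ p q) > 0"
    "x \<in> left p q \<Longrightarrow> \<exists>a\<ge>0. \<exists>b\<ge>0. x = q + a *\<^sub>R (p - q) + b *\<^sub>R (succ p q - q)"
proof -
  let ?C = "left p q"
  have qp: "adj P q p" using pq adj_commute by blast
  obtain r where r: "r \<noteq> p" "{x. adj ?C q x} = {p, r}" "\<not> collinear {q, p, r}" "r \<in> ?C" "adj P q r"
    and cone: "\<And>x. x \<in> ?C \<Longrightarrow> \<exists>a\<ge>0. \<exists>b\<ge>0. x = q + a *\<^sub>R (p - q) + b *\<^sub>R (r - q)"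
    using nbrs_in_face[OF left_face(1)[OF pq] left_face(3)[OF pq] qp left_face(2)[OF pq]] by blast
  have s: "succ p q = r" unfolding succ_def using r(1,2) by (intro the_equality) auto
  show "{x. adj (left p q) q x} = {p, succ p q}" "succ p q \<noteq> p" "\<not> collinear {q, p, succ p q}"
    "adj P q (succ p q)" using r s by auto
  show "x \<in> left p q \<Longrightarrow> \<exists>a\<ge>0. \<exists>b\<ge>0. x = q + a *\<^sub>R (p - q) + b *\<^sub>R (succ p q - q)"
    unfolding s by (rule cone)
  have "p \<bullet> (q \<times> r) \<ge> 0" using left[OF pq] r(4) by (simp add: is_left_def)
  moreover have "p \<bullet> (q \<times> r) \<noteq> 0"
    using triple_nonzero(1)[OF left_face[OF pq] r(4)] r(3) by (simp add: insert_commute)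
  ultimately have pos: "p \<bullet> (q \<times> r) > 0" by simp
  then show "p \<bullet> (q \<times> succ p q) > 0" using s by simp
  have "q \<bullet> (r \<times> x) \<ge> 0" if "x \<in> ?C" for x
  proof -
    obtain a b where ab: "a \<ge> 0" "b \<ge> 0" "x = q + a *\<^sub>R (p - q) + b *\<^sub>R (r - q)" using cone[OF \<open>x \<in> ?C\<close>] by blast
    have "q \<bullet> (r \<times> x) = a * (p \<bullet> (q \<times> r))" unfolding ab(3) by (simp add: cross3_simps)
    then show ?thesis using ab pos by simp
  qed
  then have "is_left q r ?C" using left_face[OF pq] r(4) by (simp add: is_left_def)
  then show "left q (succ p q) = left p q" unfolding s by (rule left_eqI[OF r(5)])
qed

text \<open>A second dart of the face into \<open>q\<close> would come from \<open>succ p q\<close>,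
  and then the face would lie on both sides of that edge.\<close>

lemma same_end:
  assumes "adj P p q" "adj P p' q" "left p q = left p' q" shows "p = p'"
proof (rule ccontr)
  assume "p \<noteq> p'"
  have "adj (left p q) q p'"
    using assms left_face[of p' q] adj_face[of "left p q" P q p'] adj_commute left_face(1)[OF assms(1)]
      left_face(3)[OF assms(1)] by (auto simp: two_faces_def)
  then have "p' \<in> {p, succ p q}" unfolding succ(1)[OF assms(1), symmetric] by simp
  then have "p' = succ p q" using \<open>p \<noteq> p'\<close> by simp
  then have "left q p' = left p' q" using succ(5)[OF assms(1)] assms(3) by simp
  then show False using left_antisym[OF assms(2)] by simp
qed

section \<open>A 3-polytope as a polyhedral map\<close>

definition darts :: "dart set" where "darts = {(p, q). adj P p q}"
definition nxt :: "dart \<Rightarrow> dart" where "nxt d = (snd d, succ (fst d) (snd d))"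
definition lface :: "dart \<Rightarrow> (real^3) set" where "lface d = left (fst d) (snd d)"

lemma finite_darts: "finite darts"
proof (rule finite_subset)
  show "darts \<subseteq> Sigma (verts P) (\<lambda>_. verts P)" using adj_verts by (auto simp: darts_def)
qed (simp add: finite_verts[OF poly])

lemma nxt_bij: "bij_betw nxt darts darts"
proof -
  have "inj_on nxt darts"
  proof (rule inj_onI)
    fix d d' assume d: "d \<in> darts" "d' \<in> darts" "nxt d = nxt d'"
    obtain p q where pq: "d = (p, q)" by force
    obtain p' q' where pq': "d' = (p', q')" by force
    have a: "adj P p q" "adj P p' q" "q' = q" "succ p q = succ p' q"
      using d pq pq' by (auto simp: darts_def nxt_def)
    have "left p q = left p' q" using succ(5)[OF a(1)] succ(5)[OF a(2)] a(4) by simp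
    then show "d = d'" using same_end[OF a(1,2)] pq pq' a(3) by simp
  qed
  moreover have "nxt ` darts \<subseteq> darts" using succ(4) by (auto simp: darts_def nxt_def)
  ultimately show ?thesis using finite_darts by (simp add: bij_betw_def endo_inj_surj)
qed

lemma pred_exists:
  assumes "adj P p q"
  obtains s where "adj P s p" "succ s p = q" "left s p = left p q"
proof -
  have "(p, q) \<in> nxt ` darts" using nxt_bij assms by (simp add: bij_betw_def darts_def)
  then obtain d where d: "d \<in> darts" "nxt d = (p, q)" by force
  then have a: "adj P (fst d) p" "succ (fst d) p = q" by (auto simp: darts_def nxt_def)
  show ?thesis using that[OF a] succ(5)[OF a(1)] a(2) by simp
qed

lemma same_start:
  assumes "adj P p q" "adj P p q'" "left p q = left p q'" shows "q = q'"
proof -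
  obtain s where s: "adj P s p" "succ s p = q" "left s p = left p q" using pred_exists[OF assms(1)] .
  obtain s' where s': "adj P s' p" "succ s' p = q'" "left s' p = left p q'" using pred_exists[OF assms(2)] .
  have "left s p = left s' p" by (simp only: s(3) s'(3) assms(3))
  then have "s = s'" by (rule same_end[OF s(1) s'(1)])
  then show ?thesis using s(2) s'(2) by blast
qed

lemma vertex_on_edge_line:
  assumes "adj P q r" "v \<in> verts P" "b \<ge> 0" "v = q + b *\<^sub>R (r - q)"
  shows "v = q \<or> v = r"
proof (cases "b \<le> 1")
  case True
  let ?E = "closed_segment q r"
  have E: "?E face_of P" using assms(1) by (simp add: adj_def edge_of_def)
  have "v = (1 - b) *\<^sub>R q + b *\<^sub>R r" using assms(4) by (simp add: algebra_simps)
  then have "v \<in> ?E" using assms(3) True by (auto simp: in_segment)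
  then have "v \<in> verts ?E" using verts_face[OF E] assms(2) by simp
  then show ?thesis by (simp add: verts_def extreme_point_of_segment)
next
  case False
  have r: "r extreme_point_of P" using adj_verts(2)[OF assms(1)] by (simp add: verts_def)
  have c: "(1 / b) * b = 1" using False by simp
  have "v - q = b *\<^sub>R (r - q)" using assms(4) by simp
  then have "(1 / b) *\<^sub>R (v - q) = r - q" using c by simp
  then have "r = (1 - 1 / b) *\<^sub>R q + (1 / b) *\<^sub>R v" by (simp add: algebra_simps)
  moreover have "q \<noteq> v" using assms(4) False adj_neq[OF assms(1)] by auto
  ultimately have "r \<in> open_segment q v" using False by (auto simp: in_segment intro!: exI[of _ "1 / b"])
  then show ?thesis using r adj_verts(1)[OF assms(1)] assms(2) verts_subset unfolding extreme_point_of_def by blast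
qed

sublocale polyhedral_map darts nxt "\<lambda>d. pol (lface d)"
proof
  show "finite darts" by (rule finite_darts)
  show "bij_betw nxt darts darts" by (rule nxt_bij)
  fix d assume d: "d \<in> darts"
  obtain p q where pq: "d = (p, q)" by force
  have a: "adj P p q" using d pq by (simp add: darts_def)
  define r where "r = succ p q"
  note S = succ[OF a, folded r_def]
  show "prod.swap d \<in> darts" using a adj_commute pq by (auto simp: darts_def)
  show "fst (nxt d) = snd d" by (simp add: nxt_def)
  show "pol (lface (nxt d)) = pol (lface d)" using S(5) pq r_def by (simp add: lface_def nxt_def)
  show "pol (lface d) \<bullet> fst d = 1" using pol_eq1[OF left_face(1)[OF a] left_face(2)[OF a]] pq by (simp add: lface_def)
  show "fst d \<bullet> (snd d \<times> snd (nxt d)) > 0" using S(6) pq r_def by (simp add: nxt_def)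
  fix d' assume d': "d' \<in> darts"
  obtain p' q' where pq': "d' = (p', q')" by force
  have a': "adj P p' q'" using d' pq' by (simp add: darts_def)
  have lf: "left p q \<in> two_faces P" "left p' q' \<in> two_faces P" using left_face(1) a a' by auto
  {
    assume eq: "pol (lface d') = pol (lface d)" and ne: "d' \<noteq> d" "d' \<noteq> nxt d"
    then have C: "left p' q' = left p q"
      using pol(1)[OF lf(1)] pol(1)[OF lf(2)] pq pq' by (simp add: lface_def)
    then have qC: "q' \<in> left p q" using left_face(3)[OF a'] by simp
    \<comment> \<open>In cone coordinates at \<open>q\<close> the triple product is \<open>x\<close>
      times a positive number. If \<open>x = 0\<close>, then \<open>q'\<close> is on the line of the
      edge from \<open>q\<close> to \<open>r\<close>, which leaves only the darts \<open>d\<close>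
      and \<open>nxt d\<close>.\<close>
    obtain x y where xy: "x \<ge> 0" "y \<ge> 0" "q' = q + x *\<^sub>R (p - q) + y *\<^sub>R (r - q)" using S(7)[OF qC] by blast
    have val: "q \<bullet> (r \<times> q') = x * (p \<bullet> (q \<times> r))" unfolding xy(3) by (simp add: cross3_simps)
    have "x \<noteq> 0"
    proof
      assume "x = 0"
      then have "q' = q \<or> q' = r"
        using vertex_on_edge_line[OF S(4) adj_verts(2)[OF a'] xy(2)] xy(3) by simp
      then show False
      proof
        assume "q' = q"
        then show False using same_end[of p' q p] a a' C ne pq pq' by simp
      next
        assume "q' = r"
        then show False using same_end[of p' r q] S(4,5) a' C ne pq pq' by (simp add: nxt_def r_def)
      qed
    qed
    then show "snd d \<bullet> (snd (nxt d) \<times> snd d') > 0"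
      using val xy(1) S(6) pq pq' by (simp add: nxt_def r_def)
  }
  {
    assume st: "fst d' = snd d" and ne: "d' \<noteq> nxt d" "d' \<noteq> prod.swap d"
    then have p': "p' = q" using pq pq' by simp
    \<comment> \<open>The only faces containing the edge are \<open>left p q\<close> and
      \<open>left q p\<close>, and each has a single dart starting at \<open>q\<close>, namely
      \<open>nxt d\<close> and the reverse of \<open>d\<close>.\<close>
    have "p \<notin> left q q'"
    proof
      assume "p \<in> left q q'"
      then have "left q q' = left p q \<or> left q q' = left q p"
        using face_cases[OF a, of "left q q'"] lf(2) left_face(2)[OF a'] p' by simp
      then show False
      proof
        assume "left q q' = left p q"
        then have "q' = r" using same_start[of q q' r] a' p' S(4,5) by simp
        then show False using ne p' pq pq' by (simp add: nxt_def r_def)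
      next
        assume "left q q' = left q p"
        then have "q' = p" using same_start[of q q' p] a' p' a adj_commute by blast
        then show False using ne p' pq pq' by simp
      qed
    qed
    moreover have "p \<in> P" using adj_verts(1)[OF a] verts_subset by blast
    ultimately have "pol (left q q') \<bullet> p \<noteq> 1" "pol (left q q') \<bullet> p \<le> 1"
      using pol[OF lf(2)] p' by auto
    then show "pol (lface d') \<bullet> fst d < 1" using p' pq pq' by (simp add: lface_def)
  }
qed

end

text \<open>The plate condition leaves residual displacements normal to the face only. A tilt about
  axes in the face plane produces any prescribed differences of three such residuals and keeps the
  component along \<open>n\<close>; the coefficients in \<open>\<omega>\<close> solve for this
  tilt.\<close>

lemma corner_rotation_exists:
  fixes p q s n t w :: "real^3" and u :: "real^3 \<Rightarrow> real^3"
  assumes N: "(q - p) \<times> (s - p) \<noteq> 0" and n: "n \<bullet> p = n \<bullet> q" "n \<bullet> p = n \<bullet> s"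
    and plate: "\<And>i j. i \<in> {p, q, s} \<Longrightarrow> j \<in> {p, q, s} \<Longrightarrow> (u i - t - w \<times> i) \<bullet> (j - i) = 0"
  shows "\<exists>\<omega>. \<omega> \<times> (q - p) = u q - u p \<and> \<omega> \<times> (s - p) = u s - u p \<and> \<omega> \<bullet> n = w \<bullet> n"
proof -
  define e where "e = q - p"
  define f where "f = s - p"
  let ?N = "e \<times> f"
  have N: "?N \<noteq> 0" using assms(1) by (simp add: e_def f_def)
  define y where "y i = u i - t - w \<times> i" for i
  have perp: "y i \<bullet> e = 0 \<and> y i \<bullet> f = 0" if "i \<in> {p, q, s}" for i
    using plate[OF that, of p] plate[OF that, of q] plate[OF that, of s] by (simp add: y_def e_def f_def inner_diff_right)
  have "\<exists>a. \<forall>i\<in>{p, q, s}. y i = a i *\<^sub>R ?N"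
    using perp_parallel_cross[OF _ _ N] perp by (intro exI[of _ "\<lambda>i. (y i \<bullet> ?N) / (?N \<bullet> ?N)"]) blast
  then obtain a where a: "y p = a p *\<^sub>R ?N" "y q = a q *\<^sub>R ?N" "y s = a s *\<^sub>R ?N" by blast
  define \<omega> where "\<omega> = w + (a s - a p) *\<^sub>R e - (a q - a p) *\<^sub>R f"
  have "\<omega> \<times> e = w \<times> e + (a q - a p) *\<^sub>R ?N"
    unfolding \<omega>_def cross_add_left Cross3.left_diff_distrib cross_mult_left cross_refl
    using cross_skew[of f e] by (simp add: algebra_simps)
  also have "\<dots> = w \<times> e + (y q - y p)" using a by (simp add: scaleR_diff_left)
  also have "\<dots> = u q - u p" by (simp add: y_def e_def f_def Cross3.right_diff_distrib)
  finally have 1: "\<omega> \<times> e = u q - u p" .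
  have "\<omega> \<times> f = w \<times> f + (a s - a p) *\<^sub>R ?N"
    unfolding \<omega>_def cross_add_left Cross3.left_diff_distrib cross_mult_left cross_refl by simp
  also have "\<dots> = w \<times> f + (y s - y p)" using a by (simp add: scaleR_diff_left)
  also have "\<dots> = u s - u p" by (simp add: y_def e_def f_def Cross3.right_diff_distrib)
  finally have 2: "\<omega> \<times> f = u s - u p" .
  have "e \<bullet> n = 0" "f \<bullet> n = 0" unfolding inner_commute[of _ n] using n by (simp_all add: e_def f_def inner_diff_right)
  then have "\<omega> \<bullet> n = w \<bullet> n" by (simp add: \<omega>_def inner_add_left inner_diff_left)
  then show ?thesis using 1 2 unfolding e_def f_def by blast
qed

theorem (in polytope3) rigid_if_faces_rigid:
  fixes u :: "real^3 \<Rightarrow> real^3"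
  assumes plates: "\<And>C. C \<in> two_faces P \<Longrightarrow> \<exists>t w. \<forall>i\<in>verts C. \<forall>j\<in>verts C. (u i - t - w \<times> i) \<bullet> (j - i) = 0"
  shows "\<exists>t w. \<forall>i\<in>verts P. u i = t + w \<times> i"
proof -
  have "\<exists>T W. \<forall>C\<in>two_faces P. \<forall>i\<in>verts C. \<forall>j\<in>verts C. (u i - T C - W C \<times> i) \<bullet> (j - i) = 0"
    using plates by metis
  then obtain T W where TW: "\<And>C i j. \<lbrakk>C \<in> two_faces P; i \<in> verts C; j \<in> verts C\<rbrakk> \<Longrightarrow> (u i - T C - W C \<times> i) \<bullet> (j - i) = 0"
    by metis
  have ex: "\<exists>\<omega>. \<omega> \<times> dvec d = u (snd d) - u (fst d) \<and> \<omega> \<times> (fst (\<psi> d) - fst d) = u (fst (\<psi> d)) - u (fst d)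
      \<and> \<omega> \<bullet> pol (lface d) = W (lface d) \<bullet> pol (lface d)" if d: "d \<in> darts" for d
  proof -
    obtain s p where sp: "\<psi> d = (s, p)" by force
    then have a: "adj P s p" using psi_in[OF d] by (simp add: darts_def)
    define q where "q = succ s p"
    have dd: "d = (p, q)" using phi_psi[OF d] sp by (simp add: nxt_def q_def)
    have psi: "fst (\<psi> d) = s" using sp by simp
    note S = succ[OF a, folded q_def]
    let ?C = "left s p"
    have C: "lface d = ?C" using S(5) dd by (simp add: lface_def)
    have m: "?C \<in> two_faces P" "s \<in> ?C" "p \<in> ?C" "q \<in> ?C" using left_face[OF a] left_face(3)[OF S(4)] S(5) by auto
    have f: "?C face_of P" using m by (simp add: two_faces_def)
    have v: "p \<in> verts ?C" "q \<in> verts ?C" "s \<in> verts ?C"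
      using verts_face[OF f] adj_verts[OF a] adj_verts[OF S(4)] m by auto
    have N: "(q - p) \<times> (s - p) \<noteq> 0"
      using triple_nonzero(2)[OF m(1,3,4,2)] S(3) by (simp add: insert_commute)
    have "\<exists>\<omega>. \<omega> \<times> (q - p) = u q - u p \<and> \<omega> \<times> (s - p) = u s - u p \<and> \<omega> \<bullet> pol ?C = W ?C \<bullet> pol ?C"
    proof (rule corner_rotation_exists[OF N])
      show "pol ?C \<bullet> p = pol ?C \<bullet> q" "pol ?C \<bullet> p = pol ?C \<bullet> s" using pol_eq1[OF m(1)] m by simp_all
      show "(u i - T ?C - W ?C \<times> i) \<bullet> (j - i) = 0" if "i \<in> {p, q, s}" "j \<in> {p, q, s}" for i j
        using TW[OF m(1)] that v by blast
    qed
    then show ?thesis unfolding C psi dvec_def by (simp add: dd)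
  qed
  define \<omega> where "\<omega> d = (SOME \<omega>. \<omega> \<times> dvec d = u (snd d) - u (fst d) \<and> \<omega> \<times> (fst (\<psi> d) - fst d) = u (fst (\<psi> d)) - u (fst d)
      \<and> \<omega> \<bullet> pol (lface d) = W (lface d) \<bullet> pol (lface d))" for d
  have om: "\<omega> d \<times> dvec d = u (snd d) - u (fst d)" "\<omega> d \<times> (fst (\<psi> d) - fst d) = u (fst (\<psi> d)) - u (fst d)"
    "\<omega> d \<bullet> pol (lface d) = W (lface d) \<bullet> pol (lface d)" if "d \<in> darts" for d
    using someI_ex[OF ex[OF that]] unfolding \<omega>_def by blast+
  interpret corner_motion darts nxt "\<lambda>d. pol (lface d)" u \<omega>
  proof
    fix d assume d: "d \<in> darts"
    show "\<omega> d \<times> dvec d = u (snd d) - u (fst d)" using om[OF d] by simp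
    have "\<omega> (nxt d) \<times> (fst d - snd d) = u (fst d) - u (snd d)"
      using om(2)[OF phi_in[OF d]] psi_phi[OF d] fst_phi[OF d] by simp
    then show "\<omega> (nxt d) \<times> dvec d = u (snd d) - u (fst d)"
      unfolding dvec_def by (simp add: Cross3.right_diff_distrib algebra_simps)
    fix d' assume d': "d' \<in> darts" and eq: "pol (lface d') = pol (lface d)"
    have "lface d \<in> two_faces P" "lface d' \<in> two_faces P"
      using left_face(1) d d' by (auto simp: darts_def lface_def)
    then have "lface d' = lface d" using pol(1) eq by metis
    then show "\<omega> d' \<bullet> pol (lface d) = \<omega> d \<bullet> pol (lface d)" using om(3)[OF d] om(3)[OF d'] by simp
  qed
  have swapc: "\<omega> (q, p) = \<omega> (p, q)" if "adj P p q" for p q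
    using corner_rotations_agree(2)[of "(p, q)"] that by (simp add: darts_def)
  have succc: "\<omega> (q, succ p q) = \<omega> (p, q)" if "adj P p q" for p q
    using corner_rotations_agree(1)[of "(p, q)"] that by (simp add: darts_def nxt_def)
  \<comment> \<open>Distinct \<open>q\<close> and \<open>q'\<close> are the two neighbours of
    \<open>p\<close> on \<open>C\<close>, one before and one after \<open>p\<close> along the face,
    so a step along the face and a reversal connect the two corners.\<close>
  have share: "\<omega> (p, q) = \<omega> (p, q')"
    if a: "adj P p q" "adj P p q'" and C: "C \<in> two_faces P" "p \<in> C" "q \<in> C" "q' \<in> C" for p q q' C
  proof (cases "q = q'")
    case False
    have aC: "adj C p q'" using C a adj_face[of C P p q'] by (simp add: two_faces_def)
    from face_cases[OF a(1) C(1,2,3)] show ?thesis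
    proof
      assume 1: "C = left p q"
      obtain s where s: "adj P s p" "succ s p = q" "left s p = left p q" using pred_exists[OF a(1)] .
      have "q' = s" using succ(1)[OF s(1)] s aC False 1 by auto
      then show ?thesis using succc[OF s(1)] swapc[OF s(1)] s(2) by simp
    next
      assume 2: "C = left q p"
      have qp: "adj P q p" using a(1) adj_commute by blast
      have "q' = succ q p" using succ(1)[OF qp] aC False 2 by auto
      then show ?thesis using succc[OF qp] swapc[OF a(1)] by simp
    qed
  qed simp
  have around: "\<omega> (p, q) = \<omega> (p, q')" if a: "adj P p q" "adj P p q'" for p q q'
  proof -
    have pv: "p \<in> verts P" using adj_verts[OF a(1)] by simp
    obtain h \<gamma> where "vertex_figure P p h \<gamma>" using vertex_figure_exists[OF poly pv] by blast
    then interpret V: vertex_figure P p h \<gamma> .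
    from V.nbrs_connected[OF a] show ?thesis
    proof (induction rule: rtrancl_induct)
      case (step y z)
      then show ?case using share[of p y z] by auto
    qed simp
  qed
  have "P \<noteq> {}" using int0 interior_subset by blast
  then obtain p0 where p0: "p0 \<in> verts P" using polytope_eq_hull_verts[OF poly] by fastforce
  obtain h \<gamma> where "vertex_figure P p0 h \<gamma>" using vertex_figure_exists[OF poly p0] by blast
  then obtain q0 where q0: "adj P p0 q0" using vertex_figure.has_nbr dim3 by fastforce
  define w where "w = \<omega> (p0, q0)"
  have all: "\<forall>q. adj P p q \<longrightarrow> \<omega> (p, q) = w" if p: "p \<in> verts P" for p
    using graph_connected[OF poly p0 p]
  proof (induction rule: rtrancl_induct)
    case base
    then show ?case using around[OF _ q0] w_def by blast
  next
    case (step y z)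
    then have yz: "adj P y z" by simp
    then have zy: "adj P z y" using adj_commute by blast
    have "\<omega> (z, y) = w" using swapc[OF yz] step.IH yz by simp
    then show ?case using around[OF _ zy] by simp
  qed
  have diff: "u q - w \<times> q = u p - w \<times> p" if a: "adj P p q" for p q
  proof -
    have "\<omega> (p, q) = w" using all adj_verts(1)[OF a] a by blast
    then have "w \<times> (q - p) = u q - u p" using om(1)[of "(p, q)"] a by (simp add: darts_def dvec_def)
    then show ?thesis by (simp add: Cross3.right_diff_distrib algebra_simps)
  qed
  have "u p - w \<times> p = u p0 - w \<times> p0" if p: "p \<in> verts P" for p
    using graph_connected[OF poly p0 p]
  proof (induction rule: rtrancl_induct)
    case (step y z)
    then show ?case using diff[of y z] by simp
  qed simp
  then have "\<forall>i\<in>verts P. u i = (u p0 - w \<times> p0) + w \<times> i" by (metis diff_add_cancel)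
  then show ?thesis by blast
qed

section \<open>Frameworks and alternating forms\<close>

definition alternating :: "('a::real_vector \<Rightarrow> 'a \<Rightarrow> real) \<Rightarrow> bool" where
  "alternating B \<longleftrightarrow> bilinear B \<and> (\<forall>x. B x x = 0)"

text \<open>The part of the motion visible on \<open>S\<close> is trivial. Only values with both
  arguments in \<open>S\<close> enter, so displacements transverse to the span of \<open>S\<close>
  stay free.\<close>

definition plate :: "('a::real_vector \<Rightarrow> 'a \<Rightarrow> real) \<Rightarrow> 'a set \<Rightarrow> bool" where
  "plate g S \<longleftrightarrow> (\<exists>B. alternating B \<and> (\<forall>x\<in>S. \<forall>y\<in>S. g x y = B x y))"

lemma alternatingD:
  assumes "alternating B"
  shows "B x x = 0" "linear (B x)" "linear (\<lambda>x. B x y)"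
    "B (x + y) z = B x z + B y z" "B z (x + y) = B z x + B z y"
    "B (x - y) z = B x z - B y z" "B z (x - y) = B z x - B z y"
    "B (c *\<^sub>R x) z = c * B x z" "B z (c *\<^sub>R x) = c * B z x" "B x y = - B y x"
    "B 0 x = 0" "B x 0 = 0"
proof -
  have b: "bilinear B" and a: "\<And>x. B x x = 0" using assms by (auto simp: alternating_def)
  show "B x x = 0" by (rule a)
  show "linear (B x)" "linear (\<lambda>x. B x y)" using b by (auto simp: bilinear_def)
  show l: "B (x + y) z = B x z + B y z" "B z (x + y) = B z x + B z y"
    "B (x - y) z = B x z - B y z" "B z (x - y) = B z x - B z y"
    "B (c *\<^sub>R x) z = c * B x z" "B z (c *\<^sub>R x) = c * B z x" for x y z c
    using bilinear_ladd[OF b] bilinear_radd[OF b] bilinear_lsub[OF b] bilinear_rsub[OF b]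
      bilinear_lmul[OF b] bilinear_rmul[OF b] by simp_all
  have "B (x + y) (x + y) = 0" by (rule a)
  then have "B x x + B y x + (B x y + B y y) = 0" unfolding l .
  then show "B x y = - B y x" using a[of x] a[of y] by linarith
  show "B 0 x = 0" "B x 0 = 0" using bilinear_lzero[OF b] bilinear_rzero[OF b] by simp_all
qed

lemma alternatingI:
  assumes "\<And>x y z. B (x + y) z = B x z + B y z" "\<And>x y z. B z (x + y) = B z x + B z y"
    "\<And>c x z. B (c *\<^sub>R x) z = c * B x z" "\<And>c x z. B z (c *\<^sub>R x) = c * B z x" "\<And>x. B x x = 0"
  shows "alternating B"
  unfolding alternating_def bilinear_def using assms by (auto intro!: linearI)

lemma alternating_add: "alternating A \<Longrightarrow> alternating B \<Longrightarrow> alternating (\<lambda>x y. A x y + B x y)"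
  by (rule alternatingI) (simp_all add: alternatingD(1,4-9) algebra_simps)

lemma alternating_diff: "alternating A \<Longrightarrow> alternating B \<Longrightarrow> alternating (\<lambda>x y. A x y - B x y)"
  by (rule alternatingI) (simp_all add: alternatingD(1,4-9) algebra_simps)

lemma alternating_compose:
  assumes "alternating B" "linear f" shows "alternating (\<lambda>x y. B (f x) (f y))"
  by (rule alternatingI)
    (simp_all add: alternatingD(1,4-9)[OF assms(1)] linear_add[OF assms(2)] linear_scale[OF assms(2)])

lemma alternating_wedge:
  fixes f g :: "'a::real_vector \<Rightarrow> real"
  assumes "linear f" "linear g"
  shows "alternating (\<lambda>x y. f x * g y - f y * g x)"
  by (rule alternatingI)
    (simp_all add: linear_add[OF assms(1)] linear_add[OF assms(2)] linear_scale[OF assms(1)] linear_scale[OF assms(2)] algebra_simps)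

lemma linear_eq_on_affine_hull:
  assumes "linear f" "linear g" "\<And>x. x \<in> S \<Longrightarrow> f x = g x" "x \<in> affine hull S"
  shows "f x = g x"
  using assms linear_eq_on_span[of f g S x] affine_hull_subset_span by blast

lemma alternating_real3:
  fixes B :: "real^3 \<Rightarrow> real^3 \<Rightarrow> real"
  assumes B: "alternating B"
  shows "\<exists>w. \<forall>x y. B x y = w \<bullet> (x \<times> y)"
proof -
  let ?e = "\<lambda>i. axis i 1 :: real^3"
  define w :: "real^3" where "w = vector [B (?e 2) (?e 3), B (?e 3) (?e 1), B (?e 1) (?e 2)]"
  have rep: "x = x$1 *\<^sub>R ?e 1 + x$2 *\<^sub>R ?e 2 + x$3 *\<^sub>R ?e 3" for x :: "real^3"
    by (simp add: vec_eq_iff axis_def forall_3)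
  have sw: "B (?e 2) (?e 1) = - B (?e 1) (?e 2)" "B (?e 3) (?e 2) = - B (?e 2) (?e 3)" "B (?e 1) (?e 3) = - B (?e 3) (?e 1)"
    by (rule alternatingD(10)[OF B])+
  have "B x y = w \<bullet> (x \<times> y)" for x y
  proof -
    have "B x y = B (x$1 *\<^sub>R ?e 1 + x$2 *\<^sub>R ?e 2 + x$3 *\<^sub>R ?e 3) (y$1 *\<^sub>R ?e 1 + y$2 *\<^sub>R ?e 2 + y$3 *\<^sub>R ?e 3)"
      using rep[of x] rep[of y] by simp
    also have "\<dots> = w \<bullet> (x \<times> y)"
      by (simp add: alternatingD(1,4,5,8,9)[OF B] sw w_def cross3_simps)
    finally show ?thesis .
  qed
  then show ?thesis by blast
qed

lemma alternating_triple: "alternating (\<lambda>x y. w \<bullet> (x \<times> y))" for w :: "real^3"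
  by (simp add: alternating_def bilinear_triple)

lemma linear_functional_representation:
  fixes f :: "'a::euclidean_space \<Rightarrow> real"
  assumes "linear f" shows "\<exists>v. \<forall>x. f x = v \<bullet> x"
  using adjoint_works[OF assms, of _ 1] by (intro exI[of _ "adjoint f 1"]) (simp add: inner_commute)

lemma plates_alternate:
  assumes Q: "polytope Q" "aff_dim Q \<ge> 2" and pl: "\<And>C. C \<in> two_faces Q \<Longrightarrow> plate g (verts C)"
  shows "p \<in> verts Q \<Longrightarrow> g p p = 0" and "adj Q p q \<Longrightarrow> g p q = - g q p"
proof -
  assume p: "p \<in> verts Q"
  obtain C where C: "C \<in> two_faces Q" "p \<in> C" using vertex_in_two_face[OF Q p] by blast
  have "p \<in> verts C" using verts_face[of C Q] C p by (auto simp: two_faces_def)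
  then show "g p p = 0" using pl[OF C(1)] by (auto simp: plate_def alternatingD(1))
next
  assume a: "adj Q p q"
  obtain C where C: "C \<in> two_faces Q" "p \<in> C" "q \<in> C" using edge_in_two_face[OF Q a] by blast
  have v: "p \<in> verts C" "q \<in> verts C" using verts_face[of C Q] C adj_verts[OF a] by (auto simp: two_faces_def)
  obtain B where "alternating B" "\<And>x y. x \<in> verts C \<Longrightarrow> y \<in> verts C \<Longrightarrow> g x y = B x y"
    using pl[OF C(1)] by (auto simp: plate_def)
  then show "g p q = - g q p" using v alternatingD(10)[of B p q] by simp
qed

section \<open>Transport to three-dimensional coordinates\<close>

lemma face_of_affine_image:
  assumes "linear h" "inj h"
  shows "(\<lambda>x. z + h x) ` F face_of (\<lambda>x. z + h x) ` P \<longleftrightarrow> F face_of P"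
proof -
  have "(\<lambda>x. z + h x) ` S = (+) z ` h ` S" for S by (simp add: image_image)
  then show ?thesis using face_of_linear_image[OF assms] by simp
qed

lemma aff_dim_affine_image:
  fixes h :: "'b::euclidean_space \<Rightarrow> 'a::euclidean_space"
  assumes "linear h" "inj h"
  shows "aff_dim ((\<lambda>x. z + h x) ` F) = aff_dim F"
proof -
  have "(\<lambda>x. z + h x) ` F = (+) z ` h ` F" by (simp add: image_image)
  then show ?thesis using assms by (simp add: aff_dim_translation_eq)
qed

lemma verts_affine_image:
  fixes h :: "'b::euclidean_space \<Rightarrow> 'a::euclidean_space"
  assumes "linear h" "inj h"
  shows "verts ((\<lambda>x. z + h x) ` F) = (\<lambda>x. z + h x) ` verts F"
proof -
  have iff: "(z + h x) extreme_point_of (\<lambda>x. z + h x) ` F \<longleftrightarrow> x extreme_point_of F" for x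
    using face_of_affine_image[OF assms, of z "{x}" F] by (simp add: face_of_singleton)
  have "verts ((\<lambda>x. z + h x) ` F) \<subseteq> (\<lambda>x. z + h x) ` F" by (rule verts_subset)
  then show ?thesis using iff by (auto simp: verts_def)
qed

theorem dehn_alexandrov:
  fixes Q :: "'a::euclidean_space set" and \<xi> :: 'a
  assumes Q: "polytope Q" "Q \<subseteq> {x. \<xi> \<bullet> x = 1}" "aff_dim Q = 3"
    and lin: "\<And>x. x \<in> verts Q \<Longrightarrow> linear (g x)"
    and pl: "\<And>C. C \<in> two_faces Q \<Longrightarrow> plate g (verts C)"
  shows "plate g (verts Q)"
proof -
  have cQ: "convex Q" using Q polytope_imp_convex by blast
  have "Q \<noteq> {}" using Q(3) by auto
  then obtain z where z: "z \<in> rel_interior Q" using rel_interior_eq_empty[OF cQ] by blast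
  then have zQ: "z \<in> Q" using rel_interior_subset by blast
  define N where "N = span ((\<lambda>x. x - z) ` Q)"
  have "int (dim N) = 3"
    using aff_dim_eq_dim_subtract[of z Q] zQ Q(3) by (simp add: N_def hull_inc)
  then have "dim (UNIV :: (real^3) set) = dim N" by simp
  \<comment> \<open>An isometric frame for the directions of \<open>Q\<close>. The base point
    \<open>z\<close> is relatively interior, so \<open>0\<close> becomes an interior point of
    \<open>P\<close>.\<close>
  then obtain h h' where h: "linear h" "linear h'" "h ` (UNIV :: (real^3) set) = N" "\<And>x. norm (h x) = norm x"
    "\<And>x. h' (h x) = x"
    using isometries_subspaces[of "UNIV :: (real^3) set" N] by (metis N_def UNIV_I subspace_UNIV subspace_span)
  have inj: "inj h" using h(5) by (metis injI)
  define k where "k x = z + h x" for x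
  define P where "P = h' ` (\<lambda>x. x - z) ` Q"
  have QP: "Q = k ` P"
  proof -
    have "k (h' (x - z)) = x" if "x \<in> Q" for x
    proof -
      have "x - z \<in> N" using that by (auto simp: N_def intro: span_base)
      then obtain v where "x - z = h v" using h(3) by blast
      then show ?thesis using h(5) by (simp add: k_def algebra_simps)
    qed
    then show ?thesis by (force simp: P_def image_image)
  qed
  have "(\<lambda>x. x - z) ` Q = (+) (- z) ` Q" by simp
  then have polyP: "polytope P" unfolding P_def
    using Q(1) h(2) polytope_linear_image polytope_translation_eq by metis
  have "0 \<in> interior P"
  proof -
    obtain e where e: "e > 0" "ball z e \<inter> affine hull Q \<subseteq> Q" using z mem_rel_interior_ball by blast
    have "ball 0 e \<subseteq> P"
    proof
      fix x :: "real^3" assume x: "x \<in> ball 0 e"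
      have "h x \<in> N" using h(3) by blast
      then have "k x \<in> affine hull Q" 
        using affine_hull_span_gen[of z Q] zQ by (auto simp: k_def N_def hull_inc)
      moreover have "k x \<in> ball z e" using x h(4) by (simp add: k_def dist_norm)
      ultimately have "k x \<in> k ` P" using e QP by blast
      then show "x \<in> P" using inj by (auto simp: k_def inj_eq)
    qed
    then show ?thesis using e mem_interior by blast
  qed
  then interpret polytope3 P using polyP by unfold_locales
  have vk: "verts (k ` F) = k ` verts F" for F unfolding k_def by (rule verts_affine_image[OF h(1) inj])
  have tf: "k ` C \<in> two_faces Q" if "C \<in> two_faces P" for C
    using that face_of_affine_image[OF h(1) inj, of z C P] aff_dim_affine_image[OF h(1) inj, of z C] QP
    by (simp add: two_faces_def k_def)
  have kv: "k i \<in> verts Q" if "i \<in> verts P" for i using that vk[of P] QP by blast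
  have "\<exists>u. \<forall>i\<in>verts P. \<forall>x. g (k i) (h x) = u i \<bullet> x"
  proof -
    have "\<exists>v. \<forall>x. g (k i) (h x) = v \<bullet> x" if "i \<in> verts P" for i
      using linear_functional_representation[OF linear_compose[OF h(1) lin[OF kv[OF that]]]] by (simp add: o_def)
    then show ?thesis by metis
  qed
  then obtain u where u: "\<And>i x. i \<in> verts P \<Longrightarrow> g (k i) (h x) = u i \<bullet> x" by blast
  have g0: "g (k i) (k i) = 0" if "i \<in> verts P" for i
    using plates_alternate(1)[OF Q(1) _ pl kv[OF that]] Q(3) by simp
  have kd: "k j - k i = h (j - i)" for i j using linear_diff[OF h(1)] by (simp add: k_def)
  have gk: "g (k i) (k j) = u i \<bullet> (j - i)" if "i \<in> verts P" "j \<in> verts P" for i j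
    using u[OF that(1), of "j - i"] kd[of j i] g0[OF that(1)] linear_diff[OF lin[OF kv[OF that(1)]], of "k j" "k i"] by simp
  have "\<exists>t w. \<forall>i\<in>verts C. \<forall>j\<in>verts C. (u i - t - w \<times> i) \<bullet> (j - i) = 0" if C: "C \<in> two_faces P" for C
  proof -
    obtain B where B: "alternating B" "\<And>x y. x \<in> verts (k ` C) \<Longrightarrow> y \<in> verts (k ` C) \<Longrightarrow> g x y = B x y"
      using pl[OF tf[OF C]] by (auto simp: plate_def)
    \<comment> \<open>The form of the face splits into an angular velocity \<open>w\<close>, its
      restriction to directions, and a translation \<open>t\<close>, its pairing with the base
      point.\<close>
    obtain w where w: "\<And>x y. B (h x) (h y) = w \<bullet> (x \<times> y)"
      using alternating_real3[OF alternating_compose[OF B(1) h(1)]] by blast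
    obtain t where t: "\<And>x. B z (h x) = t \<bullet> x"
      using linear_functional_representation[OF linear_compose[OF h(1) alternatingD(2)[OF B(1), of z]]] by (auto simp: o_def)
    have CP: "verts C \<subseteq> verts P" using verts_face[of C P] C by (auto simp: two_faces_def)
    have "(u i - t - w \<times> i) \<bullet> (j - i) = 0" if ij: "i \<in> verts C" "j \<in> verts C" for i j
    proof -
      have "i \<in> verts P" "j \<in> verts P" using ij CP by blast+
      from gk[OF this] have "u i \<bullet> (j - i) = g (k i) (k j)" by simp
      also have "\<dots> = B (k i) (k j)" using ij by (intro B(2)) (auto simp: vk)
      also have "\<dots> = B (k i) (h (j - i))"
        unfolding kd[symmetric] alternatingD(7)[OF B(1)] alternatingD(1)[OF B(1)] by simp
      also have "\<dots> = t \<bullet> (j - i) + w \<bullet> (i \<times> (j - i))"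
        unfolding k_def alternatingD(4)[OF B(1)] t w ..
      also have "w \<bullet> (i \<times> (j - i)) = (w \<times> i) \<bullet> (j - i)" by (simp add: cross3_simps)
      finally show ?thesis by (simp add: inner_diff_left)
    qed
    then show ?thesis by blast
  qed
  then obtain t w where tw: "\<And>i. i \<in> verts P \<Longrightarrow> u i = t + w \<times> i" using rigid_if_faces_rigid by metis
  \<comment> \<open>\<open>\<pi>\<close> is linear on the whole space and sends \<open>k i\<close>
    back to \<open>i\<close>. The form is reassembled from \<open>t\<close>, wedged with
    \<open>\<xi>\<close>, and from \<open>w\<close>.\<close>
  define \<pi> where "\<pi> a = h' (a - (\<xi> \<bullet> a) *\<^sub>R z)" for a
  have lpi: "linear \<pi>"
    by (rule linearI) (simp_all add: \<pi>_def linear_add[OF h(2)] linear_scale[OF h(2)] linear_diff[OF h(2)]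
        inner_add_right algebra_simps)
  define B where "B a b = ((\<xi> \<bullet> a) * (t \<bullet> \<pi> b) - (\<xi> \<bullet> b) * (t \<bullet> \<pi> a)) + w \<bullet> (\<pi> a \<times> \<pi> b)" for a b
  have "linear (\<lambda>b. t \<bullet> \<pi> b)" using linear_compose[OF lpi] bounded_linear.linear[OF bounded_linear_inner_right[of t]] by (simp add: o_def)
  moreover have "linear (\<lambda>a. \<xi> \<bullet> a)" by (rule bounded_linear.linear[OF bounded_linear_inner_right])
  ultimately have "alternating B" unfolding B_def
    by (intro alternating_add alternating_wedge alternating_compose[OF alternating_triple lpi])
  moreover have "g x y = B x y" if xy: "x \<in> verts Q" "y \<in> verts Q" for x y
  proof -
    obtain i j where ij: "i \<in> verts P" "j \<in> verts P" "x = k i" "y = k j" using xy vk[of P] QP by blast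
    have "\<xi> \<bullet> x = 1" "\<xi> \<bullet> y = 1" using xy verts_subset Q(2) by blast+
    moreover from this have "\<pi> x = i" "\<pi> y = j" using ij h(5) by (simp_all add: \<pi>_def k_def)
    ultimately have "B x y = t \<bullet> (j - i) + w \<bullet> (i \<times> j)" by (simp add: B_def inner_diff_right)
    also have "w \<bullet> (i \<times> j) = (w \<times> i) \<bullet> (j - i)" by (simp add: cross3_simps)
    finally show ?thesis using gk[OF ij(1,2)] tw[OF ij(1)] ij(3,4) by (simp add: inner_add_left)
  qed
  ultimately show ?thesis unfolding plate_def by blast
qed

section \<open>Higher dimensions\<close>

lemma agree_on_polytope:
  assumes D: "polytope D" and B: "alternating B" and eq: "\<forall>x\<in>verts D. \<forall>y\<in>verts D. g x y = B x y"
    and i: "i \<in> verts D" "linear (g i)" and x: "x \<in> D"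
  shows "g i x = B i x"
proof -
  have "x \<in> affine hull (verts D)" using hull_inc[OF x, of affine] affine_hull_verts[OF D] by simp
  moreover have "g i z = B i z" if "z \<in> verts D" for z using bspec[OF bspec[OF eq i(1)] that] .
  ultimately show ?thesis by (rule linear_eq_on_affine_hull[OF i(2) alternatingD(2)[OF B], rotated])
qed

text \<open>Wedge \<open>f\<close> with a functional that is 1 at \<open>p\<close>; the correction
  term disappears because \<open>f p = 0\<close>.\<close>

lemma alternating_with_row:
  fixes f :: "'a::euclidean_space \<Rightarrow> real"
  assumes "linear f" "f p = 0" "p \<noteq> 0"
  obtains B where "alternating B" "\<And>x. B p x = f x"
proof
  define c where "c = 1 / (p \<bullet> p)"
  have l: "linear (\<lambda>x. (c *\<^sub>R p) \<bullet> x)" by (rule bounded_linear.linear[OF bounded_linear_inner_right])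
  show "alternating (\<lambda>x y. ((c *\<^sub>R p) \<bullet> x) * f y - ((c *\<^sub>R p) \<bullet> y) * f x)"
    by (rule alternating_wedge[OF l assms(1)])
  show "((c *\<^sub>R p) \<bullet> p) * f x - ((c *\<^sub>R p) \<bullet> x) * f p = f x" for x
    using assms by (simp add: c_def)
qed

text \<open>The framework seen from a vertex \<open>p\<close>, after subtracting the motion that agrees with
  \<open>g\<close> at \<open>p\<close>, is a framework on the vertex figure; its plates come from the 3-faces at \<open>p\<close>.\<close>

lemma star_rigid:
  fixes Q :: "'a::euclidean_space set" and \<xi> :: 'a
  assumes Q: "polytope Q" "Q \<subseteq> {x. \<xi> \<bullet> x = 1}" "aff_dim Q \<ge> 4"
    and lin: "\<And>x. x \<in> verts Q \<Longrightarrow> linear (g x)"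
    and pl: "\<And>C. C \<in> two_faces Q \<Longrightarrow> plate g (verts C)"
    and p: "p \<in> verts Q"
    and faces: "\<And>D. D face_of Q \<Longrightarrow> aff_dim D = 3 \<Longrightarrow> plate g (verts D)"
    and IH: "\<And>K f. polytope K \<Longrightarrow> K \<subseteq> {x. \<xi> \<bullet> x = 1} \<Longrightarrow> aff_dim K = aff_dim Q - 1 \<Longrightarrow>
      (\<And>x. x \<in> verts K \<Longrightarrow> linear (f x)) \<Longrightarrow> (\<And>C. C \<in> two_faces K \<Longrightarrow> plate f (verts C)) \<Longrightarrow> plate f (verts K)"
  shows "\<exists>B. alternating B \<and> (\<forall>q\<in>insert p {q. adj Q p q}. \<forall>x\<in>Q. g q x = B q x)"
proof -
  obtain h \<gamma> where "vertex_figure Q p h \<gamma>" using vertex_figure_exists[OF Q(1) p] by blast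
  then interpret vertex_figure Q p h \<gamma> .
  have d2: "aff_dim Q \<ge> 2" using Q(3) by simp
  have pQ: "p \<in> Q" using p verts_subset by blast
  then have xp: "\<xi> \<bullet> p = 1" using Q(2) by blast
  then have p0: "p \<noteq> 0" by auto
  have gp: "g p p = 0" using plates_alternate(1)[OF Q(1) d2 pl p] by blast
  obtain B0 where B0: "alternating B0" "\<And>x. B0 p x = g p x"
    using alternating_with_row[OF lin[OF p] gp p0] by blast
  define E where "E y q t \<longleftrightarrow> adj Q p q \<and> 0 < t \<and> t < 1 \<and> y = p + t *\<^sub>R (q - p) \<and>
    closed_segment p q \<inter> {x. h \<bullet> x = \<gamma>} = {y}" for y q t
  have "\<exists>q t. E y q t" if "y \<in> verts K" for y
    using vert_K[OF that] unfolding E_def by metis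
  then obtain qf tf where E: "\<And>y. y \<in> verts K \<Longrightarrow> E y (qf y) (tf y)" by metis
  have qt: "adj Q p (qf y)" "0 < tf y" "tf y < 1" "y = p + tf y *\<^sub>R (qf y - p)"
    "closed_segment p (qf y) \<inter> {x. h \<bullet> x = \<gamma>} = {y}" if "y \<in> verts K" for y
    using E[OF that] unfolding E_def by blast+
  \<comment> \<open>After subtraction of \<open>B0\<close> the row of \<open>p\<close> is zero. A
    bilinear extension therefore has, at the point \<open>y\<close> on the edge, \<open>tf y\<close>
    times the row of \<open>qf y\<close>.\<close>
  define G where "G y x = tf y * (g (qf y) x - B0 (qf y) x)" for y x
  have linG: "linear (G y)" if y: "y \<in> verts K" for y
  proof -
    have l: "linear (g (qf y))" using lin adj_verts(2)[OF qt(1)[OF y]] by blast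
    show ?thesis
      by (rule linearI) (simp_all add: G_def linear_add[OF l] linear_scale[OF l] alternatingD(5,9)[OF B0(1)] algebra_simps)
  qed
  have plG: "plate G (verts S)" if S: "S \<in> two_faces K" for S
  proof -
    have Sf: "S face_of K" "aff_dim S = 2" using S by (auto simp: two_faces_def)
    then have "S \<noteq> {}" by auto
    then obtain D where D: "D face_of Q" "p \<in> D" "S = D \<inter> {x. h \<bullet> x = \<gamma>}" using face_of_K_lift[OF Sf(1)] by blast
    have "aff_dim D = 3" using face_K(2)[OF D(1,2)] D(3) Sf(2) by simp
    then obtain B1 where B1: "alternating B1" "\<forall>x\<in>verts D. \<forall>y\<in>verts D. g x y = B1 x y"
      using faces[OF D(1)] by (auto simp: plate_def)
    have pD: "polytope D" using face_of_polytope_polytope[OF Q(1) D(1)] .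
    have vD: "verts D = verts Q \<inter> D" using verts_face[OF D(1)] .
    have ag: "g i x = B1 i x" if "i \<in> verts D" "x \<in> D" for i x
      using agree_on_polytope[OF pD B1(1,2) that(1) lin that(2)] that vD by blast
    define B2 where "B2 x y = B1 x y - B0 x y" for x y
    have B2: "alternating B2" unfolding B2_def by (rule alternating_diff[OF B1(1) B0(1)])
    have "G y x = B2 y x" if "y \<in> verts S" "x \<in> verts S" for y x
    proof -
      have y: "y \<in> verts K" using verts_face[OF Sf(1)] that by blast
      have yD: "y \<in> D" and xD: "x \<in> D" using that verts_subset D(3) by blast+
      have "y \<in> open_segment p (qf y)"
        using qt(2,3,4)[OF y] adj_neq[OF qt(1)[OF y]] by (auto simp: in_segment algebra_simps intro!: exI[of _ "tf y"])
      then have "qf y \<in> D" using face_ofD[OF D(1) _ pQ _ yD] adj_verts(2)[OF qt(1)[OF y]] verts_subset by blast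
      then have qD: "qf y \<in> verts D" using vD adj_verts(2)[OF qt(1)[OF y]] by blast
      have pD': "p \<in> verts D" using vD p D(2) by blast
      have Bp: "B2 p x = 0" using ag[OF pD' xD] B0(2) by (simp add: B2_def)
      have "B2 y x = B2 (p + tf y *\<^sub>R (qf y - p)) x" using qt(4)[OF y] by simp
      also have "\<dots> = tf y * B2 (qf y) x" using Bp by (simp add: alternatingD(4,6,8)[OF B2])
      also have "\<dots> = G y x" using ag[OF qD xD] by (simp add: G_def B2_def)
      finally show ?thesis by simp
    qed
    then show ?thesis unfolding plate_def using B2 by blast
  qed
  have "K \<subseteq> {x. \<xi> \<bullet> x = 1}" using Q(2) by blast
  then obtain B3 where B3: "alternating B3" "\<forall>x\<in>verts K. \<forall>y\<in>verts K. G x y = B3 x y"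
    using IH[OF polytope_K _ _ linG plG] aff_dim_K by (auto simp: plate_def)
  \<comment> \<open>Projection along \<open>p\<close> onto the linear hyperplane
    \<open>h \<bullet> x = \<gamma> * (\<xi> \<bullet> x)\<close>. It fixes \<open>K\<close> and
    kills \<open>p\<close>, so the pulled-back form does not disturb the row of
    \<open>p\<close>.\<close>
  define \<pi> where "\<pi> x = x - ((h \<bullet> x - \<gamma> * (\<xi> \<bullet> x)) / (h \<bullet> p - \<gamma>)) *\<^sub>R p" for x
  have lpi: "linear \<pi>"
    by (rule linearI) (simp_all add: \<pi>_def inner_add_right algebra_simps add_divide_distrib diff_divide_distrib)
  have pip: "\<pi> p = 0" using hp xp by (simp add: \<pi>_def)
  have piK: "\<pi> x = x" if "x \<in> K" for x
  proof -
    have "h \<bullet> x = \<gamma>" "\<xi> \<bullet> x = 1" using that Q(2) by auto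
    then show ?thesis by (simp add: \<pi>_def)
  qed
  define B4 where "B4 x y = B3 (\<pi> x) (\<pi> y)" for x y
  have B4: "alternating B4" unfolding B4_def by (rule alternating_compose[OF B3(1) lpi])
  have B4p: "B4 p x = 0" "B4 x p = 0" for x by (simp_all add: B4_def pip alternatingD(11,12)[OF B3(1)])
  have GB4: "G y x = B4 y x" if y: "y \<in> verts K" and x: "x \<in> Q" for y x
  proof (rule linear_eq_on_affine_hull[OF linG[OF y] alternatingD(2)[OF B4]])
    show "x \<in> affine hull (insert p K)" using hull_inc[OF x, of affine] affine_hull_K by simp
    fix z assume "z \<in> insert p K"
    then show "G y z = B4 y z"
    proof
      \<comment> \<open>\<open>K\<close> spans \<open>Q\<close> only together with \<open>p\<close>.
        At \<open>p\<close> both sides vanish, since \<open>g\<close> and \<open>B0\<close> are skew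
        along the edge and have the same row at \<open>p\<close>.\<close>
      assume z: "z = p"
      have "g (qf y) p = - g p (qf y)" 
        using plates_alternate(2)[OF Q(1) d2 pl, where p = "qf y" and q = p] qt(1)[OF y] adj_commute by blast
      moreover have "B0 (qf y) p = - g p (qf y)" using alternatingD(10)[OF B0(1), of "qf y" p] B0(2) by simp
      ultimately show ?thesis using z B4p by (simp add: G_def)
    next
      assume z: "z \<in> K"
      have "y \<in> K" using y verts_subset by blast
      then show ?thesis using agree_on_polytope[OF polytope_K B3 y linG[OF y] z] piK z by (simp add: B4_def)
    qed
  qed
  define B where "B x y = B0 x y + B4 x y" for x y
  have "alternating B" unfolding B_def by (rule alternating_add[OF B0(1) B4])
  moreover have "g q x = B q x" if q: "q \<in> insert p {q. adj Q p q}" and x: "x \<in> Q" for q x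
  proof (cases "q = p")
    case True
    then show ?thesis using B0(2) B4p by (simp add: B_def)
  next
    case False
    then have a: "adj Q p q" using q by simp
    obtain y t where y: "y \<in> verts K" "closed_segment p q \<inter> {x. h \<bullet> x = \<gamma>} = {y}" using edge_point[OF a] by metis
    then have qy: "qf y = q" using edge_point_unique[OF qt(1)[OF y(1)] a] qt(5)[OF y(1)] by simp
    have "tf y * (g q x - B0 q x) = B4 y x" using GB4[OF y(1) x] by (simp add: G_def qy)
    also have "B4 y x = B4 (p + tf y *\<^sub>R (q - p)) x" using qt(4)[OF y(1)] qy by simp
    also have "\<dots> = tf y * B4 q x" using B4p by (simp add: alternatingD(4,6,8)[OF B4])
    finally show ?thesis using qt(2)[OF y(1)] by (simp add: B_def)
  qed
  ultimately show ?thesis by blast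
qed

text \<open>A proper face is the intersection of the facets containing it, and a single facet would
  be too large. A second one has a point off the affine hull of the first, so the two together
  span.\<close>

lemma two_facets_contain:
  fixes Q :: "'a::euclidean_space set"
  assumes Q: "polytope Q" and C: "C face_of Q" "C \<noteq> {}" "aff_dim C < aff_dim Q - 1"
  obtains D1 D2 where "D1 facet_of Q" "D2 facet_of Q" "C \<subseteq> D1" "C \<subseteq> D2"
    "affine hull (D1 \<union> D2) = affine hull Q"
proof -
  let ?S = "{F. F facet_of Q \<and> C \<subseteq> F}"
  have ph: "polyhedron Q" using Q polytope_imp_polyhedron by blast
  have "C \<noteq> Q" using C(3) by auto
  then have eq: "C = \<Inter>?S" using face_of_polyhedron[OF ph C(1,2)] by simp
  have "?S \<noteq> {}"
  proof
    assume "?S = {}"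
    then have "C = UNIV" using eq by (metis Inter_empty)
    then show False using \<open>C \<noteq> Q\<close> face_of_imp_subset[OF C(1)] by auto
  qed
  then obtain D1 where D1: "D1 facet_of Q" "C \<subseteq> D1" by blast
  have "\<exists>D2\<in>?S. D2 \<noteq> D1"
  proof (rule ccontr)
    assume "\<not> ?thesis"
    then have "?S = {D1}" using D1 by blast
    then have "\<Inter>?S = D1" by (metis cInf_singleton)
    then have "C = D1" using eq by (rule trans[rotated])
    then show False using D1(1) C(3) by (simp add: facet_of_def)
  qed
  then obtain D2 where D2: "D2 facet_of Q" "C \<subseteq> D2" "D2 \<noteq> D1" by blast
  have f: "D1 face_of Q" "D2 face_of Q" "aff_dim D1 = aff_dim Q - 1" "aff_dim D2 = aff_dim Q - 1"
    using D1 D2 by (auto simp: facet_of_def)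
  have sub: "D1 \<subseteq> Q" "D2 \<subseteq> Q" using f face_of_imp_subset by auto
  have "\<not> D2 \<subseteq> D1"
  proof
    assume "D2 \<subseteq> D1"
    then have "D2 face_of D1" using f(1,2) face_of_face by blast
    then have "aff_dim D2 < aff_dim D1" using face_of_aff_dim_lt[OF face_of_imp_convex[OF f(1)]] D2(3) by blast
    then show False using f by simp
  qed
  then obtain x where x: "x \<in> D2" "x \<notin> D1" by blast
  have "D1 = affine hull D1 \<inter> Q" using face_of_imp_eq_affine_Int[OF polytope_imp_convex[OF Q] f(1)] .
  then have "x \<notin> affine hull D1" using x sub by blast
  then have "aff_dim (insert x D1) = aff_dim Q" using f(3) by (simp add: aff_dim_insert)
  moreover have "aff_dim (insert x D1) \<le> aff_dim (D1 \<union> D2)" "aff_dim (D1 \<union> D2) \<le> aff_dim Q"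
    using x sub by (intro aff_dim_subset; blast)+
  ultimately have "aff_dim (D1 \<union> D2) = aff_dim Q" by simp
  then have "affine hull (D1 \<union> D2) = affine hull Q"
    using x sub by (intro affine_dim_equal affine_affine_hull hull_mono) auto
  then show ?thesis using that D1 D2 by blast
qed

theorem rigid_if_two_faces_rigid:
  fixes Q :: "'a::euclidean_space set" and \<xi> :: 'a
  assumes "polytope Q" "Q \<subseteq> {x. \<xi> \<bullet> x = 1}" "aff_dim Q \<ge> 3"
    and "\<And>x. x \<in> verts Q \<Longrightarrow> linear (g x)"
    and "\<And>C. C \<in> two_faces Q \<Longrightarrow> plate g (verts C)"
  shows "plate g (verts Q)"
  using assms
proof (induction "nat (aff_dim Q)" arbitrary: Q g rule: less_induct)
  case less
  note Q = less.prems(1,2) and lin = less.prems(4) and pl = less.prems(5)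
  show ?case
  proof (cases "aff_dim Q = 3")
    case True
    then show ?thesis using dehn_alexandrov[OF Q True lin pl] by blast
  next
    case False
    then have d: "aff_dim Q \<ge> 4" using less.prems(3) by simp
    have face: "plate g (verts D)" if D: "D face_of Q" "aff_dim D \<ge> 3" "aff_dim D < aff_dim Q" for D
    proof (rule less.hyps)
      show "nat (aff_dim D) < nat (aff_dim Q)" using D by simp
      show "polytope D" using face_of_polytope_polytope[OF Q(1) D(1)] .
      show "D \<subseteq> {x. \<xi> \<bullet> x = 1}" using face_of_imp_subset[OF D(1)] Q(2) by blast
      show "aff_dim D \<ge> 3" by fact
      show "linear (g x)" if "x \<in> verts D" for x using lin that verts_face[OF D(1)] by blast
      show "plate g (verts C)" if "C \<in> two_faces D" for C using pl that two_faces_face[OF D(1)] by blast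
    qed
    have star: "\<exists>B. alternating B \<and> (\<forall>q\<in>insert p {q. adj Q p q}. \<forall>x\<in>Q. g q x = B q x)" if p: "p \<in> verts Q" for p
    proof (rule star_rigid[OF Q d lin pl p])
      show "plate g (verts D)" if "D face_of Q" "aff_dim D = 3" for D using face[OF that(1)] that(2) d by simp
      fix K f
      assume K: "polytope K" "K \<subseteq> {x. \<xi> \<bullet> x = 1}" "aff_dim K = aff_dim Q - 1"
        "\<And>x. x \<in> verts K \<Longrightarrow> linear (f x)" "\<And>C. C \<in> two_faces K \<Longrightarrow> plate f (verts C)"
      show "plate f (verts K)" using K(3) d by (intro less.hyps[OF _ K(1,2) _ K(4,5)]) auto
    qed
    then obtain B where B: "\<And>p. p \<in> verts Q \<Longrightarrow> alternating (B p)"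
      "\<And>p q x. p \<in> verts Q \<Longrightarrow> q \<in> insert p {q. adj Q p q} \<Longrightarrow> x \<in> Q \<Longrightarrow> g q x = B p q x"
      by metis
    \<comment> \<open>The form at \<open>p\<close> and the form of the face have equal rows at
      \<open>p\<close> and at its neighbours in \<open>D\<close>, and these points span
      \<open>D\<close>.\<close>
    have on_face: "B p x y = BD x y"
      if p: "p \<in> verts Q" and D: "D face_of Q" "p \<in> D" and BD: "alternating BD" "\<forall>x\<in>verts D. \<forall>y\<in>verts D. g x y = BD x y"
        and xy: "x \<in> D" "y \<in> D" for p x y D BD
    proof -
      have pD: "polytope D" using face_of_polytope_polytope[OF Q(1) D(1)] .
      have vD: "verts D = verts Q \<inter> D" using verts_face[OF D(1)] .
      have pv: "p \<in> verts D" using p D vD by blast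
      obtain h \<gamma> where "vertex_figure D p h \<gamma>" using vertex_figure_exists[OF pD pv] by blast
      then interpret V: vertex_figure D p h \<gamma> .
      have "B p i y = BD i y" if i: "i \<in> insert p {q. adj D p q}" for i
      proof -
        have iD: "i \<in> verts D" using i pv adj_verts(2) by blast
        have "i \<in> insert p {q. adj Q p q}" using i adj_face[OF D(1)] by blast
        then have "g i y = B p i y" using B(2)[OF p] xy(2) face_of_imp_subset[OF D(1)] by blast
        moreover have "g i y = BD i y" using agree_on_polytope[OF pD BD iD lin xy(2)] iD vD by blast
        ultimately show ?thesis by simp
      qed
      then show ?thesis
        using linear_eq_on_affine_hull[OF alternatingD(3)[OF B(1)[OF p]] alternatingD(3)[OF BD(1)], of "insert p {q. adj D p q}" y y x]
          V.affine_hull_nbrs xy(1) hull_inc[of x D affine] by blast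
    qed
    \<comment> \<open>The form at \<open>p\<close> has the correct row even at vertices of
      \<open>C\<close> that are not adjacent to \<open>p\<close>: it is correct against each of two
      facets through \<open>C\<close>, and these span \<open>Q\<close>.\<close>
    have near: "g x y = B p x y" if p: "p \<in> verts Q" and C: "C \<in> two_faces Q" "p \<in> C" and x: "x \<in> verts C" and y: "y \<in> Q" for p C x y
    proof -
      have Cf: "C face_of Q" "aff_dim C = 2" using C by (auto simp: two_faces_def)
      have xQ: "x \<in> verts Q" using verts_face[OF Cf(1)] x by blast
      have xC: "x \<in> C" using x verts_subset by blast
      obtain D1 D2 where D: "D1 facet_of Q" "D2 facet_of Q" "C \<subseteq> D1" "C \<subseteq> D2"
        and aff: "affine hull (D1 \<union> D2) = affine hull Q"
        using two_facets_contain[OF Q(1) Cf(1)] C(2) Cf(2) d by auto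
      have "g x z = B p x z" if z: "z \<in> D" and D: "D facet_of Q" "C \<subseteq> D" for z D
      proof -
        have Df: "D face_of Q" "aff_dim D \<ge> 3" "aff_dim D < aff_dim Q" using D d by (auto simp: facet_of_def)
        obtain BD where BD: "alternating BD" "\<forall>x\<in>verts D. \<forall>y\<in>verts D. g x y = BD x y"
          using face[OF Df] by (auto simp: plate_def)
        have "x \<in> verts D" using verts_face[OF Df(1)] xQ xC D(2) by blast
        then have "g x z = BD x z"
          using agree_on_polytope[OF face_of_polytope_polytope[OF Q(1) Df(1)] BD _ lin[OF xQ] z] by blast
        moreover have "B p x z = BD x z" using on_face[OF p Df(1) _ BD _ z] C(2) D(2) xC by blast
        ultimately show ?thesis by simp
      qed
      then have "g x z = B p x z" if "z \<in> D1 \<union> D2" for z using D that by blast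
      then show ?thesis
        using linear_eq_on_affine_hull[OF lin[OF xQ] alternatingD(2)[OF B(1)[OF p]], of "D1 \<union> D2" x y]
          aff y hull_inc[of y Q affine] by blast
    qed
    \<comment> \<open>By \<open>near\<close> both forms have the rows of \<open>g\<close> at all
      vertices of the 2-faces through the edge, and those faces span \<open>Q\<close>.\<close>
    have glue: "B p x y = B q x y" if a: "adj Q p q" and x: "x \<in> Q" and y: "y \<in> Q" for p q x y
    proof -
      let ?U = "\<Union>{C \<in> two_faces Q. p \<in> C \<and> q \<in> C}"
      have pq: "p \<in> verts Q" "q \<in> verts Q" using adj_verts[OF a] by auto
      obtain h \<gamma> where "vertex_figure Q p h \<gamma>" using vertex_figure_exists[OF Q(1) pq(1)] by blast
      then interpret V: vertex_figure Q p h \<gamma> .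
      have U: "affine hull Q = affine hull ?U" using V.edge_two_faces_span(2)[OF _ a] d by simp
      note lB = alternatingD(3)[OF B(1)[OF pq(1)], of y] alternatingD(3)[OF B(1)[OF pq(2)], of y]
      have "B p z y = B q z y" if z: "z \<in> ?U" for z
      proof -
        obtain C where C: "C \<in> two_faces Q" "p \<in> C" "q \<in> C" "z \<in> C" using z by blast
        have "polytope C" using C(1) face_of_polytope_polytope[OF Q(1)] by (auto simp: two_faces_def)
        then have "z \<in> affine hull (verts C)" using affine_hull_verts C(4) hull_inc by metis
        then show ?thesis
          by (rule linear_eq_on_affine_hull[OF lB, rotated])
            (use near[OF pq(1) C(1,2) _ y] near[OF pq(2) C(1,3) _ y] in simp)
      qed
      moreover have "x \<in> affine hull ?U" unfolding U[symmetric] by (rule hull_inc[OF x])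
      ultimately show ?thesis by (rule linear_eq_on_affine_hull[OF lB])
    qed
    have "Q \<noteq> {}" using d by auto
    then obtain p0 where p0: "p0 \<in> verts Q" using polytope_eq_hull_verts[OF Q(1)] by fastforce
    have all: "\<forall>x\<in>Q. \<forall>y\<in>Q. B p x y = B p0 x y" if p: "p \<in> verts Q" for p
      using graph_connected[OF Q(1) p0 p]
    proof (induction rule: rtrancl_induct)
      case (step y z)
      then show ?case using glue[of y z] by auto
    qed simp
    have "g p y = B p0 p y" if v: "p \<in> verts Q" "y \<in> verts Q" for p y
    proof -
      have Qm: "p \<in> Q" "y \<in> Q" using v verts_subset by auto
      have "g p y = B p p y" by (rule B(2)[OF v(1) insertI1 Qm(2)])
      also have "\<dots> = B p0 p y" using all[OF v(1)] Qm by simp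
      finally show ?thesis .
    qed
    then show ?thesis unfolding plate_def using B(1)[OF p0] by blast
  qed
qed

section \<open>Frameworks in quadrics\<close>

lemma independent_if_affine_independent:
  fixes S :: "'a::euclidean_space set"
  assumes "\<not> affine_dependent S" "S \<subseteq> {x. \<xi> \<bullet> x = 1}"
  shows "independent S"
proof
  have fin: "finite S" using assms(1) aff_independent_finite by blast
  assume "dependent S"
  then obtain u v where u: "v \<in> S" "u v \<noteq> 0" "(\<Sum>v\<in>S. u v *\<^sub>R v) = 0"
    using dependent_finite[OF fin] by auto
  have "(\<Sum>v\<in>S. u v) = (\<Sum>v\<in>S. u v * (\<xi> \<bullet> v))"
    using assms(2) by (intro sum.cong) auto
  also have "\<dots> = \<xi> \<bullet> (\<Sum>v\<in>S. u v *\<^sub>R v)" by (simp add: inner_sum_right)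
  finally have "(\<Sum>v\<in>S. u v) = 0" using u(3) by simp
  then show False using assms(1) u unfolding affine_dependent_explicit_finite[OF fin] by blast
qed

lemma alternating_on_three:
  fixes a b c :: "'a::euclidean_space"
  assumes ind: "independent {a, b, c}" and ne: "a \<noteq> b" "a \<noteq> c" "b \<noteq> c"
  obtains B where "alternating B" "B a b = r" "B a c = s" "B b c = (t :: real)"
proof -
  have ext: "\<exists>f. linear f \<and> f a = x \<and> f b = y \<and> f c = (z :: real)" for x y z
  proof -
    obtain f where f: "linear f" "\<forall>v\<in>{a, b, c}. f v = (if v = a then x else if v = b then y else z)"
      using linear_independent_extend[OF ind, of "\<lambda>v. if v = a then x else if v = b then y else z"] by blast
    have "f a = x \<and> f b = y \<and> f c = z" using f(2) ne by auto
    then show ?thesis using f(1) by blast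
  qed
  \<comment> \<open>With \<open>f1\<close> and \<open>f3\<close> dual to \<open>a\<close> and
    \<open>b\<close>, the first wedge realises \<open>r\<close> and \<open>s\<close> and vanishes on
    \<open>b\<close>, \<open>c\<close>; the second realises \<open>t\<close> and vanishes on the
    other pairs.\<close>
  obtain f1 :: "'a \<Rightarrow> real" where f1: "linear f1" "f1 a = 1" "f1 b = 0" "f1 c = 0" using ext by blast
  obtain f2 :: "'a \<Rightarrow> real" where f2: "linear f2" "f2 a = 0" "f2 b = r" "f2 c = s" using ext by blast
  obtain f3 :: "'a \<Rightarrow> real" where f3: "linear f3" "f3 a = 0" "f3 b = 1" "f3 c = 0" using ext by blast
  obtain f4 :: "'a \<Rightarrow> real" where f4: "linear f4" "f4 a = 0" "f4 b = 0" "f4 c = t" using ext by blast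
  have "alternating (\<lambda>x y. (f1 x * f2 y - f1 y * f2 x) + (f3 x * f4 y - f3 y * f4 x))"
    by (intro alternating_add alternating_wedge f1 f2 f3 f4)
  then show ?thesis by (rule that) (simp_all add: f1 f2 f3 f4)
qed

text \<open>Here the triangulation enters: the vertices of a triangle in a hyperplane off the origin
  are linearly independent, so any three edge values are those of an alternating form.\<close>

lemma triangle_plate:
  fixes C :: "'a::euclidean_space set"
  assumes C: "2 simplex C" "C \<subseteq> {x. \<xi> \<bullet> x = 1}"
    and diag: "\<And>x. x \<in> verts C \<Longrightarrow> g x x = 0" and adj: "\<And>x y. adj C x y \<Longrightarrow> g x y = - g y x"
  shows "plate g (verts C)"
proof -
  obtain S where S: "\<not> affine_dependent S" "int (card S) = 3" "C = convex hull S"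
    using C(1) by (auto simp: simplex_def)
  then obtain a b c where abc: "S = {a, b, c}" "a \<noteq> b" "a \<noteq> c" "b \<noteq> c"
    using card_3_iff[of S] by auto
  have v: "verts C = {a, b, c}"
    using extreme_point_of_convex_hull_affine_independent[OF S(1)] S(3) abc(1) by (auto simp: verts_def)
  have e: "adj C x y" if "x \<in> S" "y \<in> S" "x \<noteq> y" for x y
  proof -
    have "convex hull {x, y} face_of convex hull S"
      unfolding face_of_convex_hull_affine_independent[OF S(1)]
      using that by (intro exI[of _ "{x, y}"]) simp
    moreover have "aff_dim (convex hull {x, y}) = 1" unfolding aff_dim_convex_hull using that(3) by simp
    ultimately show ?thesis unfolding adj_def edge_of_def segment_convex_hull S(3) by blast
  qed
  have "S \<subseteq> {x. \<xi> \<bullet> x = 1}"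
    using hull_subset[of S convex] C(2)[unfolded S(3)] by (rule order_trans)
  then have "independent S" by (rule independent_if_affine_independent[OF S(1)])
  then have ind: "independent {a, b, c}" using abc(1) by simp
  obtain B where B: "alternating B" "B a b = g a b" "B a c = g a c" "B b c = g b c"
    by (rule alternating_on_three[OF ind abc(2,3,4), of "g a b" "g a c" "g b c"]) (rule that)
  have sk: "g y x = B y x" if "x \<in> S" "y \<in> S" "x \<noteq> y" "g x y = B x y" for x y
  proof -
    have "g y x = - g x y" by (rule adj[OF e[OF that(2,1)]]) (use that(3) in simp)
    then show ?thesis using that(4) alternatingD(10)[OF B(1), of y x] by simp
  qed
  have "g x x = B x x" if "x \<in> S" for x using diag v that abc alternatingD(1)[OF B(1)] by simp
  moreover have "g b a = B b a" "g c a = B c a" "g c b = B c b"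
    by (rule sk; simp add: abc B)+
  ultimately show ?thesis unfolding plate_def v using B abc(1) by (intro exI[of _ B]) auto
qed

text \<open>The sign matrix of the form. It reduces \<open>form k\<close> to the Euclidean inner
  product, and as an involution it gives nondegeneracy.\<close>

definition sig :: "nat \<Rightarrow> real ^ ('m::{finite,linorder}) \<Rightarrow> real ^ ('m::{finite,linorder})" where
  "sig k x = (\<chi> i. if coord_pos i \<le> CARD('m) - k then x $ i else - x $ i)"

lemma form_eq: "form k x y = sig k x \<bullet> y" for x :: "real ^ ('m::{finite,linorder})"
proof -
  let ?A = "{i :: 'm. coord_pos i \<le> CARD('m) - k}"
  have "sig k x \<bullet> y = (\<Sum>i\<in>UNIV. if i \<in> ?A then x $ i * y $ i else - (x $ i * y $ i))"
    by (auto simp: inner_vec_def sig_def intro!: sum.cong)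
  also have "\<dots> = (\<Sum>i\<in>?A. x $ i * y $ i) + (\<Sum>i\<in>-?A. - (x $ i * y $ i))"
    by (simp add: sum.If_cases)
  also have "-?A = {i. CARD('m) - k < coord_pos i}" by auto
  finally show ?thesis by (simp add: form_def sum_negf)
qed

lemma sig_sig: "sig k (sig k x) = x" by (simp add: sig_def vec_eq_iff)

lemma form_commute: "form k x y = form k y x" by (simp add: form_def mult.commute)

lemma form_simps:
  "form k (x + y) z = form k x z + form k y z" "form k z (x + y) = form k z x + form k z y"
  "form k (c *\<^sub>R x) z = c * form k x z" "form k z (c *\<^sub>R x) = c * form k z x"
proof -
  show r: "form k z (x + y) = form k z x + form k z y" "form k z (c *\<^sub>R x) = c * form k z x" for x y z
    by (simp_all add: form_eq inner_add_right)
  show "form k (x + y) z = form k x z + form k y z" "form k (c *\<^sub>R x) z = c * form k x z"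
    using r form_commute[of k _ z] by simp_all
qed

lemma form_nondegenerate:
  assumes "\<And>x. form k u x = form k w x" shows "u = w"
proof -
  have "(sig k u - sig k w) \<bullet> (sig k u - sig k w) = 0"
    using assms by (simp only: inner_diff_left form_eq diff_self)
  then have "sig k u = sig k w" by simp
  then show ?thesis by (metis sig_sig)
qed

lemma form_represents_alternating:
  fixes B :: "real ^ ('m::{finite,linorder}) \<Rightarrow> real ^ ('m::{finite,linorder}) \<Rightarrow> real"
  assumes "alternating B"
  shows "\<exists>w. \<forall>x y. form k (w x) y = B x y"
proof -
  have "\<exists>v. \<forall>y. B x y = v \<bullet> y" for x
    by (rule linear_functional_representation[OF alternatingD(2)[OF assms]])
  then obtain v where v: "\<And>x y. B x y = v x \<bullet> y" by metis
  have "form k (sig k (v x)) y = B x y" for x y by (simp add: form_eq sig_sig v)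
  then show ?thesis by (intro exI[of _ "\<lambda>x. sig k (v x)"]) simp
qed

text \<open>Points with the same projection are positive multiples of one vector \<open>z\<close>.
  As \<open>c\<close> is nonzero, \<open>z\<close> is not null, so equal values of the form force
  equal factors.\<close>

lemma central_proj_inj:
  assumes "c \<noteq> 0" shows "inj_on central_proj (space_X c k)"
proof (rule inj_onI)
  fix x y :: "real ^ ('m::{finite,linorder})"
  assume x: "x \<in> space_X c k" and y: "y \<in> space_X c k" and eq: "central_proj x = central_proj y"
  define z where "z = central_proj x"
  have l: "last_coord x > 0" "last_coord y > 0" and f: "form k x x = c" "form k y y = c"
    using x y by (auto simp: space_X_def)
  have xz: "x = last_coord x *\<^sub>R z" using l by (simp add: z_def central_proj_def)
  have yz: "y = last_coord y *\<^sub>R z" using l eq by (simp add: z_def central_proj_def)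
  have "last_coord x * (last_coord x * form k z z) = c" using f(1) xz by (metis form_simps(3,4))
  moreover have "last_coord y * (last_coord y * form k z z) = c" using f(2) yz by (metis form_simps(3,4))
  ultimately have "(last_coord x)\<^sup>2 * form k z z = (last_coord y)\<^sup>2 * form k z z" "form k z z \<noteq> 0"
    using assms by (auto simp: power2_eq_square mult.assoc)
  then have "last_coord x = last_coord y" using l by simp
  then show "x = y" using xz yz by simp
qed

theorem mainTheorem5:
  fixes n k :: nat and c :: real
    and P :: "(real ^ ('m::{finite,linorder})) set"
  assumes "CARD('m) = n + 1" and "n \<ge> 3" and "k \<le> n + 1" and "c \<noteq> 0"
    and "convex_triangulated_polytope c k P"
  shows "first_order_rigid c k (polytope_vertices P) (polytope_edges P) (\<lambda>v. v)"
proof -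
  define Q where "Q = central_proj ` P"
  define \<xi> :: "(real, 'm) vec" where "\<xi> = axis (Max UNIV) 1"
  define V where "V = polytope_vertices P"
  have PX: "P \<subseteq> space_X c k" and Q: "polytope Q" "aff_dim Q = int n"
    and tri: "\<And>F. F face_of Q \<Longrightarrow> aff_dim F = 2 \<Longrightarrow> 2 simplex F"
    using assms(1,5) by (auto simp: convex_triangulated_polytope_def Q_def)
  have xi: "\<xi> \<bullet> x = last_coord x" for x by (simp add: \<xi>_def last_coord_def inner_axis')
  have lP: "last_coord v > 0" if "v \<in> P" for v using PX that by (auto simp: space_X_def)
  have "\<xi> \<bullet> central_proj v = 1" if "v \<in> P" for v
    using lP[OF that] by (simp add: central_proj_def xi)
  then have Qxi: "Q \<subseteq> {x. \<xi> \<bullet> x = 1}" by (auto simp: Q_def)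
  have d2: "aff_dim Q \<ge> 2" using Q(2) assms(2) by simp
  have inj: "inj_on central_proj P" using central_proj_inj[OF assms(4)] PX inj_on_subset by blast
  define lift where "lift = inv_into P central_proj"
  have lift: "lift y \<in> P" "central_proj (lift y) = y" if "y \<in> Q" for y
    using that by (auto simp: lift_def Q_def inv_into_into f_inv_into_f)
  have lift_proj: "lift (central_proj v) = v" if "v \<in> P" for v
    using that inj by (simp add: lift_def)
  have Viff: "v \<in> V \<longleftrightarrow> v \<in> P \<and> central_proj v \<in> verts Q" for v
    by (simp add: V_def polytope_vertices_def verts_def Q_def)
  have VP: "V \<subseteq> P" using Viff by blast
  have edges: "polytope_edges P = {{v, w} | v w. v \<in> V \<and> w \<in> V \<and> adj Q (central_proj v) (central_proj w)}"
    by (simp add: polytope_edges_def V_def adj_def Q_def)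
  have "finite V"
  proof (rule finite_imageD)
    show "finite (central_proj ` V)"
      by (rule finite_subset[OF _ finite_verts[OF Q(1)]]) (use Viff in blast)
    show "inj_on central_proj V" using inj VP inj_on_subset by blast
  qed
  moreover have "e \<subseteq> V \<and> card e = 2" if eP: "e \<in> polytope_edges P" for e
  proof -
    obtain v w where e: "e = {v, w}" "v \<in> V" "w \<in> V" "adj Q (central_proj v) (central_proj w)"
      using eP unfolding edges by blast
    have "v \<noteq> w" using adj_neq[OF e(4)] by blast
    then show ?thesis using e by simp
  qed
  ultimately have fw: "framework c k V (polytope_edges P) (\<lambda>v. v)"
    using VP PX by (auto simp: framework_def)
  have "\<exists>w. trivial_motion c k w \<and> (\<forall>v\<in>V. u v = w v)"
    if "first_order_motion k V (polytope_edges P) (\<lambda>v. v) u" for u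
  proof -
    have u1: "form k v (u w) + form k w (u v) = 0" if "{v, w} \<in> polytope_edges P" for v w
      using \<open>first_order_motion _ _ _ _ _\<close> that by (simp add: first_order_motion_def)
    have u2: "form k v (u v) = 0" if "v \<in> V" for v
      using \<open>first_order_motion _ _ _ _ _\<close> that by (simp add: first_order_motion_def)
    \<comment> \<open>The division matches the scaling of the projected vertex. Both ends of an edge
      then get the common factor \<open>1 / (last_coord v * last_coord w)\<close>, which preserves
      skewness.\<close>
    define g where "g y x = form k (u (lift y)) x / last_coord (lift y)" for y x
    have lin: "linear (g y)" for y
      by (rule linearI) (simp_all add: g_def form_simps add_divide_distrib)
    have g_proj: "g (central_proj v) (central_proj w) = form k (u v) w / (last_coord v * last_coord w)"
      if "v \<in> P" for v w
      using lift_proj[OF that] by (simp add: g_def central_proj_def[of w] form_simps divide_simps)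
    have vert: "\<exists>v\<in>V. y = central_proj v" if "y \<in> verts Q" for y
      using lift[of y] that verts_subset[of Q] Viff by (metis subsetD)
    have g0: "g y y = 0" if y: "y \<in> verts Q" for y
    proof -
      obtain v where "v \<in> V" "y = central_proj v" using vert[OF y] by blast
      then show ?thesis using g_proj[of v v] u2[of v] VP form_commute[of k v "u v"] by auto
    qed
    have gadj: "g y x = - g x y" if a: "adj Q y x" for y x
    proof -
      obtain v w where vw: "v \<in> V" "y = central_proj v" "w \<in> V" "x = central_proj w"
        using vert adj_verts[OF a] by metis
      then have "{v, w} \<in> polytope_edges P" using a unfolding edges by blast
      from u1[OF this] have eq: "form k (u v) w = - form k (u w) v"
        using form_commute[of k w "u v"] form_commute[of k v "u w"] by simp
      have "v \<in> P" "w \<in> P" using vw VP by blast+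
      then show ?thesis unfolding vw(2,4) using g_proj[of v w] g_proj[of w v] eq by (simp add: mult.commute)
    qed
    have "plate g (verts C)" if C: "C \<in> two_faces Q" for C
    proof (rule triangle_plate)
      have Cf: "C face_of Q" "aff_dim C = 2" using C by (auto simp: two_faces_def)
      show "2 simplex C" by (rule tri[OF Cf])
      show "C \<subseteq> {x. \<xi> \<bullet> x = 1}" using face_of_imp_subset[OF Cf(1)] Qxi by blast
      show "g x x = 0" if "x \<in> verts C" for x using g0 that verts_face[OF Cf(1)] by blast
      show "g x y = - g y x" if "adj C x y" for x y using gadj that adj_face[OF Cf(1)] by blast
    qed
    then have "plate g (verts Q)"
      using rigid_if_two_faces_rigid[OF Q(1) Qxi _ lin] Q(2) assms(2) by simp
    then obtain B where B: "alternating B" "\<forall>x\<in>verts Q. \<forall>y\<in>verts Q. g x y = B x y"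
      by (auto simp: plate_def)
    obtain w where w: "\<And>x y. form k (w x) y = B x y"
      using form_represents_alternating[OF B(1)] by blast
    have "form k x (w y) + form k y (w x) = 0" for x y
      using w[of y x] w[of x y] alternatingD(10)[OF B(1), of x y] form_commute[of k x "w y"] form_commute[of k y "w x"] by simp
    moreover have "form k z (w z) = 0" for z
      using w[of z z] alternatingD(1)[OF B(1)] form_commute[of k z "w z"] by simp
    ultimately have "trivial_motion c k w" by (simp add: trivial_motion_def)
    \<comment> \<open>\<open>B\<close> is known to match \<open>g\<close> on vertices only. But
      \<open>Q\<close> is \<open>n\<close>-dimensional in a hyperplane off the origin, so it spans
      the whole space linearly, and the functionals of \<open>u v\<close> and \<open>w v\<close>
      coincide.\<close>
    moreover have "u v = w v" if v: "v \<in> V" for v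
    proof (rule form_nondegenerate)
      fix x
      define y where "y = central_proj v"
      have y: "y \<in> verts Q" "lift y = v" "last_coord v > 0" and vP: "v \<in> P"
        using v Viff[of v] lift_proj lP by (auto simp: y_def)
      have vy: "v = last_coord v *\<^sub>R y" using y(3) by (simp add: y_def central_proj_def)
      have "affine hull Q \<subseteq> {x. \<xi> \<bullet> x = 1}" using Qxi by (intro hull_minimal affine_hyperplane)
      then have "0 \<notin> affine hull Q" by auto
      then have "aff_dim (insert 0 Q) = int DIM((real, 'm) vec)" using Q(2) assms(1) by (simp add: aff_dim_insert)
      then have full: "x \<in> affine hull (insert 0 Q)" using aff_dim_eq_full by (metis UNIV_I)
      have "g y x = B y x"
      proof (rule linear_eq_on_affine_hull[OF lin alternatingD(2)[OF B(1)] _ full])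
        fix z assume "z \<in> insert 0 Q"
        then show "g y z = B y z"
          using agree_on_polytope[OF Q(1) B y(1) lin] linear_0[OF lin] alternatingD(12)[OF B(1)] by auto
      qed
      then have "form k (u v) x = last_coord v * B y x" using y by (simp add: g_def field_simps)
      also have "\<dots> = B v x" using vy alternatingD(8)[OF B(1)] by metis
      finally show "form k (u v) x = form k (w v) x" using w by simp
    qed
    ultimately show ?thesis by blast
  qed
  then show ?thesis using fw unfolding first_order_rigid_def V_def by simp
qed

end
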